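(* Let $\varphi:\,]a,b[\,\to\mathbb{R}$ be a strictly increasing function satisfying $\dddot\varphi\le 0$, and let $\psi:\Sigma\to\mathbb{R}^2\times]a,b[$ be a $2$-dimensional locally convex $[\varphi,\vec e_3]$-minimal immersion. If the Gauss curvature $K$ vanishes anywhere, then $K$ vanishes everywhere.
   Context: The function $\varphi$ is smooth, and a dot denotes its derivative with respect to its (height) variable. The immersion $\psi$ of the surface $\Sigma$ (maybe with non-empty boundary) has Gauss map $N$ and vector-valued second fundamental form $\mathbf{A}$; its scalar second fundamental form is $\mathcal{A}(X,Y)=-\langle\mathbf{A}(X,Y),N\rangle$, and the mean curvature vector $\mathbf{H}$ is the trace of $\mathbf{A}$ with respect to the induced metric. The immersion is $[\varphi,\vec e_3]$-minimal if $\mathbf{H}=\dot\varphi\,\vec e_3^{\,\perp}$, where $\perp$ is the projection to the normal bundle, $\vec e_3=(0,0,1)$, and $\dot\varphi$ is evaluated at the height of the point. Locally convex means that the Gauss map $N$ can be chosen so that $\mathcal{A}$ is positive semi-definite. $K$ is the Gauss curvature of $\psi$.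
   Formalization: Σ is assumed connected, and "K vanishes anywhere" means at an interior point of Σ: if K vanishes only on the boundary the claim fails (outer convex part of a winglike rotational translator, φ(t)=t); the conclusion still covers boundary points. *)

theory Defs
  imports "HOL-Analysis.Analysis"
begin

section \<open>Smooth maps between Euclidean spaces\<close>

text \<open>\<open>Ck_on k f S\<close> is intended for open \<open>S\<close> only.\<close>

primrec Ck_on ::
  "nat \<Rightarrow> ('a::euclidean_space \<Rightarrow> 'b::real_normed_vector) \<Rightarrow> 'a set \<Rightarrow> bool" where
  "Ck_on 0 f S \<longleftrightarrow> continuous_on S f"
| "Ck_on (Suc k) f S \<longleftrightarrow>
     (\<forall>x\<in>S. f differentiable (at x)) \<and>
     (\<forall>v. Ck_on k (\<lambda>x. frechet_derivative f (at x) v) S)"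

text \<open>On an arbitrary set, smoothness means the existence of local \<open>C\<^sup>\<infinity>\<close>
  extensions to open sets; this is needed at the boundary of the half-plane.\<close>

definition smooth_on ::
  "'a::euclidean_space set \<Rightarrow> ('a \<Rightarrow> 'b::real_normed_vector) \<Rightarrow> bool" where
  "smooth_on S f \<longleftrightarrow>
     (\<forall>x\<in>S. \<exists>V g. open V \<and> x \<in> V \<and> (\<forall>k. Ck_on k g V) \<and> (\<forall>y\<in>S \<inter> V. g y = f y))"


section \<open>Smooth surfaces with (possibly empty) boundary\<close>

text \<open>A chart is a domain together with a coordinate map; values of the
  coordinate map outside the domain are irrelevant.\<close>

type_synonym 'a chart = "'a set \<times> ('a \<Rightarrow> real^2)"

definition half_plane :: "(real^2) set" where
  "half_plane = {x. 0 \<le> x $ 2}"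

definition chart_image :: "'a chart \<Rightarrow> (real^2) set" where
  "chart_image \<kappa> = snd \<kappa> ` fst \<kappa>"

definition in_chart :: "'a chart \<Rightarrow> ('a \<Rightarrow> 'b) \<Rightarrow> real^2 \<Rightarrow> 'b" where
  "in_chart \<kappa> f = f \<circ> inv_into (fst \<kappa>) (snd \<kappa>)"

definition surface_chart :: "'a topology \<Rightarrow> 'a chart \<Rightarrow> bool" where
  "surface_chart M \<kappa> \<longleftrightarrow>
     openin M (fst \<kappa>) \<and>
     openin (top_of_set half_plane) (chart_image \<kappa>) \<and>
     homeomorphic_map (subtopology M (fst \<kappa>)) (top_of_set (chart_image \<kappa>)) (snd \<kappa>)"

definition smooth_surface :: "'a topology \<Rightarrow> 'a chart set \<Rightarrow> bool" where
  "smooth_surface M \<A> \<longleftrightarrow>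
     Hausdorff_space M \<and> second_countable M \<and>
     (\<forall>\<kappa>\<in>\<A>. surface_chart M \<kappa>) \<and>
     (\<Union>\<kappa>\<in>\<A>. fst \<kappa>) = topspace M \<and>
     (\<forall>\<kappa>\<in>\<A>. \<forall>\<mu>\<in>\<A>. smooth_on (snd \<kappa> ` (fst \<kappa> \<inter> fst \<mu>)) (in_chart \<kappa> (snd \<mu>)))"

definition surface_interior :: "'a chart set \<Rightarrow> 'a set" where
  "surface_interior \<A> = {p. \<exists>\<kappa>\<in>\<A>. p \<in> fst \<kappa> \<and> 0 < snd \<kappa> p $ 2}"

definition smooth_map :: "'a chart set \<Rightarrow> ('a \<Rightarrow> 'b::real_normed_vector) \<Rightarrow> bool" where
  "smooth_map \<A> f \<longleftrightarrow> (\<forall>\<kappa>\<in>\<A>. smooth_on (chart_image \<kappa>) (in_chart \<kappa> f))"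

text \<open>A tangent vector at \<open>p\<close> is represented by its coordinates \<open>v\<close> in a chart
  around \<open>p\<close>. The derivative is taken within the image of the chart because \<open>p\<close> may
  be a boundary point.\<close>

definition differential ::
  "'a chart \<Rightarrow> ('a \<Rightarrow> 'b::real_normed_vector) \<Rightarrow> 'a \<Rightarrow> real^2 \<Rightarrow> 'b" where
  "differential \<kappa> f p v =
     frechet_derivative (in_chart \<kappa> f) (at (snd \<kappa> p) within chart_image \<kappa>) v"


section \<open>Immersed surfaces in Euclidean 3-space\<close>

definition immersion :: "'a chart set \<Rightarrow> ('a \<Rightarrow> real^3) \<Rightarrow> bool" where
  "immersion \<A> \<psi> \<longleftrightarrow>
     smooth_map \<A> \<psi> \<and> (\<forall>\<kappa>\<in>\<A>. \<forall>p\<in>fst \<kappa>. inj (differential \<kappa> \<psi> p))"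

definition tangent_plane :: "'a chart \<Rightarrow> ('a \<Rightarrow> real^3) \<Rightarrow> 'a \<Rightarrow> (real^3) set" where
  "tangent_plane \<kappa> \<psi> p = range (differential \<kappa> \<psi> p)"

text \<open>Orthogonal projection to the normal line of the surface at \<open>p\<close>.\<close>

definition normal_part :: "'a chart \<Rightarrow> ('a \<Rightarrow> real^3) \<Rightarrow> 'a \<Rightarrow> real^3 \<Rightarrow> real^3" where
  "normal_part \<kappa> \<psi> p X =
     (THE n. n \<in> orthogonal_comp (tangent_plane \<kappa> \<psi> p) \<and> X - n \<in> tangent_plane \<kappa> \<psi> p)"

definition first_ff :: "'a chart \<Rightarrow> ('a \<Rightarrow> real^3) \<Rightarrow> 'a \<Rightarrow> real^2 \<Rightarrow> real^2 \<Rightarrow> real" where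
  "first_ff \<kappa> \<psi> p v w = differential \<kappa> \<psi> p v \<bullet> differential \<kappa> \<psi> p w"

text \<open>\<open>\<^bold>A(X,Y) = (D\<^sub>X Y)\<^sup>\<bottom>\<close>, with \<open>Y\<close> extended to the field having constant
  coordinates \<open>w\<close> in the chart.\<close>

definition second_ff ::
  "'a chart \<Rightarrow> ('a \<Rightarrow> real^3) \<Rightarrow> 'a \<Rightarrow> real^2 \<Rightarrow> real^2 \<Rightarrow> real^3" where
  "second_ff \<kappa> \<psi> p v w =
     normal_part \<kappa> \<psi> p (differential \<kappa> (\<lambda>q. differential \<kappa> \<psi> q w) p v)"

definition scalar_second_ff ::
  "'a chart \<Rightarrow> ('a \<Rightarrow> real^3) \<Rightarrow> real^3 \<Rightarrow> 'a \<Rightarrow> real^2 \<Rightarrow> real^2 \<Rightarrow> real" where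
  "scalar_second_ff \<kappa> \<psi> n p v w = - (second_ff \<kappa> \<psi> p v w \<bullet> n)"

definition first_ff_matrix :: "'a chart \<Rightarrow> ('a \<Rightarrow> real^3) \<Rightarrow> 'a \<Rightarrow> real^2^2" where
  "first_ff_matrix \<kappa> \<psi> p = (\<chi> i j. first_ff \<kappa> \<psi> p (axis i 1) (axis j 1))"

definition mean_curvature_vector :: "'a chart \<Rightarrow> ('a \<Rightarrow> real^3) \<Rightarrow> 'a \<Rightarrow> real^3" where
  "mean_curvature_vector \<kappa> \<psi> p =
     (\<Sum>i\<in>UNIV. \<Sum>j\<in>UNIV.
        (matrix_inv (first_ff_matrix \<kappa> \<psi> p) $ i $ j) *\<^sub>R second_ff \<kappa> \<psi> p (axis i 1) (axis j 1))"

definition gauss_map :: "'a chart set \<Rightarrow> ('a \<Rightarrow> real^3) \<Rightarrow> ('a \<Rightarrow> real^3) \<Rightarrow> bool" where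
  "gauss_map \<A> \<psi> N \<longleftrightarrow>
     smooth_map \<A> N \<and>
     (\<forall>\<kappa>\<in>\<A>. \<forall>p\<in>fst \<kappa>. norm (N p) = 1 \<and> N p \<in> orthogonal_comp (tangent_plane \<kappa> \<psi> p))"

definition locally_convex :: "'a chart set \<Rightarrow> ('a \<Rightarrow> real^3) \<Rightarrow> bool" where
  "locally_convex \<A> \<psi> \<longleftrightarrow>
     (\<exists>N. gauss_map \<A> \<psi> N \<and>
          (\<forall>\<kappa>\<in>\<A>. \<forall>p\<in>fst \<kappa>. \<forall>v. 0 \<le> scalar_second_ff \<kappa> \<psi> (N p) p v v))"

definition phi_minimal :: "'a chart set \<Rightarrow> (real \<Rightarrow> real) \<Rightarrow> ('a \<Rightarrow> real^3) \<Rightarrow> bool" where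
  "phi_minimal \<A> \<phi> \<psi> \<longleftrightarrow>
     (\<forall>\<kappa>\<in>\<A>. \<forall>p\<in>fst \<kappa>.
        mean_curvature_vector \<kappa> \<psi> p =
          deriv \<phi> (\<psi> p $ 3) *\<^sub>R normal_part \<kappa> \<psi> p (axis 3 1))"

text \<open>The Gauss curvature is the determinant of the shape operator \<open>g\<^sup>-\<^sup>1 h\<close>. Replacing
  the unit normal by its opposite does not change it, so the unit normal determined by
  the orientation of the chart may be used. The value does not depend on the chart either,
  so some chart around \<open>p\<close> is chosen.\<close>

definition chart_normal :: "'a chart \<Rightarrow> ('a \<Rightarrow> real^3) \<Rightarrow> 'a \<Rightarrow> real^3" where
  "chart_normal \<kappa> \<psi> p =
     sgn (cross3 (differential \<kappa> \<psi> p (axis 1 1)) (differential \<kappa> \<psi> p (axis 2 1)))"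

definition chart_gauss_curvature :: "'a chart \<Rightarrow> ('a \<Rightarrow> real^3) \<Rightarrow> 'a \<Rightarrow> real" where
  "chart_gauss_curvature \<kappa> \<psi> p =
     det (matrix_inv (first_ff_matrix \<kappa> \<psi> p) **
          (\<chi> i j. scalar_second_ff \<kappa> \<psi> (chart_normal \<kappa> \<psi> p) p (axis i 1) (axis j 1)))"

definition gauss_curvature :: "'a chart set \<Rightarrow> ('a \<Rightarrow> real^3) \<Rightarrow> 'a \<Rightarrow> real" where
  "gauss_curvature \<A> \<psi> p =
     chart_gauss_curvature (SOME \<kappa>. \<kappa> \<in> \<A> \<and> p \<in> fst \<kappa>) \<psi> p"

end

theory Submission
  imports Defs
begin

text \<open>Near a point the surface is the graph of a function \<open>u\<close> over its tangent plane; local convexity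
  makes the Hessian of \<open>u\<close> positive semi-definite, and \<open>K\<close> vanishes where its determinant \<open>D\<close> does.
  Where the Hessian has rank one, differentiating the mean curvature equation twice and
  contracting with the cofactor matrix of the Hessian yields
  \<open>a\<^sup>i\<^sup>j D\<^sub>i\<^sub>j \<le> c\<^sub>0 D + c\<^sub>i D\<^sub>i\<close>; the only term not controlled by \<open>D\<close> and its gradient contains the third
  derivative of \<open>\<phi>\<close> and has the right sign. Where the Hessian vanishes, the vertical component \<open>v\<close>
  of the normal is nonnegative, vanishes there and solves a linear elliptic equation.
  In both cases Hopf's strong maximum principle shows that the zero set of \<open>K\<close> is
  open. Chart by chart, connectedness of half balls carries this to the boundary.\<close>

section \<open>Smooth functions\<close>

text \<open>Signs come first: a nonnegative second fundamental form and a positive derivative of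
  \<open>\<phi>\<close> make \<open>v\<close>, the vertical component of the normal opposite to
  \<open>N\<close>, nonnegative. Strict monotonicity alone does not give this positive derivative,
  and the flat case needs it, so it is extracted from the sign of the third derivative. The operator
  applied to \<open>D\<close> produces fourth derivatives and a quadratic expression in third
  derivatives. The fourth ones are symmetric in all indices, so they can be regrouped into
  derivatives of the mean curvature equation. The quadratic expression has no sign; it is bounded by
  the gradient of \<open>D\<close> only after division by a diagonal entry of the Hessian. This
  bound breaks down where the Hessian vanishes, which forces the second argument with
  \<open>v\<close>. Graphs over tangent planes tilt the vertical direction, hence a general vector
  \<open>(\<alpha>, \<beta>, \<gamma>)\<close> instead of the third axis. The maximum principle says
  nothing at boundary points, so a zero there need not spread by itself. The connectedness argument
  therefore uses the interior of the zero set, not the zero set.\<close>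

lemma has_frechet_derivative:
  "f differentiable (at x) \<Longrightarrow> (f has_derivative frechet_derivative f (at x)) (at x)"
  using frechet_derivative_works by blast

lemma Ck_on_subset: "Ck_on k f S \<Longrightarrow> T \<subseteq> S \<Longrightarrow> Ck_on k f T"
  by (induction k arbitrary: f) (auto intro: continuous_on_subset)

lemma Ck_on_cong:
  assumes "open S" "\<And>x. x \<in> S \<Longrightarrow> f x = g x" "Ck_on k f S"
  shows "Ck_on k g S"
  using assms(2,3)
proof (induction k arbitrary: f g)
  case 0
  then show ?case by (metis Ck_on.simps(1) continuous_on_cong)
next
  case (Suc k)
  have d: "g differentiable (at x)" "frechet_derivative f (at x) = frechet_derivative g (at x)"
    if "x \<in> S" for x
  proof -
    have "f differentiable (at x)" using Suc.prems that by simp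
    then have "(f has_derivative frechet_derivative f (at x)) (at x)"
      by (rule has_frechet_derivative)
    then have h: "(g has_derivative frechet_derivative f (at x)) (at x)"
      by (rule has_derivative_transform_within_open[OF _ assms(1) that]) (use Suc.prems in auto)
    then show "g differentiable (at x)" by (auto simp: differentiable_def)
    show "frechet_derivative f (at x) = frechet_derivative g (at x)"
      by (rule frechet_derivative_at[OF h])
  qed
  have "Ck_on k (\<lambda>x. frechet_derivative g (at x) v) S" for v
    by (rule Suc.IH[of "\<lambda>x. frechet_derivative f (at x) v"]) (use d Suc.prems in auto)
  then show ?case using d by simp
qed

lemma Ck_on_SucD: "Ck_on (Suc k) f S \<Longrightarrow> Ck_on k f S"
proof (induction k arbitrary: f)
  case 0
  then show ?case
    by (auto intro!: continuous_at_imp_continuous_on differentiable_imp_continuous_within)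
next
  case (Suc k)
  then show ?case by (metis Ck_on.simps(2))
qed

lemma Ck_on_local:
  assumes "\<And>x. x \<in> S \<Longrightarrow> \<exists>T. open T \<and> x \<in> T \<and> Ck_on k f T"
  shows "Ck_on k f S"
  using assms
proof (induction k arbitrary: f)
  case 0
  have "isCont f x" if "x \<in> S" for x
    using 0[OF that] by (metis Ck_on.simps(1) continuous_on_eq_continuous_at)
  then show ?case by (auto intro: continuous_at_imp_continuous_on)
next
  case (Suc k)
  show ?case
  proof (simp, intro conjI ballI allI)
    show "f differentiable at x" if "x \<in> S" for x
      using Suc.prems[OF that] by auto
    show "Ck_on k (\<lambda>x. frechet_derivative f (at x) v) S" for v
      by (rule Suc.IH) (metis Suc.prems Ck_on.simps(2))
  qed
qed

text \<open>The closure lemmas below know an explicit derivative, whereas \<open>Ck_on\<close>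
  speaks of \<open>frechet_derivative\<close>; uniqueness of derivatives identifies the two on
  \<open>S\<close>.\<close>

lemma Ck_on_SucI:
  assumes der: "\<And>x. x \<in> S \<Longrightarrow> (f has_derivative f' x) (at x)" and S: "open S"
    and f': "\<And>v. Ck_on k (\<lambda>x. f' x v) S"
  shows "Ck_on (Suc k) f S"
proof -
  have "frechet_derivative f (at x) = f' x" if "x \<in> S" for x
    using frechet_derivative_at der[OF that] by metis
  then have "Ck_on k (\<lambda>x. frechet_derivative f (at x) v) S" for v
    by (intro Ck_on_cong[OF S _ f'[of v]]) auto
  then show ?thesis using der by (auto simp: differentiable_def)
qed

lemma Ck_onD:
  assumes "Ck_on (Suc k) f S" "x \<in> S"
  shows "(f has_derivative frechet_derivative f (at x)) (at x)"
  using assms by (auto intro: has_frechet_derivative)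

lemma Ck_on_const: "open S \<Longrightarrow> Ck_on k (\<lambda>x. c) S"
proof (induction k arbitrary: c)
  case (Suc k)
  then show ?case by simp
qed simp

lemma Ck_on_add:
  assumes "open S" shows "Ck_on k f S \<Longrightarrow> Ck_on k g S \<Longrightarrow> Ck_on k (\<lambda>x. f x + g x) S"
proof (induction k arbitrary: f g)
  case 0 then show ?case by (auto intro: continuous_intros)
next
  case (Suc k)
  show ?case
    by (rule Ck_on_SucI[OF _ assms,
          where f'="\<lambda>x v. frechet_derivative f (at x) v + frechet_derivative g (at x) v"])
      (use Suc in \<open>auto intro!: derivative_intros has_frechet_derivative\<close>)
qed

lemma Ck_on_linear:
  assumes "open S" "bounded_linear L" shows "Ck_on k f S \<Longrightarrow> Ck_on k (\<lambda>x. L (f x)) S"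
proof (induction k arbitrary: f)
  case 0 then show ?case using assms(2) by (auto intro: bounded_linear.continuous_on)
next
  case (Suc k)
  show ?case
    by (rule Ck_on_SucI[OF _ assms(1), where f'="\<lambda>x v. L (frechet_derivative f (at x) v)"])
      (use Suc in \<open>auto intro!: bounded_linear.has_derivative[OF assms(2)] has_frechet_derivative\<close>)
qed

lemma Ck_on_bilinear:
  assumes "open S" "bounded_bilinear B"
  shows "Ck_on k f S \<Longrightarrow> Ck_on k g S \<Longrightarrow> Ck_on k (\<lambda>x. B (f x) (g x)) S"
proof (induction k arbitrary: f g)
  case 0 then show ?case using assms(2) by (auto intro: bounded_bilinear.continuous_on)
next
  case (Suc k)
  have "Ck_on k f S" "Ck_on k g S" using Suc.prems Ck_on_SucD by blast+
  then have "Ck_on k (\<lambda>x. B (f x) (frechet_derivative g (at x) v)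
      + B (frechet_derivative f (at x) v) (g x)) S" for v
    using Suc.prems by (intro Ck_on_add assms(1) Suc.IH) auto
  then show ?case
    by (intro Ck_on_SucI[OF _ assms(1), where f'="\<lambda>x v. B (f x) (frechet_derivative g (at x) v)
      + B (frechet_derivative f (at x) v) (g x)"])
      (use Suc.prems in \<open>auto intro!: bounded_bilinear.FDERIV[OF assms(2)] has_frechet_derivative\<close>)
qed

text \<open>The derivative of \<open>1/f\<close> is built from \<open>f'\<close> and
  \<open>1/f\<close> itself, and the latter is already known to be of class \<open>k\<close>;
  induction on \<open>k\<close> with \<open>f\<close> fixed therefore suffices.\<close>

lemma Ck_on_inverse:
  fixes f :: "'a::euclidean_space \<Rightarrow> real"
  assumes "open S" "\<And>x. x \<in> S \<Longrightarrow> f x \<noteq> 0"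
  shows "Ck_on k f S \<Longrightarrow> Ck_on k (\<lambda>x. inverse (f x)) S"
proof (induction k)
  case 0 then show ?case using assms(2) by (auto intro!: continuous_intros)
next
  case (Suc k)
  have "Ck_on k f S" using Suc.prems Ck_on_SucD by blast
  then have i: "Ck_on k (\<lambda>x. inverse (f x)) S" by (rule Suc.IH)
  have "Ck_on k (\<lambda>x. - (inverse (f x) * frechet_derivative f (at x) v * inverse (f x))) S" for v
    using Suc.prems i
    by (intro Ck_on_linear[OF assms(1) bounded_linear_minus[OF bounded_linear_ident]]
        Ck_on_bilinear[OF assms(1) bounded_bilinear_mult]) auto
  moreover have "((\<lambda>x. inverse (f x)) has_derivative
      (\<lambda>v. - (inverse (f x) * frechet_derivative f (at x) v * inverse (f x)))) (at x)"
    if "x \<in> S" for x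
    by (rule Deriv.has_derivative_inverse) (use Suc.prems assms(2) that in \<open>auto intro: has_frechet_derivative\<close>)
  ultimately show ?case
    by (intro Ck_on_SucI[OF _ assms(1), where
          f'="\<lambda>x v. - (inverse (f x) * frechet_derivative f (at x) v * inverse (f x))"])
qed

lemma Ck_on_comp_real:
  fixes f :: "real \<Rightarrow> real" and z :: "'a::euclidean_space \<Rightarrow> real"
  assumes "open S" "\<And>x. x \<in> S \<Longrightarrow> z x \<in> T"
  shows "Ck_on k f T \<Longrightarrow> Ck_on k z S \<Longrightarrow> Ck_on k (\<lambda>x. f (z x)) S"
proof (induction k arbitrary: f)
  case 0 then show ?case using assms(2)
    by (auto intro!: continuous_on_compose2[where g=f and t=T])
next
  case (Suc k)
  have z: "Ck_on k z S" using Suc.prems Ck_on_SucD by blast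
  \<comment> \<open>On the line a derivative is multiplication by its value at 1, so the derivative
    of the composite is a product with one factor again of the form \<open>g (z x)\<close>; this is
    why the induction varies \<open>f\<close>.\<close>
  have lin: "frechet_derivative f (at (z x)) w = w * frechet_derivative f (at (z x)) 1"
    if "x \<in> S" for x w
  proof -
    have "linear (frechet_derivative f (at (z x)))"
      using Suc.prems assms(2) that by (auto intro: linear_frechet_derivative)
    from linear_scale[OF this, of w 1] show ?thesis by simp
  qed
  have "Ck_on k (\<lambda>x. frechet_derivative z (at x) v * frechet_derivative f (at (z x)) 1) S" for v
    using Suc.prems z
    by (intro Ck_on_bilinear[OF assms(1) bounded_bilinear_mult _
          Suc.IH[of "\<lambda>t. frechet_derivative f (at t) 1"]]) auto
  then have "Ck_on k (\<lambda>x. frechet_derivative f (at (z x)) (frechet_derivative z (at x) v)) S" for v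
    by (rule Ck_on_cong[OF assms(1), rotated]) (simp add: lin[symmetric])
  then show ?case
    by (intro Ck_on_SucI[OF _ assms(1), where
          f'="\<lambda>x v. frechet_derivative f (at (z x)) (frechet_derivative z (at x) v)"]
        has_derivative_compose[of z _ _ _ f])
      (use Suc.prems assms(2) in \<open>auto intro: has_frechet_derivative\<close>)
qed

text \<open>The working notion on open sets. Unlike \<open>smooth_on\<close> it involves no local
  extensions, so its closure properties can serve as simplification rules.\<close>

definition Cinf_on :: "('a::euclidean_space \<Rightarrow> 'b::real_normed_vector) \<Rightarrow> 'a set \<Rightarrow> bool" where
  "Cinf_on f S \<longleftrightarrow> (\<forall>k. Ck_on k f S)"

lemma Cinf_on_subset: "Cinf_on f S \<Longrightarrow> T \<subseteq> S \<Longrightarrow> Cinf_on f T"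
  by (auto simp: Cinf_on_def intro: Ck_on_subset)

lemma Cinf_on_cong: "open S \<Longrightarrow> (\<And>x. x \<in> S \<Longrightarrow> f x = g x) \<Longrightarrow> Cinf_on f S \<Longrightarrow> Cinf_on g S"
  unfolding Cinf_on_def using Ck_on_cong by blast

lemma smooth_on_open_imp_Cinf_on:
  assumes "open S" "smooth_on S f" shows "Cinf_on f S"
  unfolding Cinf_on_def
proof
  fix k show "Ck_on k f S"
  proof (rule Ck_on_local)
    fix x assume "x \<in> S"
    then obtain V g where V: "open V" "x \<in> V" "\<forall>k. Ck_on k g V" "\<forall>y\<in>S \<inter> V. g y = f y"
      using assms(2) unfolding smooth_on_def by blast
    have "Ck_on k f (S \<inter> V)"
      by (rule Ck_on_cong[where f=g]) (use V assms(1) Ck_on_subset[of k g V "S \<inter> V"] in auto)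
    then show "\<exists>T. open T \<and> x \<in> T \<and> Ck_on k f T"
      using V \<open>x \<in> S\<close> assms(1) by (intro exI[of _ "S \<inter> V"]) auto
  qed
qed

lemma Cinf_on_continuous: "Cinf_on f S \<Longrightarrow> continuous_on S f"
  unfolding Cinf_on_def by (metis Ck_on.simps(1))

lemma Cinf_on_has_derivative:
  "Cinf_on f S \<Longrightarrow> x \<in> S \<Longrightarrow> (f has_derivative frechet_derivative f (at x)) (at x)"
  unfolding Cinf_on_def using Ck_onD by blast

lemma Cinf_on_differentiable: "Cinf_on f S \<Longrightarrow> x \<in> S \<Longrightarrow> f differentiable (at x)"
  using Cinf_on_has_derivative differentiable_def by blast

lemma Cinf_on_frechet: "Cinf_on f S \<Longrightarrow> Cinf_on (\<lambda>x. frechet_derivative f (at x) v) S"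
  unfolding Cinf_on_def by (metis Ck_on.simps(2))

lemma Cinf_on_const [simp]: "open S \<Longrightarrow> Cinf_on (\<lambda>x. c) S"
  by (simp add: Cinf_on_def Ck_on_const)

lemma Cinf_on_add [simp]: "open S \<Longrightarrow> Cinf_on f S \<Longrightarrow> Cinf_on g S \<Longrightarrow> Cinf_on (\<lambda>x. f x + g x) S"
  by (simp add: Cinf_on_def Ck_on_add)

lemma Cinf_on_bilinear:
  "open S \<Longrightarrow> bounded_bilinear B \<Longrightarrow> Cinf_on f S \<Longrightarrow> Cinf_on g S \<Longrightarrow> Cinf_on (\<lambda>x. B (f x) (g x)) S"
  by (simp add: Cinf_on_def Ck_on_bilinear)

lemma Cinf_on_inner [simp]:
  fixes f g :: "_ \<Rightarrow> 'b::real_inner" shows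
  "open S \<Longrightarrow> Cinf_on f S \<Longrightarrow> Cinf_on g S \<Longrightarrow> Cinf_on (\<lambda>x. f x \<bullet> g x) S"
  by (rule Cinf_on_bilinear[OF _ bounded_bilinear_inner])

lemma Cinf_on_mult [simp]:
  fixes f g :: "_ \<Rightarrow> real" shows
  "open S \<Longrightarrow> Cinf_on f S \<Longrightarrow> Cinf_on g S \<Longrightarrow> Cinf_on (\<lambda>x. f x * g x) S"
  by (rule Cinf_on_bilinear[OF _ bounded_bilinear_mult])

lemma Cinf_on_minus [simp]:
  fixes f :: "_ \<Rightarrow> real" shows "open S \<Longrightarrow> Cinf_on f S \<Longrightarrow> Cinf_on (\<lambda>x. - f x) S"
  using Cinf_on_mult[of S "\<lambda>_. -1" f] by simp

lemma Cinf_on_diff [simp]: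
  fixes f g :: "_ \<Rightarrow> real" shows
  "open S \<Longrightarrow> Cinf_on f S \<Longrightarrow> Cinf_on g S \<Longrightarrow> Cinf_on (\<lambda>x. f x - g x) S"
  using Cinf_on_add[of S f "\<lambda>x. - g x"] by simp

lemma Cinf_on_inverse [simp]:
  fixes f :: "_ \<Rightarrow> real" shows
  "open S \<Longrightarrow> (\<And>x. x \<in> S \<Longrightarrow> f x \<noteq> 0) \<Longrightarrow> Cinf_on f S \<Longrightarrow> Cinf_on (\<lambda>x. inverse (f x)) S"
  by (simp add: Cinf_on_def Ck_on_inverse)

lemma Cinf_on_divide [simp]:
  fixes f :: "_ \<Rightarrow> real" shows
  "open S \<Longrightarrow> (\<And>x. x \<in> S \<Longrightarrow> g x \<noteq> 0) \<Longrightarrow> Cinf_on f S \<Longrightarrow> Cinf_on g S \<Longrightarrow>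
    Cinf_on (\<lambda>x. f x / g x) S"
  by (simp add: divide_inverse)

lemma Cinf_on_comp_real:
  fixes f :: "real \<Rightarrow> real" shows
  "open S \<Longrightarrow> (\<And>x. x \<in> S \<Longrightarrow> z x \<in> T) \<Longrightarrow> Cinf_on f T \<Longrightarrow> Cinf_on z S \<Longrightarrow>
    Cinf_on (\<lambda>x. f (z x)) S"
  unfolding Cinf_on_def using Ck_on_comp_real[of S z T] by blast

lemma Cinf_on_linear_self: "open S \<Longrightarrow> bounded_linear L \<Longrightarrow> Cinf_on L S"
  unfolding Cinf_on_def
proof
  fix k assume S: "open S" and L: "bounded_linear L"
  show "Ck_on k L S"
  proof (cases k)
    case 0 then show ?thesis using L by (simp add: linear_continuous_on)
  next
    case (Suc m)
    have "frechet_derivative L (at x) = L" for x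
      by (metis L bounded_linear_imp_has_derivative frechet_derivative_at)
    then show ?thesis using L S Suc
      by (auto simp: Ck_on_const bounded_linear_imp_differentiable)
  qed
qed

section \<open>Partial derivatives in the plane\<close>

definition pd :: "2 \<Rightarrow> (real^2 \<Rightarrow> 'b::real_normed_vector) \<Rightarrow> real^2 \<Rightarrow> 'b" where
  "pd i f x = frechet_derivative f (at x) (axis i 1)"

lemma Cinf_on_pd [simp]: "Cinf_on f S \<Longrightarrow> Cinf_on (pd i f) S"
  using Cinf_on_frechet[of f S] by (simp add: pd_def[abs_def])

lemma pd_eqI: "(f has_derivative f') (at x) \<Longrightarrow> pd i f x = f' (axis i 1)"
  unfolding pd_def by (metis frechet_derivative_at)

lemma vec2_eq_axis: "(v::real^2) = v$1 *\<^sub>R axis 1 1 + v$2 *\<^sub>R axis 2 1"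
  by (simp add: vec_eq_iff forall_2 axis_def)

lemma frechet_eq_pd:
  assumes "f differentiable (at x)"
  shows "frechet_derivative f (at x) v = v$1 *\<^sub>R pd 1 f x + v$2 *\<^sub>R pd 2 f x"
proof -
  have l: "linear (frechet_derivative f (at x))" using assms by (rule linear_frechet_derivative)
  show ?thesis
    by (subst vec2_eq_axis[of v]) (simp only: linear_add[OF l] linear_scale[OF l] pd_def)
qed

lemma pd_cong:
  assumes "open S" "x \<in> S" "\<And>y. y \<in> S \<Longrightarrow> f y = g y" "Cinf_on f S"
  shows "pd i f x = pd i g x"
  unfolding pd_def
  using frechet_derivative_transform_within_open[OF Cinf_on_differentiable[OF assms(4,2)] assms(1,2)]
    assms(3) by metis

context
  fixes S :: "(real^2) set" and f g :: "real^2 \<Rightarrow> real"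
  assumes f: "Cinf_on f S" and g: "Cinf_on g S"
begin

lemma pd_add [simp]: "x \<in> S \<Longrightarrow> pd i (\<lambda>x. f x + g x) x = pd i f x + pd i g x"
  by (rule pd_eqI[THEN trans]) (auto intro!: derivative_intros Cinf_on_has_derivative f g simp: pd_def)

lemma pd_diff [simp]: "x \<in> S \<Longrightarrow> pd i (\<lambda>x. f x - g x) x = pd i f x - pd i g x"
  by (rule pd_eqI[THEN trans]) (auto intro!: derivative_intros Cinf_on_has_derivative f g simp: pd_def)

lemma pd_mult [simp]: "x \<in> S \<Longrightarrow> pd i (\<lambda>x. f x * g x) x = f x * pd i g x + pd i f x * g x"
  by (rule pd_eqI[THEN trans]) (auto intro!: has_derivative_mult Cinf_on_has_derivative f g simp: pd_def)

end

lemma pd_const [simp]: "pd i (\<lambda>x. c) x = 0"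
  by (simp add: pd_def)

lemma pd_minus [simp]:
  fixes f :: "real^2 \<Rightarrow> real"
  shows "Cinf_on f S \<Longrightarrow> x \<in> S \<Longrightarrow> pd i (\<lambda>x. - f x) x = - pd i f x"
  by (rule pd_eqI[THEN trans]) (auto intro!: derivative_intros Cinf_on_has_derivative simp: pd_def)

lemma pd_comp_real:
  fixes f :: "real \<Rightarrow> real"
  assumes "Cinf_on z S" "x \<in> S" "(f has_real_derivative d) (at (z x))"
  shows "pd i (\<lambda>x. f (z x)) x = d * pd i z x"
  by (rule pd_eqI[THEN trans, OF has_derivative_compose[OF Cinf_on_has_derivative[OF assms(1,2)]]])
    (use assms(3) in \<open>auto simp: has_field_derivative_def pd_def\<close>)

section \<open>Second derivatives\<close>

lemma line_has_derivative:
  fixes f :: "real^2 \<Rightarrow> real"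
  assumes "Cinf_on f S" "x + s *\<^sub>R v \<in> S"
  shows "((\<lambda>s. f (x + s *\<^sub>R v)) has_real_derivative
    v$1 * pd 1 f (x + s *\<^sub>R v) + v$2 * pd 2 f (x + s *\<^sub>R v)) (at s)"
proof -
  let ?F = "frechet_derivative f (at (x + s *\<^sub>R v))"
  have d: "(f has_derivative ?F) (at (x + s *\<^sub>R v))"
    by (rule Cinf_on_has_derivative[OF assms])
  have "((\<lambda>s. f (x + s *\<^sub>R v)) has_derivative (\<lambda>h. ?F (h *\<^sub>R v))) (at s)"
    by (rule has_derivative_compose[where f = "\<lambda>s. x + s *\<^sub>R v" and g = f, OF _ d]) (auto intro!: derivative_eq_intros)
  then show ?thesis
    unfolding has_field_derivative_def
    by (rule has_derivative_eq_rhs)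
      (simp add: frechet_eq_pd[OF Cinf_on_differentiable[OF assms]] fun_eq_iff algebra_simps)
qed

lemma pd_line:
  fixes f :: "real^2 \<Rightarrow> real"
  assumes "Cinf_on f S" "x + s *\<^sub>R axis i 1 \<in> S"
  shows "((\<lambda>s. f (x + s *\<^sub>R axis i 1)) has_real_derivative pd i f (x + s *\<^sub>R axis i 1)) (at s)"
  using line_has_derivative[OF assms] exhaust_2[of i] by (auto simp: axis_def)

text \<open>Two applications of the mean value theorem, one in each direction. The left-hand side is
  symmetric in \<open>i\<close> and \<open>j\<close>, which is what the interchange of derivatives
  rests on. The corner of the square lies within distance \<open>2*h\<close> of
  \<open>x\<close>.\<close>

lemma second_difference:
  fixes f :: "real^2 \<Rightarrow> real"
  assumes f: "Cinf_on f S" and h: "h > 0" and b: "cball x (2*h) \<subseteq> S"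
  shows "\<exists>y\<in>cball x (2*h). f (x + h *\<^sub>R axis i 1 + h *\<^sub>R axis j 1) - f (x + h *\<^sub>R axis i 1)
    - f (x + h *\<^sub>R axis j 1) + f x = h\<^sup>2 * pd j (pd i f) y"
proof -
  have m: "x + s *\<^sub>R axis i 1 + t *\<^sub>R axis j 1 \<in> cball x (2*h)"
    if "0 \<le> s" "s \<le> h" "0 \<le> t" "t \<le> h" for s t
  proof -
    have "norm (s *\<^sub>R (axis i 1::real^2) + t *\<^sub>R axis j 1) \<le> s + t"
      using norm_triangle_ineq[of "s *\<^sub>R (axis i 1::real^2)" "t *\<^sub>R axis j 1"] that
      by (simp add: norm_axis_1)
    then show ?thesis using that by (simp add: dist_norm algebra_simps norm_minus_commute)
  qed
  have m': "x + s *\<^sub>R axis i 1 + t *\<^sub>R axis j 1 \<in> S"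
    if "0 \<le> s" "s \<le> h" "0 \<le> t" "t \<le> h" for s t using m[OF that] b by blast
  define \<phi> where "\<phi> s = f (x + h *\<^sub>R axis j 1 + s *\<^sub>R axis i 1) - f (x + s *\<^sub>R axis i 1)" for s
  define \<phi>' where "\<phi>' s = pd i f (x + h *\<^sub>R axis j 1 + s *\<^sub>R axis i 1) - pd i f (x + s *\<^sub>R axis i 1)" for s
  have "(\<phi> has_real_derivative \<phi>' s) (at s)" if "0 \<le> s" "s \<le> h" for s
    unfolding \<phi>_def \<phi>'_def
    by (intro DERIV_diff pd_line[OF f]) (use m'[of s h] m'[of s 0] that h in \<open>auto simp: algebra_simps\<close>)
  then obtain \<xi> where \<xi>: "0 < \<xi>" "\<xi> < h" "\<phi> h - \<phi> 0 = (h - 0) * \<phi>' \<xi>"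
    using MVT2[OF h, of \<phi> \<phi>'] by auto
  have "((\<lambda>t. pd i f (x + \<xi> *\<^sub>R axis i 1 + t *\<^sub>R axis j 1)) has_real_derivative
      pd j (pd i f) (x + \<xi> *\<^sub>R axis i 1 + t *\<^sub>R axis j 1)) (at t)" if "0 \<le> t" "t \<le> h" for t
    by (intro pd_line[of _ S] Cinf_on_pd f m') (use that \<xi> in auto)
  then obtain \<eta> where \<eta>: "0 < \<eta>" "\<eta> < h"
    "pd i f (x + \<xi> *\<^sub>R axis i 1 + h *\<^sub>R axis j 1) - pd i f (x + \<xi> *\<^sub>R axis i 1 + 0 *\<^sub>R axis j 1)
      = (h - 0) * pd j (pd i f) (x + \<xi> *\<^sub>R axis i 1 + \<eta> *\<^sub>R axis j 1)"
    using MVT2[OF h, of "\<lambda>t. pd i f (x + \<xi> *\<^sub>R axis i 1 + t *\<^sub>R axis j 1)"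
        "\<lambda>t. pd j (pd i f) (x + \<xi> *\<^sub>R axis i 1 + t *\<^sub>R axis j 1)"] by auto
  have "\<phi> h - \<phi> 0 = h * (h * pd j (pd i f) (x + \<xi> *\<^sub>R axis i 1 + \<eta> *\<^sub>R axis j 1))"
    using \<xi>(3) \<eta>(3) by (simp add: \<phi>'_def add.commute add.left_commute)
  then show ?thesis
    by (intro bexI[of _ "x + \<xi> *\<^sub>R axis i 1 + \<eta> *\<^sub>R axis j 1"] m)
      (use \<xi> \<eta> in \<open>auto simp: \<phi>_def power2_eq_square algebra_simps\<close>)
qed

text \<open>Both orders of differentiation express the same second difference, at two points that
  may differ but both tend to \<open>x\<close> with the mesh; continuity of the two mixed
  derivatives finishes.\<close>

lemma pd_commute:
  fixes f :: "real^2 \<Rightarrow> real"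
  assumes S: "open S" and f: "Cinf_on f S" and x: "x \<in> S"
  shows "pd i (pd j f) x = pd j (pd i f) x"
proof -
  obtain r where r: "r > 0" "cball x r \<subseteq> S" using S x open_contains_cball by blast
  define h where "h n = r / 2 * inverse (real (Suc n))" for n
  have h: "h n > 0" "cball x (2 * h n) \<subseteq> S" for n
  proof -
    show "h n > 0" using r by (simp add: h_def)
    have "2 * h n \<le> r" using r by (simp add: h_def field_simps)
    then show "cball x (2 * h n) \<subseteq> S" using r by auto
  qed
  have "\<exists>y z. y \<in> cball x (2 * h n) \<and> z \<in> cball x (2 * h n) \<and> pd i (pd j f) y = pd j (pd i f) z" for n
  proof -
    obtain y z where yz: "y \<in> cball x (2 * h n)" "z \<in> cball x (2 * h n)"
      "f (x + h n *\<^sub>R axis j 1 + h n *\<^sub>R axis i 1) - f (x + h n *\<^sub>R axis j 1)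
        - f (x + h n *\<^sub>R axis i 1) + f x = (h n)\<^sup>2 * pd i (pd j f) y"
      "f (x + h n *\<^sub>R axis i 1 + h n *\<^sub>R axis j 1) - f (x + h n *\<^sub>R axis i 1)
        - f (x + h n *\<^sub>R axis j 1) + f x = (h n)\<^sup>2 * pd j (pd i f) z"
      using second_difference[OF f h, of n] by meson
    moreover have "x + h n *\<^sub>R axis j 1 + h n *\<^sub>R axis i 1 = x + h n *\<^sub>R axis i 1 + h n *\<^sub>R axis j 1"
      by (simp add: algebra_simps)
    ultimately have "(h n)\<^sup>2 * pd i (pd j f) y = (h n)\<^sup>2 * pd j (pd i f) z" by (smt (verit))
    then show ?thesis using yz h[of n] by auto
  qed
  then obtain Y Z where YZ: "\<And>n. Y n \<in> cball x (2 * h n)" "\<And>n. Z n \<in> cball x (2 * h n)"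
    "\<And>n. pd i (pd j f) (Y n) = pd j (pd i f) (Z n)" by metis
  have h0: "(\<lambda>n. 2 * h n) \<longlonglongrightarrow> 0"
    using LIMSEQ_inverse_real_of_nat[THEN tendsto_mult_left, of r]
    by (simp add: h_def)
  have lim: "W \<longlonglongrightarrow> x" if W: "\<And>n. W n \<in> cball x (2 * h n)" for W
  proof -
    have W': "dist (W n) x \<le> 2 * h n" for n using W[of n] by (simp add: dist_commute)
    have "(\<lambda>n. dist (W n) x) \<longlonglongrightarrow> 0"
      by (rule tendsto_sandwich[OF _ _ tendsto_const h0]) (simp_all add: W' always_eventually)
    then show ?thesis by (rule tendsto_dist_iff[THEN iffD2])
  qed
  have c: "isCont (pd i (pd j f)) x" "isCont (pd j (pd i f)) x"
    using f S x Cinf_on_continuous continuous_on_eq_continuous_at Cinf_on_pd by metis+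
  have "(\<lambda>n. pd i (pd j f) (Y n)) \<longlonglongrightarrow> pd i (pd j f) x"
    by (rule isCont_tendsto_compose[OF c(1) lim]) (rule YZ)
  moreover have "(\<lambda>n. pd i (pd j f) (Y n)) \<longlonglongrightarrow> pd j (pd i f) x"
    unfolding YZ(3) by (rule isCont_tendsto_compose[OF c(2) lim]) (rule YZ)
  ultimately show ?thesis by (rule LIMSEQ_unique)
qed

section \<open>Interior minima and quadratic forms in two variables\<close>

lemma local_min_second_derivative_nonneg:
  fixes \<phi> \<phi>' :: "real \<Rightarrow> real"
  assumes d: "d > 0" and \<phi>: "\<And>s. \<bar>s\<bar> < d \<Longrightarrow> (\<phi> has_real_derivative \<phi>' s) (at s)"
    and \<phi>': "(\<phi>' has_real_derivative m) (at 0)" and min: "\<And>s. \<bar>s\<bar> < d \<Longrightarrow> \<phi> 0 \<le> \<phi> s"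
  shows "\<phi>' 0 = 0" "0 \<le> m"
proof -
  show z: "\<phi>' 0 = 0"
    by (rule DERIV_local_min[OF \<phi>, of 0 d]) (use d min in auto)
  show "0 \<le> m"
  proof (rule ccontr)
    assume "\<not> 0 \<le> m"
    then obtain e where e: "e > 0" "\<And>h. h > 0 \<Longrightarrow> h < e \<Longrightarrow> \<phi>' h < \<phi>' 0"
      using DERIV_neg_dec_right[OF \<phi>'] by auto
    define h where "h = min d e / 2"
    have h: "h > 0" "h < d" "h < e" using d e by (auto simp: h_def)
    obtain t where t: "t > 0" "t < h" "\<phi> h - \<phi> 0 = (h - 0) * \<phi>' t"
      using MVT2[OF h(1), of \<phi> \<phi>'] \<phi> h by force
    have "\<phi>' t < 0" using e(2)[of t] t h z by auto
    then have "h * \<phi>' t < 0" using h by (intro mult_pos_neg)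
    then have "\<phi> h < \<phi> 0" using t(3) by simp
    then show False using min[of h] h by auto
  qed
qed

lemma local_min_hessian:
  fixes g :: "real^2 \<Rightarrow> real"
  assumes S: "open S" "x \<in> S" and g: "Cinf_on g S" and min: "\<And>y. y \<in> S \<Longrightarrow> g x \<le> g y"
  shows "pd 1 g x = 0" "pd 2 g x = 0"
    "0 \<le> a * a * pd 1 (pd 1 g) x + 2 * (a * b) * pd 2 (pd 1 g) x + b * b * pd 2 (pd 2 g) x"
proof -
  obtain r where r: "r > 0" "ball x r \<subseteq> S" using S open_contains_ball by blast
  have main: "v$1 * pd 1 g x + v$2 * pd 2 g x = 0 \<and>
     0 \<le> v$1 * (v$1 * pd 1 (pd 1 g) x + v$2 * pd 2 (pd 1 g) x)
      + v$2 * (v$1 * pd 1 (pd 2 g) x + v$2 * pd 2 (pd 2 g) x)" for v :: "real^2"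
  proof -
    \<comment> \<open>The summand 1 keeps the denominator positive when \<open>v\<close> is
      zero.\<close>
    define d where "d = r / (norm v + 1)"
    have d: "d > 0" using r by (simp add: d_def add_nonneg_pos)
    have inS: "x + s *\<^sub>R v \<in> S" if "\<bar>s\<bar> < d" for s
    proof -
      have "\<bar>s\<bar> * norm v \<le> \<bar>s\<bar> * (norm v + 1)" by (simp add: mult_left_mono)
      also have "\<dots> < d * (norm v + 1)"
        using that by (intro mult_strict_right_mono) (auto simp: add_nonneg_pos)
      also have "\<dots> = r" using norm_ge_zero[of v] by (simp add: d_def add_nonneg_eq_0_iff)
      finally show ?thesis using r by (auto simp: dist_norm subset_eq)
    qed
    let ?f' = "\<lambda>s. v$1 * pd 1 g (x + s *\<^sub>R v) + v$2 * pd 2 g (x + s *\<^sub>R v)"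
    have 1: "((\<lambda>s. g (x + s *\<^sub>R v)) has_real_derivative ?f' s) (at s)" if "\<bar>s\<bar> < d" for s
      by (rule line_has_derivative[OF g inS[OF that]])
    have 2: "((\<lambda>s. pd i g (x + s *\<^sub>R v)) has_real_derivative
        v$1 * pd 1 (pd i g) x + v$2 * pd 2 (pd i g) x) (at 0)" for i
      using line_has_derivative[OF Cinf_on_pd[OF g, of i] inS, of 0] d by simp
    have 3: "(?f' has_real_derivative v$1 * (v$1 * pd 1 (pd 1 g) x + v$2 * pd 2 (pd 1 g) x)
      + v$2 * (v$1 * pd 1 (pd 2 g) x + v$2 * pd 2 (pd 2 g) x)) (at 0)"
      by (intro DERIV_add DERIV_cmult 2)
    have 4: "g (x + 0 *\<^sub>R v) \<le> g (x + s *\<^sub>R v)" if "\<bar>s\<bar> < d" for s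
      using min[OF inS[OF that]] by simp
    show ?thesis using local_min_second_derivative_nonneg[OF d 1 3 4] by simp
  qed
  show "pd 1 g x = 0" "pd 2 g x = 0"
    using main[of "axis 1 1"] main[of "axis 2 1"] by (auto simp: axis_def)
  show "0 \<le> a * a * pd 1 (pd 1 g) x + 2 * (a * b) * pd 2 (pd 1 g) x + b * b * pd 2 (pd 2 g) x"
    using main[of "vector [a, b]"] pd_commute[OF S(1) g S(2), of 1 2] by (simp add: algebra_simps)
qed

text \<open>The trace of the product of a positive definite and a positive semi-definite matrix:
  \<open>A\<close> times it is the second form at \<open>(A, B)\<close> plus the first determinant
  times \<open>g22\<close>.\<close>

lemma trace_product_nonneg:
  fixes A B C g11 g12 g22 :: real
  assumes "A > 0" "A * C - B\<^sup>2 > 0"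
    and g: "\<And>a b. 0 \<le> a * a * g11 + 2 * (a * b) * g12 + b * b * g22"
  shows "0 \<le> A * g11 + 2 * B * g12 + C * g22"
proof -
  have "0 \<le> (A * A * g11 + 2 * (A * B) * g12 + B * B * g22) + (A * C - B\<^sup>2) * g22"
    using g[of A B] g[of 0 1] assms(2) by simp
  also have "\<dots> = A * (A * g11 + 2 * B * g12 + C * g22)"
    by (simp add: algebra_simps power2_eq_square)
  finally show ?thesis using assms(1) by (simp add: zero_le_mult_iff)
qed

text \<open>Determinant over trace lies below the smallest eigenvalue: by Cayley-Hamilton the
  difference, times the trace, is the squared length of the matrix applied to \<open>(a, b)\<close>.
  Being rational in the coefficients, this bound is evidently continuous.\<close>

lemma elliptic_lower_bound:
  fixes A B C a b :: real
  assumes "A + C > 0"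
  shows "(A * C - B\<^sup>2) / (A + C) * (a\<^sup>2 + b\<^sup>2) \<le> A * a\<^sup>2 + 2 * B * (a * b) + C * b\<^sup>2"
proof -
  have "(A + C) * (A * a\<^sup>2 + 2 * B * (a * b) + C * b\<^sup>2) - (A * C - B\<^sup>2) * (a\<^sup>2 + b\<^sup>2)
    = (A * a + B * b)\<^sup>2 + (B * a + C * b)\<^sup>2" by (simp add: algebra_simps power2_eq_square)
  then have "(A * C - B\<^sup>2) * (a\<^sup>2 + b\<^sup>2) \<le> (A + C) * (A * a\<^sup>2 + 2 * B * (a * b) + C * b\<^sup>2)"
    using sum_power2_ge_zero by (metis diff_ge_0_iff_ge)
  then show ?thesis using assms by (simp add: field_simps)
qed

lemma Ck_on_exp: "Ck_on k (exp :: real \<Rightarrow> real) UNIV"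
proof (induction k)
  case 0 then show ?case by (auto intro: continuous_intros)
next
  case (Suc k)
  have "Ck_on k (\<lambda>x::real. exp x * v) UNIV" for v
    by (intro Ck_on_bilinear[OF _ bounded_bilinear_mult] Suc Ck_on_const) auto
  then show ?case
    by (intro Ck_on_SucI[where f'="\<lambda>x v. exp x * v"]) (auto intro!: derivative_eq_intros)
qed

lemma Cinf_on_nth [simp]: "open S \<Longrightarrow> Cinf_on (\<lambda>x::real^'n. x $ i) S"
  by (intro Cinf_on_linear_self bounded_linear_vec_nth)

lemma pd_nth [simp]: "pd i (\<lambda>x. x $ j) x = (if i = j then 1 else 0)"
  by (subst pd_eqI[OF bounded_linear_imp_has_derivative[OF bounded_linear_vec_nth]])
    (auto simp: axis_def)

lemma norm2_eq: "(norm (x::real^2))\<^sup>2 = (x$1)\<^sup>2 + (x$2)\<^sup>2"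
  by (simp add: norm_vec_def L2_set_def sum_2)

section \<open>The strong maximum principle\<close>

text \<open>Hopf's radial comparison function, the exponential of \<open>- a\<close> times the
  squared distance to \<open>y\<close>; products of coordinates replace the norm so that the
  differentiation rules apply directly.\<close>

definition barrier :: "real \<Rightarrow> real^2 \<Rightarrow> real^2 \<Rightarrow> real" where
  "barrier a y x = exp (- a * ((x$1 - y$1) * (x$1 - y$1) + (x$2 - y$2) * (x$2 - y$2)))"

lemma Cinf_on_barrier [simp]: "Cinf_on (barrier a y) UNIV"
  unfolding barrier_def
  by (rule Cinf_on_comp_real[where T=UNIV]) (auto simp: Cinf_on_def[of exp] Ck_on_exp)

lemma pd_barrier: "pd i (barrier a y) x = - 2 * a * (x$i - y$i) * barrier a y x"
proof -
  let ?q = "\<lambda>x::real^2. - a * ((x$1 - y$1) * (x$1 - y$1) + (x$2 - y$2) * (x$2 - y$2))"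
  have "pd i (\<lambda>x. exp (?q x)) x = exp (?q x) * pd i ?q x"
    by (rule pd_comp_real[where S=UNIV]) (auto intro!: derivative_eq_intros)
  also have "pd i ?q x = - 2 * a * (x$i - y$i)"
    using exhaust_2[of i] by (auto simp: pd_mult[where S=UNIV] pd_add[where S=UNIV]
        pd_diff[where S=UNIV] algebra_simps)
  finally show ?thesis unfolding barrier_def[abs_def] by (simp add: algebra_simps)
qed

lemma pd_pd_barrier: "pd j (pd i (barrier a y)) x =
  (4 * a\<^sup>2 * (x$i - y$i) * (x$j - y$j) - (if i = j then 2 * a else 0)) * barrier a y x"
proof -
  have "pd i (barrier a y) = (\<lambda>x. - 2 * a * (x$i - y$i) * barrier a y x)"
    by (rule ext) (rule pd_barrier)
  then have "pd j (pd i (barrier a y)) x = pd j (\<lambda>x. - 2 * a * (x$i - y$i) * barrier a y x) x"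
    by simp
  also have "\<dots> = - 2 * a * (x$i - y$i) * pd j (barrier a y) x
      + (if i = j then - 2 * a else 0) * barrier a y x"
    by (subst pd_mult[where S=UNIV]; simp add: pd_minus[where S=UNIV] pd_mult[where S=UNIV] pd_diff[where S=UNIV])
  finally show ?thesis by (auto simp: pd_barrier algebra_simps power2_eq_square)
qed

lemma continuous_compact_bounded:
  fixes f :: "'a::topological_space \<Rightarrow> real"
  assumes "compact K" "continuous_on K f"
  obtains c where "c \<ge> 0" "\<And>x. x \<in> K \<Longrightarrow> \<bar>f x\<bar> \<le> c"
proof -
  have "bounded (f ` K)" using assms compact_continuous_image compact_imp_bounded by blast
  then obtain c where "\<forall>y\<in>f ` K. \<bar>y\<bar> \<le> c" by (auto simp: bounded_iff)
  then show ?thesis by (intro that[of "max c 0"]) auto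
qed

lemma continuous_compact_pos_bound:
  fixes f :: "'a::topological_space \<Rightarrow> real"
  assumes "compact K" "continuous_on K f" "\<And>x. x \<in> K \<Longrightarrow> f x > 0"
  obtains m where "m > 0" "\<And>x. x \<in> K \<Longrightarrow> m \<le> f x"
proof (cases "K = {}")
  case True then show ?thesis by (intro that[of 1]) auto
next
  case False
  then obtain k where "k \<in> K" "\<forall>x\<in>K. f k \<le> f x"
    using continuous_attains_inf[OF assms(1) _ assms(2)] by blast
  then show ?thesis using assms(3) by (intro that[of "f k"]) auto
qed

text \<open>Halving the ball that touches the zero set makes the touching point unique.\<close>

lemma inner_ball_touches_once:
  fixes x y z :: "'a::real_inner"
  assumes "dist x (midpoint y z) \<le> dist y z / 2" "dist y z \<le> dist y x"
  shows "x = z"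
proof -
  define a where "a = x - midpoint y z"
  define b where "b = y - midpoint y z"
  have z: "z - midpoint y z = - b" and bn: "norm b = dist y z / 2"
  proof -
    have "2 *\<^sub>R midpoint y z = y + z" by (simp add: midpoint_def)
    then show "z - midpoint y z = - b" unfolding b_def by (simp add: scaleR_2 algebra_simps)
    show "norm b = dist y z / 2"
      using dist_midpoint(1)[of y z] by (simp add: b_def dist_norm)
  qed
  have an: "norm a \<le> norm b" using assms(1) by (simp add: a_def bn dist_norm)
  have "norm (b - a) \<ge> 2 * norm b" using assms(2) bn by (simp add: a_def b_def dist_norm)
  then have "(2 * norm b)\<^sup>2 \<le> (norm (b - a))\<^sup>2" by (intro power_mono) auto
  then have "4 * (b \<bullet> b) \<le> b \<bullet> b - 2 * (a \<bullet> b) + a \<bullet> a"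
    by (simp add: power2_norm_eq_inner power_mult_distrib inner_commute algebra_simps)
  moreover have "a \<bullet> a \<le> b \<bullet> b" using an by (simp add: norm_le)
  ultimately have "(a + b) \<bullet> (a + b) \<le> 0" by (simp add: inner_commute algebra_simps)
  then have "a + b = 0" using inner_ge_zero[of "a + b"] by (metis inner_eq_zero_iff order_antisym)
  then show ?thesis using z by (simp add: a_def) (metis add.commute add_eq_0_iff diff_add_cancel eq_iff_diff_eq_0)
qed

text \<open>If \<open>D\<close> were nonzero near \<open>x0\<close>, a ball free of zeros would
  touch the zero set at some \<open>x1\<close>. Subtracting a small multiple of a barrier from
  \<open>D\<close> creates an interior minimum close to \<open>x1\<close>, where the differential
  inequality contradicts the steepness of the barrier. The sign of \<open>c0\<close> does not
  matter, because at that minimum \<open>D\<close> itself is bounded by the barrier.\<close>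

theorem strong_maximum_principle:
  fixes D A B C c0 c1 c2 :: "real^2 \<Rightarrow> real"
  assumes V: "open V" and D: "Cinf_on D V"
    and cont: "continuous_on V A" "continuous_on V B" "continuous_on V C"
      "continuous_on V c0" "continuous_on V c1" "continuous_on V c2"
    and ell: "\<And>x. x \<in> V \<Longrightarrow> A x > 0" "\<And>x. x \<in> V \<Longrightarrow> A x * C x - (B x)\<^sup>2 > 0"
    and nonneg: "\<And>x. x \<in> V \<Longrightarrow> D x \<ge> 0"
    and ineq: "\<And>x. x \<in> V \<Longrightarrow>
      A x * pd 1 (pd 1 D) x + 2 * B x * pd 2 (pd 1 D) x + C x * pd 2 (pd 2 D) x
        \<le> c0 x * D x + c1 x * pd 1 D x + c2 x * pd 2 D x"
    and x0: "x0 \<in> V" "D x0 = 0"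
  shows "\<exists>e>0. ball x0 e \<subseteq> V \<and> (\<forall>x\<in>ball x0 e. D x = 0)"
proof -
  obtain \<rho> where \<rho>: "\<rho> > 0" "cball x0 \<rho> \<subseteq> V" using V x0 open_contains_cball by blast
  let ?K = "cball x0 \<rho>"
  have K: "compact ?K" by simp
  note cK = cont[THEN continuous_on_subset, OF \<rho>(2)]
  have AC: "A x + C x > 0" if "x \<in> ?K" for x
  proof -
    have "A x * C x > 0" using ell(2)[of x] that \<rho> by (smt (verit) subsetD zero_le_power2)
    then show ?thesis using ell(1)[of x] that \<rho> by (smt (verit) subsetD zero_less_mult_pos)
  qed
  obtain lam where lam: "lam > 0" "\<And>x. x \<in> ?K \<Longrightarrow> lam \<le> (A x * C x - (B x)\<^sup>2) / (A x + C x)"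
  proof (rule continuous_compact_pos_bound[OF K, of "\<lambda>x. (A x * C x - (B x)\<^sup>2) / (A x + C x)"])
    show "continuous_on ?K (\<lambda>x. (A x * C x - (B x)\<^sup>2) / (A x + C x))"
      using AC by (intro continuous_intros cK) force
    show "0 < (A x * C x - (B x)\<^sup>2) / (A x + C x)" if "x \<in> ?K" for x
      using AC[OF that] ell(2)[of x] that \<rho> by auto
  qed auto
  have elip: "lam * (a\<^sup>2 + b\<^sup>2) \<le> A x * a\<^sup>2 + 2 * B x * (a * b) + C x * b\<^sup>2" if "x \<in> ?K" for x a b
    using mult_right_mono[OF lam(2)[OF that], of "a\<^sup>2 + b\<^sup>2"]
      elliptic_lower_bound[OF AC[OF that], of "B x" a b] by simp
  obtain c where c: "c \<ge> 0" "\<And>x. x \<in> ?K \<Longrightarrow> \<bar>c0 x\<bar> + \<bar>c1 x\<bar> + \<bar>c2 x\<bar> + \<bar>A x\<bar> + \<bar>C x\<bar> \<le> c"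
  proof -
    have "continuous_on ?K (\<lambda>x. \<bar>c0 x\<bar> + \<bar>c1 x\<bar> + \<bar>c2 x\<bar> + \<bar>A x\<bar> + \<bar>C x\<bar>)"
      by (intro continuous_intros cK)
    from continuous_compact_bounded[OF K this] show ?thesis using that by (smt (verit))
  qed
  \<comment> \<open>The quarter radius puts the zero nearest to \<open>y\<close> within
    \<open>\<rho> / 2\<close> of \<open>x0\<close>, so all balls used below stay inside
    \<open>cball x0 \<rho>\<close>.\<close>
  have "D y = 0" if y: "y \<in> ball x0 (\<rho> / 4)" for y
  proof (rule ccontr)
    assume Dy: "D y \<noteq> 0"
    define Z where "Z = {x \<in> ?K. D x = 0}"
    have contD: "continuous_on ?K D" using Cinf_on_continuous[OF D] \<rho> continuous_on_subset by blast
    have "closed Z" unfolding Z_def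
      by (rule continuous_closed_preimage_constant[OF contD]) simp
    moreover have x0Z: "x0 \<in> Z" using x0 \<rho> by (simp add: Z_def)
    ultimately obtain x1 where x1: "x1 \<in> Z" "\<And>x. x \<in> Z \<Longrightarrow> dist y x1 \<le> dist y x"
      using distance_attains_inf[of Z y] by blast
    define R where "R = dist y x1"
    have R: "0 < R" "R < \<rho> / 4"
      using x1(1) Dy x1(2)[OF x0Z] y by (auto simp: R_def Z_def dist_commute)
    define y' where "y' = midpoint y x1"
    define R' where "R' = R / 2"
    have R': "R' > 0" "dist x1 y' = R'" "dist y y' = R'"
      using R dist_midpoint[of y x1] by (auto simp: R'_def R_def y'_def dist_commute)
    have x0x1: "dist x0 x1 < \<rho> / 2"
      using dist_triangle[of x0 x1 y] y R by (simp add: R_def)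
    have K1: "cball x1 (R' / 2) \<subseteq> ?K"
    proof
      fix x assume "x \<in> cball x1 (R' / 2)"
      then show "x \<in> ?K" using dist_triangle[of x0 x x1] x0x1 R unfolding R'_def by simp
    qed
    have touch: "D x > 0" if "x \<in> ?K" "dist x y' \<le> R'" "x \<noteq> x1" for x
    proof -
      have "x \<notin> Z" using inner_ball_touches_once[of x y x1] that x1(2)[of x]
        by (auto simp: y'_def R'_def R_def)
      then show ?thesis using nonneg[of x] that \<rho> by (auto simp: Z_def)
    qed
    \<comment> \<open>The only zero in \<open>cball y' R'\<close> is \<open>x1\<close>, and
      \<open>x1\<close> is not on the sphere; hence \<open>D\<close> has a positive minimum on this
      compact cap.\<close>
    obtain m where m: "m > 0" "\<And>x. x \<in> sphere x1 (R' / 2) \<inter> cball y' R' \<Longrightarrow> m \<le> D x"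
    proof (rule continuous_compact_pos_bound[of "sphere x1 (R' / 2) \<inter> cball y' R'" D])
      show "continuous_on (sphere x1 (R' / 2) \<inter> cball y' R') D"
        by (rule continuous_on_subset[OF contD]) (use K1 in auto)
      show "0 < D x" if "x \<in> sphere x1 (R' / 2) \<inter> cball y' R'" for x
      proof (rule touch)
        have "x \<in> cball x1 (R' / 2)" using that by simp
        then show "x \<in> ?K" using K1 by blast
        show "dist x y' \<le> R'" "x \<noteq> x1" using that R'(1) by (auto simp: dist_commute)
      qed
    qed (auto simp: compact_Int)
    \<comment> \<open>The constants anticipate the final estimate: \<open>5 * c\<close> collects
      \<open>4 * c\<close> from the trace term \<open>2 * a * (A + C)\<close> and \<open>c\<close>
      from \<open>c0\<close>; \<open>8 * c * R'\<close> collects \<open>4 * c * R'\<close> from each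
      first-order term. The summand 1 in \<open>a\<close> makes the inequality strict and gives
      \<open>a \<ge> 1\<close>.\<close>
    define q where "q = (5 * c + 8 * c * R') / (lam * R'\<^sup>2)"
    define a where "a = q + 1"
    have a: "a \<ge> 1" "a * (lam * R'\<^sup>2) > 5 * c + 8 * c * R'"
    proof -
      have p: "lam * R'\<^sup>2 > 0" using lam R' by simp
      have "q \<ge> 0" using p c R' by (simp add: q_def)
      then show "a \<ge> 1" by (simp add: a_def)
      have "q * (lam * R'\<^sup>2) = 5 * c + 8 * c * R'" using less_imp_neq[OF p] by (simp add: q_def)
      then show "a * (lam * R'\<^sup>2) > 5 * c + 8 * c * R'" using p by (simp add: a_def distrib_right)
    qed
    define E where "E = barrier a y'"
    have E: "E x = exp (- a * (dist x y')\<^sup>2)" for x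
      using norm2_eq[of "x - y'"] by (simp add: E_def barrier_def dist_norm power2_eq_square)
    \<comment> \<open>Positive inside the ball of radius \<open>R'\<close> about \<open>y'\<close>,
      zero on its sphere and negative outside. Thus subtracting \<open>\<epsilon> * w\<close> costs
      less than \<open>m\<close> on the cap and helps on the rest of the small sphere about
      \<open>x1\<close>.\<close>
    define w where "w x = E x - exp (- a * R'\<^sup>2)" for x
    define \<epsilon> where "\<epsilon> = m / 2"
    have \<epsilon>: "\<epsilon> > 0" "\<epsilon> < m" using m by (auto simp: \<epsilon>_def)
    define G where "G x = D x - \<epsilon> * w x" for x
    have sph: "G x > 0" if x: "x \<in> sphere x1 (R' / 2)" for x
    proof (cases "x \<in> cball y' R'")
      case True
      have "E x \<le> 1" using a by (simp add: E)
      then have "w x \<le> 1" unfolding w_def by (smt (verit) exp_gt_zero)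
      then have "\<epsilon> * w x \<le> \<epsilon>" using \<epsilon> by simp
      moreover have "m \<le> D x" using m(2)[of x] True x by blast
      ultimately show ?thesis using \<epsilon> unfolding G_def by linarith
    next
      case False
      then have "R'\<^sup>2 < (dist x y')\<^sup>2" using R' by (intro power_strict_mono) (auto simp: dist_commute)
      then have "w x < 0" using a by (simp add: w_def E)
      then have "\<epsilon> * w x < 0" using \<epsilon> by (simp add: mult_pos_neg)
      moreover have "x \<in> cball x1 (R' / 2)" using x by simp
      then have "x \<in> V" using K1 \<rho> by blast
      ultimately show ?thesis using nonneg[of x] unfolding G_def by linarith
    qed
    have E_smooth: "Cinf_on E V" unfolding E_def
      using Cinf_on_barrier Cinf_on_subset by blast
    have G_smooth: "Cinf_on G V"
      unfolding G_def w_def using V D E_smooth by simp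
    have "continuous_on (cball x1 (R' / 2)) G"
      using Cinf_on_continuous[OF G_smooth] K1 \<rho> continuous_on_subset by blast
    \<comment> \<open>As \<open>G x1 = 0\<close> while \<open>G > 0\<close> on the small sphere, the
      minimum lies in the open ball, where the second-order conditions hold. Zero need not be its
      value.\<close>
    then obtain x2 where x2: "x2 \<in> cball x1 (R' / 2)" "\<And>x. x \<in> cball x1 (R' / 2) \<Longrightarrow> G x2 \<le> G x"
      using continuous_attains_inf[of "cball x1 (R' / 2)" G] R' by auto
    have "G x1 = 0" using x1(1) R' by (simp add: G_def Z_def w_def E)
    then have G2: "G x2 \<le> 0" using x2(2)[of x1] R' by simp
    then have x2b: "x2 \<in> ball x1 (R' / 2)" using sph[of x2] x2(1) by force
    have x2K: "x2 \<in> ?K" "x2 \<in> V" using x2(1) K1 \<rho> by blast+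
    have bV: "ball x1 (R' / 2) \<subseteq> V" using K1 \<rho> ball_subset_cball by blast
    have "G x2 \<le> G y" if "y \<in> ball x1 (R' / 2)" for y using x2(2)[of y] that by simp
    note Gmin = local_min_hessian[OF open_ball x2b Cinf_on_subset[OF G_smooth bV] this]
    have pdG: "pd i G x = pd i D x - \<epsilon> * pd i E x" if "x \<in> V" for i x
      unfolding G_def w_def using that V D E_smooth
      by (simp add: pd_diff[where S=V] pd_mult[where S=V])
    have pdpdG: "pd j (pd i G) x = pd j (pd i D) x - \<epsilon> * pd j (pd i E) x" if "x \<in> V" for i j x
    proof -
      have "pd j (pd i G) x = pd j (\<lambda>x. pd i D x - \<epsilon> * pd i E x) x"
        by (rule pd_cong[OF V that pdG]) (use G_smooth in auto)
      then show ?thesis using that V D E_smooth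
        by (simp add: pd_diff[where S=V] pd_mult[where S=V])
    qed
    define \<xi> where "\<xi> = x2 $ 1 - y' $ 1"
    define \<eta> where "\<eta> = x2 $ 2 - y' $ 2"
    have n: "\<xi>\<^sup>2 + \<eta>\<^sup>2 = (dist x2 y')\<^sup>2" using norm2_eq[of "x2 - y'"] by (simp add: \<xi>_def \<eta>_def dist_norm)
    \<comment> \<open>Staying away from the centre \<open>y'\<close> is essential: the
      \<open>a\<^sup>2\<close> term of the barrier carries the squared distance to \<open>y'\<close>
      as a factor.\<close>
    have dl: "R' / 2 \<le> dist x2 y'" "dist x2 y' \<le> 2 * R'"
      using dist_triangle[of x1 y' x2] dist_triangle[of x2 y' x1] x2(1) R' by (auto simp: dist_commute)
    have nl: "R'\<^sup>2 / 4 \<le> \<xi>\<^sup>2 + \<eta>\<^sup>2"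
      using power_mono[OF dl(1), of 2] R' n by (simp add: power_divide)
    have absl: "\<bar>\<xi>\<bar> \<le> 2 * R'" "\<bar>\<eta>\<bar> \<le> 2 * R'"
    proof -
      have "\<xi>\<^sup>2 \<le> (dist x2 y')\<^sup>2" "\<eta>\<^sup>2 \<le> (dist x2 y')\<^sup>2" using n by (metis le_add_same_cancel1 le_add_same_cancel2 zero_le_power2)+
      then have "\<bar>\<xi>\<bar> \<le> dist x2 y'" "\<bar>\<eta>\<bar> \<le> dist x2 y'"
        by (auto intro!: abs_le_square_iff[THEN iffD2, of _ "dist x2 y'", simplified])
      then show "\<bar>\<xi>\<bar> \<le> 2 * R'" "\<bar>\<eta>\<bar> \<le> 2 * R'" using dl by auto
    qed
    have e0: "E x2 > 0" by (simp add: E)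
    have D1: "pd 1 D x2 = \<epsilon> * (- 2 * a * \<xi> * E x2)" "pd 2 D x2 = \<epsilon> * (- 2 * a * \<eta> * E x2)"
      using Gmin(1,2) pdG[OF x2K(2)] by (auto simp: E_def pd_barrier \<xi>_def \<eta>_def)
    \<comment> \<open>\<open>G x2 \<le> 0\<close> bounds \<open>D x2\<close> by a multiple of
      \<open>E x2\<close>, so the zero-order term has only the factor \<open>c\<close>, without any
      power of \<open>a\<close>.\<close>
    have D0: "0 \<le> D x2" "D x2 \<le> \<epsilon> * E x2"
    proof -
      show "0 \<le> D x2" using nonneg x2K by blast
      have "w x2 \<le> E x2" by (simp add: w_def)
      then have "\<epsilon> * w x2 \<le> \<epsilon> * E x2" using \<epsilon> by simp
      then show "D x2 \<le> \<epsilon> * E x2" using G2 unfolding G_def by linarith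
    qed
    let ?L = "\<lambda>f. A x2 * pd 1 (pd 1 f) x2 + 2 * B x2 * pd 2 (pd 1 f) x2 + C x2 * pd 2 (pd 2 f) x2"
    have "0 \<le> ?L G"
      by (rule trace_product_nonneg[OF ell(1)[OF x2K(2)] ell(2)[OF x2K(2)] Gmin(3)])
    then have "\<epsilon> * ?L E \<le> ?L D" using pdpdG[OF x2K(2)] by (simp add: algebra_simps)
    also have "\<dots> \<le> c0 x2 * D x2 + c1 x2 * pd 1 D x2 + c2 x2 * pd 2 D x2" by (rule ineq[OF x2K(2)])
    also have "\<dots> \<le> \<epsilon> * (E x2 * (c * (1 + 8 * a * R')))"
    proof -
      have cc: "\<bar>c0 x2\<bar> \<le> c" "\<bar>c1 x2\<bar> \<le> c" "\<bar>c2 x2\<bar> \<le> c" using c(2)[OF x2K(1)] by auto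
      have f0: "c0 x2 * D x2 \<le> c * (\<epsilon> * E x2)"
        using mult_mono[OF cc(1) D0(2) c(1) D0(1)] mult_right_mono[OF abs_ge_self D0(1), of "c0 x2"]
        by (rule order_trans[rotated])
      have f1: "k * (\<epsilon> * (- 2 * a * t * E x2)) \<le> c * (\<epsilon> * (2 * a * (2 * R') * E x2))"
        if "\<bar>k\<bar> \<le> c" "\<bar>t\<bar> \<le> 2 * R'" for k t
      proof -
        have "\<bar>\<epsilon> * (- 2 * a * t * E x2)\<bar> \<le> \<epsilon> * (2 * a * (2 * R') * E x2)"
          using \<epsilon> a e0 that by (simp add: abs_mult mult_right_mono)
        then have "\<bar>k\<bar> * \<bar>\<epsilon> * (- 2 * a * t * E x2)\<bar> \<le> c * (\<epsilon> * (2 * a * (2 * R') * E x2))"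
          using that(1) c(1) by (intro mult_mono) auto
        then show ?thesis unfolding abs_mult[symmetric] by (rule abs_le_D1)
      qed
      show ?thesis unfolding D1
        using f0 f1[OF cc(2) absl(1)] f1[OF cc(3) absl(2)] by (simp add: algebra_simps)
    qed
    finally have "?L E \<le> E x2 * (c * (1 + 8 * a * R'))" using \<epsilon> by simp
    moreover have "?L E = E x2 * (4 * a\<^sup>2 * (A x2 * \<xi>\<^sup>2 + 2 * B x2 * (\<xi> * \<eta>) + C x2 * \<eta>\<^sup>2) - 2 * a * (A x2 + C x2))"
      unfolding E_def pd_pd_barrier \<xi>_def \<eta>_def by (simp add: algebra_simps power2_eq_square)
    ultimately have "4 * a\<^sup>2 * (A x2 * \<xi>\<^sup>2 + 2 * B x2 * (\<xi> * \<eta>) + C x2 * \<eta>\<^sup>2) - 2 * a * (A x2 + C x2)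
        \<le> c * (1 + 8 * a * R')" using e0 by simp
    moreover have "4 * a\<^sup>2 * (lam * (R'\<^sup>2 / 4)) \<le> 4 * a\<^sup>2 * (A x2 * \<xi>\<^sup>2 + 2 * B x2 * (\<xi> * \<eta>) + C x2 * \<eta>\<^sup>2)"
      by (intro mult_left_mono order_trans[OF mult_left_mono[OF nl] elip[OF x2K(1)]])
        (use lam(1) in auto)
    moreover have "2 * a * (A x2 + C x2) \<le> 2 * a * (2 * c)"
      using c(2)[OF x2K(1)] a by (intro mult_left_mono) auto
    moreover have "c \<le> c * a" using c a by (simp add: mult_le_cancel_left1)
    ultimately have "a * (a * (lam * R'\<^sup>2)) \<le> a * (5 * c + 8 * c * R')"
      by (simp add: algebra_simps power2_eq_square)
    then show False using a by simp
  qed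
  moreover have "ball x0 (\<rho> / 4) \<subseteq> V" using \<rho> by auto
  ultimately show ?thesis using \<rho> by (intro exI[of _ "\<rho> / 4"]) auto
qed

section \<open>The constant rank theorem for graphs\<close>

definition Lop :: "(real^2 \<Rightarrow> real) \<Rightarrow> (real^2 \<Rightarrow> real) \<Rightarrow> (real^2 \<Rightarrow> real) \<Rightarrow>
    (real^2 \<Rightarrow> real) \<Rightarrow> real^2 \<Rightarrow> real" where
  "Lop A B C f x = A x * pd 1 (pd 1 f) x + 2 * B x * pd 2 (pd 1 f) x + C x * pd 2 (pd 2 f) x"

text \<open>The principal symbol as a bilinear form on gradients; it measures the failure of
  \<open>Lop\<close> to be a derivation. The coefficients are arbitrary functions because two
  operators are needed, one from the metric of the graph and one from the cofactors of the
  Hessian.\<close>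

definition Gam :: "(real^2 \<Rightarrow> real) \<Rightarrow> (real^2 \<Rightarrow> real) \<Rightarrow> (real^2 \<Rightarrow> real) \<Rightarrow>
    (real^2 \<Rightarrow> real) \<Rightarrow> (real^2 \<Rightarrow> real) \<Rightarrow> real^2 \<Rightarrow> real" where
  "Gam A B C f g x = A x * pd 1 f x * pd 1 g x
     + B x * (pd 1 f x * pd 2 g x + pd 2 f x * pd 1 g x) + C x * pd 2 f x * pd 2 g x"

lemma Gam_commute: "Gam A B C f g = Gam A B C g f"
  by (rule ext) (simp add: Gam_def)

context
  fixes V :: "(real^2) set"
  assumes V: "open V"
begin

lemma pd_pd_cong:
  assumes "x \<in> V" "\<And>y. y \<in> V \<Longrightarrow> f y = g y" "Cinf_on f V"
  shows "pd j (pd i f) x = pd j (pd i g) x"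
  by (rule pd_cong[OF V assms(1) pd_cong[OF V _ assms(2,3)]]) (simp_all add: assms(3))

context
  fixes f g :: "real^2 \<Rightarrow> real"
  assumes f: "Cinf_on f V" and g: "Cinf_on g V"
begin

lemma pd_pd_add:
  assumes "x \<in> V"
  shows "pd j (pd i (\<lambda>x. f x + g x)) x = pd j (pd i f) x + pd j (pd i g) x"
proof -
  have "pd j (pd i (\<lambda>x. f x + g x)) x = pd j (\<lambda>x. pd i f x + pd i g x) x"
    by (rule pd_cong[OF V assms pd_add[OF f g]]) (simp_all add: V f g)
  then show ?thesis using assms by (simp add: pd_add[OF Cinf_on_pd[OF f] Cinf_on_pd[OF g]])
qed

lemma pd_pd_diff:
  assumes "x \<in> V"
  shows "pd j (pd i (\<lambda>x. f x - g x)) x = pd j (pd i f) x - pd j (pd i g) x"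
proof -
  have "pd j (pd i (\<lambda>x. f x - g x)) x = pd j (\<lambda>x. pd i f x - pd i g x) x"
    by (rule pd_cong[OF V assms pd_diff[OF f g]]) (simp_all add: V f g)
  then show ?thesis using assms by (simp add: pd_diff[OF Cinf_on_pd[OF f] Cinf_on_pd[OF g]])
qed

lemma pd_pd_mult:
  assumes "x \<in> V"
  shows "pd j (pd i (\<lambda>x. f x * g x)) x = f x * pd j (pd i g) x + pd j f x * pd i g x
    + pd i f x * pd j g x + pd j (pd i f) x * g x"
proof -
  have "pd j (pd i (\<lambda>x. f x * g x)) x = pd j (\<lambda>x. f x * pd i g x + pd i f x * g x) x"
    by (rule pd_cong[OF V assms pd_mult[OF f g]]) (simp_all add: V f g)
  also have "\<dots> = pd j (\<lambda>x. f x * pd i g x) x + pd j (\<lambda>x. pd i f x * g x) x"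
    by (rule pd_add[where S=V]) (simp_all add: V f g assms)
  finally show ?thesis using assms f g
    by (simp add: pd_mult[OF f Cinf_on_pd[OF g]] pd_mult[OF Cinf_on_pd[OF f] g])
qed

lemma Lop_add: "x \<in> V \<Longrightarrow> Lop A B C (\<lambda>x. f x + g x) x = Lop A B C f x + Lop A B C g x"
  by (simp add: Lop_def pd_pd_add algebra_simps)

lemma Lop_diff: "x \<in> V \<Longrightarrow> Lop A B C (\<lambda>x. f x - g x) x = Lop A B C f x - Lop A B C g x"
  by (simp add: Lop_def pd_pd_diff algebra_simps)

lemma Lop_mult: "x \<in> V \<Longrightarrow>
    Lop A B C (\<lambda>x. f x * g x) x = f x * Lop A B C g x + g x * Lop A B C f x + 2 * Gam A B C f g x"
  by (simp add: Lop_def Gam_def pd_pd_mult algebra_simps)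

lemma Gam_add: "x \<in> V \<Longrightarrow> Gam A B C (\<lambda>x. f x + g x) h x = Gam A B C f h x + Gam A B C g h x"
  by (simp add: Gam_def pd_add[OF f g] algebra_simps)

lemma Gam_diff: "x \<in> V \<Longrightarrow> Gam A B C (\<lambda>x. f x - g x) h x = Gam A B C f h x - Gam A B C g h x"
  by (simp add: Gam_def pd_diff[OF f g] algebra_simps)

lemma Gam_mult: "x \<in> V \<Longrightarrow>
    Gam A B C (\<lambda>x. f x * g x) h x = f x * Gam A B C g h x + g x * Gam A B C f h x"
  by (simp add: Gam_def pd_mult[OF f g] algebra_simps)

end

lemma Lop_cong:
  assumes "x \<in> V" "\<And>y. y \<in> V \<Longrightarrow> f y = g y" "Cinf_on f V"
  shows "Lop A B C f x = Lop A B C g x"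
  using pd_pd_cong[OF assms] by (simp add: Lop_def)

lemma Lop_const [simp]: "Lop A B C (\<lambda>x. c) x = 0"
proof -
  have "pd i (\<lambda>x. c :: real) = (\<lambda>x. 0)" for i by (rule ext) simp
  then show ?thesis by (simp add: Lop_def)
qed

lemma Gam_const [simp]: "Gam A B C (\<lambda>x. c) h x = 0"
  by (simp add: Gam_def)

lemma Lop_minus: "Cinf_on f V \<Longrightarrow> x \<in> V \<Longrightarrow> Lop A B C (\<lambda>x. - f x) x = - Lop A B C f x"
  using Lop_diff[of "\<lambda>x. 0" f x A B C] V by simp

lemma Gam_minus: "Cinf_on f V \<Longrightarrow> x \<in> V \<Longrightarrow> Gam A B C (\<lambda>x. - f x) h x = - Gam A B C f h x"
  using Gam_diff[of "\<lambda>x. 0" f x A B C h] V by simp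

lemma Lop_nth [simp]: "Lop A B C (\<lambda>x. x $ i) x = 0"
proof -
  have "pd j (\<lambda>x. x $ i) = (\<lambda>x. if j = i then 1 else 0)" for j by (rule ext) simp
  then show ?thesis by (auto simp: Lop_def)
qed

context
  fixes z :: "real^2 \<Rightarrow> real" and F F1 F2 :: "real \<Rightarrow> real" and T :: "real set"
  assumes z: "Cinf_on z V" and zT: "\<And>x. x \<in> V \<Longrightarrow> z x \<in> T"
    and F: "\<And>t. t \<in> T \<Longrightarrow> (F has_real_derivative F1 t) (at t)" "Cinf_on F T"
    and F1: "\<And>t. t \<in> T \<Longrightarrow> (F1 has_real_derivative F2 t) (at t)" "Cinf_on F1 T"
begin

lemma Gam_comp: "x \<in> V \<Longrightarrow> Gam A B C (\<lambda>x. F (z x)) h x = F1 (z x) * Gam A B C z h x"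
  by (simp add: Gam_def pd_comp_real[OF z _ F(1)[OF zT]] algebra_simps)

text \<open>With \<open>F\<close> the first derivative of \<open>\<phi>\<close>, its third
  derivative enters the argument through the term with \<open>F2\<close> only, multiplied by a
  quadratic form in the gradient of the height.\<close>

lemma Lop_comp:
  assumes x: "x \<in> V"
  shows "Lop A B C (\<lambda>x. F (z x)) x = F2 (z x) * Gam A B C z z x + F1 (z x) * Lop A B C z x"
proof -
  have F1z: "Cinf_on (\<lambda>x. F1 (z x)) V" by (rule Cinf_on_comp_real[OF V zT F1(2) z])
  have Fz: "Cinf_on (\<lambda>x. F (z x)) V" by (rule Cinf_on_comp_real[OF V zT F(2) z])
  have "pd j (pd i (\<lambda>x. F (z x))) x = F1 (z x) * pd j (pd i z) x + F2 (z x) * pd j z x * pd i z x"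
    for i j
  proof -
    have "pd j (pd i (\<lambda>x. F (z x))) x = pd j (\<lambda>x. F1 (z x) * pd i z x) x"
      by (rule pd_cong[OF V x pd_comp_real[OF z _ F(1)[OF zT]]]) (simp_all add: V Fz)
    also have "\<dots> = F1 (z x) * pd j (pd i z) x + pd j (\<lambda>x. F1 (z x)) x * pd i z x"
      by (rule pd_mult[OF F1z _ x]) (simp add: z)
    finally show ?thesis by (simp add: pd_comp_real[OF z x F1(1)[OF zT[OF x]]])
  qed
  then show ?thesis by (simp add: Lop_def Gam_def algebra_simps)
qed

end

end

text \<open>A graph over the plane spanned by two of three orthonormal vectors; \<open>(\<alpha>, \<beta>, \<gamma>)\<close> are the
  coordinates of the vertical vector, so \<open>z\<close> is the height and \<open>v\<close> is the vertical component
  of the normal \<open>(-p, -q, 1)\<close>.\<close>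

locale convex_graph =
  fixes V :: "(real^2) set" and u :: "real^2 \<Rightarrow> real" and F F1 F2 :: "real \<Rightarrow> real"
    and T :: "real set" and \<alpha> \<beta> \<gamma> \<delta> :: real
    and p q r s t z v D :: "real^2 \<Rightarrow> real"
  assumes V: "open V" and u: "Cinf_on u V"
    and F: "\<And>\<tau>. \<tau> \<in> T \<Longrightarrow> (F has_real_derivative F1 \<tau>) (at \<tau>)" "Cinf_on F T"
    and F1: "\<And>\<tau>. \<tau> \<in> T \<Longrightarrow> (F1 has_real_derivative F2 \<tau>) (at \<tau>)" "Cinf_on F1 T"
    and F_pos: "\<And>\<tau>. \<tau> \<in> T \<Longrightarrow> F \<tau> > 0" and F2_le: "\<And>\<tau>. \<tau> \<in> T \<Longrightarrow> F2 \<tau> \<le> 0"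
  defines "p \<equiv> pd 1 u" and "q \<equiv> pd 2 u"
    and "r \<equiv> pd 1 (pd 1 u)" and "s \<equiv> pd 2 (pd 1 u)" and "t \<equiv> pd 2 (pd 2 u)"
    and "z \<equiv> (\<lambda>x. \<alpha> * x$1 + \<beta> * x$2 + \<gamma> * u x + \<delta>)"
    and "v \<equiv> (\<lambda>x. \<gamma> - \<alpha> * pd 1 u x - \<beta> * pd 2 u x)"
    and "D \<equiv> (\<lambda>x. pd 1 (pd 1 u) x * pd 2 (pd 2 u) x - pd 2 (pd 1 u) x * pd 2 (pd 1 u) x)"
  assumes zT: "\<And>x. x \<in> V \<Longrightarrow> z x \<in> T"
    and psd: "\<And>x a b. x \<in> V \<Longrightarrow> 0 \<le> r x * a\<^sup>2 + 2 * s x * (a * b) + t x * b\<^sup>2"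
    and pde: "\<And>x. x \<in> V \<Longrightarrow> (1 + q x * q x) * r x - 2 * (p x * q x) * s x + (1 + p x * p x) * t x
      = (1 + p x * p x + q x * q x) * v x * F (z x)"
begin

lemma smooth [simp]: "Cinf_on u V" "Cinf_on p V" "Cinf_on q V" "Cinf_on r V" "Cinf_on s V" "Cinf_on t V"
  "Cinf_on z V" "Cinf_on v V" "Cinf_on D V" "Cinf_on (\<lambda>x. F (z x)) V" "Cinf_on (\<lambda>x. F1 (z x)) V"
proof -
  show z: "Cinf_on z V" using V u by (simp add: z_def)
  show "Cinf_on (\<lambda>x. F (z x)) V" by (rule Cinf_on_comp_real[OF V zT F(2) z])
  show "Cinf_on (\<lambda>x. F1 (z x)) V" by (rule Cinf_on_comp_real[OF V zT F1(2) z])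
qed (use V u in \<open>simp_all add: p_def q_def r_def s_def t_def v_def D_def\<close>)

lemma pd_u: "x \<in> V \<Longrightarrow> pd 1 u x = p x" "x \<in> V \<Longrightarrow> pd 2 u x = q x"
  "x \<in> V \<Longrightarrow> pd 1 p x = r x" "x \<in> V \<Longrightarrow> pd 2 p x = s x" "x \<in> V \<Longrightarrow> pd 1 q x = s x" "x \<in> V \<Longrightarrow> pd 2 q x = t x"
  using pd_commute[OF V u, of x 1 2] by (auto simp: p_def q_def r_def s_def t_def)

text \<open>The identities for first derivatives hold on \<open>V\<close> only, so using them under
  a further derivative relies on \<open>V\<close> being open.\<close>

lemma pd_pd: "x \<in> V \<Longrightarrow> pd i (pd 1 u) x = pd i p x" "x \<in> V \<Longrightarrow> pd i (pd 2 u) x = pd i q x"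
  "x \<in> V \<Longrightarrow> pd i (pd 1 p) x = pd i r x" "x \<in> V \<Longrightarrow> pd i (pd 2 p) x = pd i s x"
  "x \<in> V \<Longrightarrow> pd i (pd 1 q) x = pd i s x" "x \<in> V \<Longrightarrow> pd i (pd 2 q) x = pd i t x"
  by (rule pd_cong[OF V _ pd_u(1)] pd_cong[OF V _ pd_u(2)] pd_cong[OF V _ pd_u(3)]
      pd_cong[OF V _ pd_u(4)] pd_cong[OF V _ pd_u(5)] pd_cong[OF V _ pd_u(6)]; simp)+

text \<open>Together with \<open>pd4\<close> this reduces third and fourth derivatives of
  \<open>u\<close> to a normal form, so that later cancellations are purely algebraic.\<close>

lemma pd3: "x \<in> V \<Longrightarrow> pd 2 r x = pd 1 s x" "x \<in> V \<Longrightarrow> pd 1 t x = pd 2 s x"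
  using pd_commute[OF V smooth(2), of x 1 2] pd_commute[OF V smooth(3), of x 1 2]
  by (simp_all add: pd_pd)

lemma pd4: "x \<in> V \<Longrightarrow> pd 2 (pd 1 r) x = pd 1 (pd 1 s) x" "x \<in> V \<Longrightarrow> pd 2 (pd 2 r) x = pd 2 (pd 1 s) x"
  "x \<in> V \<Longrightarrow> pd 1 (pd 1 t) x = pd 2 (pd 1 s) x" "x \<in> V \<Longrightarrow> pd 2 (pd 1 t) x = pd 2 (pd 2 s) x"
  using pd_commute[OF V smooth(4), of x 1 2] pd_commute[OF V smooth(5), of x 1 2]
    pd_cong[OF V _ pd3(1), where x=x and i=1] pd_cong[OF V _ pd3(1), where x=x and i=2]
    pd_cong[OF V _ pd3(2), where x=x and i=1] pd_cong[OF V _ pd3(2), where x=x and i=2] by simp_all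

text \<open>These coefficients are the inverse metric of the graph multiplied by
  \<open>1 + p\<^sup>2 + q\<^sup>2\<close>; the associated operator is the principal part of the
  mean curvature equation.\<close>

definition "A = (\<lambda>x. 1 + q x * q x)"
definition "B = (\<lambda>x. - (p x * q x))"
definition "C = (\<lambda>x. 1 + p x * p x)"
abbreviation "La \<equiv> Lop A B C"
abbreviation "Ga \<equiv> Gam A B C"
abbreviation "Lc \<equiv> Lop t (\<lambda>x. - s x) r"
abbreviation "Gc \<equiv> Gam t (\<lambda>x. - s x) r"

lemmas ops = Lop_add[OF V] Lop_diff[OF V] Lop_mult[OF V] Gam_add[OF V] Gam_diff[OF V] Gam_mult[OF V]
  Lop_minus[OF V] Gam_minus[OF V]

lemma ABC_smooth [simp]: "Cinf_on A V" "Cinf_on B V" "Cinf_on C V"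
  using V by (simp_all add: A_def B_def C_def)

lemma D_eq: "D = (\<lambda>x. r x * t x - s x * s x)"
  by (simp add: D_def r_def s_def t_def)

lemma D_at: "D x = r x * t x - s x * s x"
  by (simp add: D_eq)

lemma v_eq: "v = (\<lambda>x. \<gamma> - \<alpha> * p x - \<beta> * q x)"
  by (simp add: v_def p_def q_def)

lemma pd_D: "x \<in> V \<Longrightarrow> pd i D x = r x * pd i t x + pd i r x * t x - 2 * s x * pd i s x"
  using V by (simp add: D_eq pd_diff[where S=V] pd_mult[where S=V])

text \<open>Since \<open>Lc\<close> is built from the cofactor matrix of the Hessian, \<open>Gc p\<close> and \<open>Gc q\<close> are divisible
  by \<open>D\<close>. Applying \<open>Lc\<close> to the equation therefore leaves, besides \<open>F2\<close>, only multiples of \<open>D\<close> and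
  of its first derivatives.\<close>

lemma Lc_pq: "x \<in> V \<Longrightarrow> Lc p x = pd 1 D x" "x \<in> V \<Longrightarrow> Lc q x = pd 2 D x" "x \<in> V \<Longrightarrow> Lc u x = 2 * D x"
  by (simp_all add: Lop_def pd_pd pd_D pd3 pd_u algebra_simps D_at)

lemma Gc_pq: "x \<in> V \<Longrightarrow> Gc p g x = D x * pd 1 g x" "x \<in> V \<Longrightarrow> Gc q g x = D x * pd 2 g x"
  by (simp_all add: Gam_def pd_u algebra_simps D_at)

lemma pd_v: "x \<in> V \<Longrightarrow> pd 1 v x = - \<alpha> * r x - \<beta> * s x" "x \<in> V \<Longrightarrow> pd 2 v x = - \<alpha> * s x - \<beta> * t x"
  using V by (simp_all add: v_eq pd_diff[where S=V] pd_mult[where S=V] pd_u)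

lemma Lc_A: "x \<in> V \<Longrightarrow> Lc A x = 2 * q x * pd 2 D x + 2 * t x * D x"
  using V by (simp add: A_def ops Lc_pq Gc_pq pd_u)

lemma Lc_B: "x \<in> V \<Longrightarrow> Lc B x = - (p x * pd 2 D x + q x * pd 1 D x + 2 * s x * D x)"
  using V by (simp add: B_def ops Lc_pq Gc_pq pd_u)

lemma Lc_C: "x \<in> V \<Longrightarrow> Lc C x = 2 * p x * pd 1 D x + 2 * r x * D x"
  using V by (simp add: C_def ops Lc_pq Gc_pq pd_u)

lemma Gc_ABC: "x \<in> V \<Longrightarrow> Gc A g x = 2 * q x * D x * pd 2 g x"
  "x \<in> V \<Longrightarrow> Gc B g x = - (p x * pd 2 g x + q x * pd 1 g x) * D x"
  "x \<in> V \<Longrightarrow> Gc C g x = 2 * p x * D x * pd 1 g x"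
  using V by (simp_all add: A_def B_def C_def ops Gc_pq algebra_simps)

lemma Lc_z: "x \<in> V \<Longrightarrow> Lc z x = 2 * \<gamma> * D x"
  using V by (simp add: z_def ops Lc_pq)

text \<open>The determinant of the first fundamental form of the graph, which is also that of the
  matrix with entries \<open>A\<close>, \<open>B\<close>, \<open>C\<close>.\<close>

definition "W = (\<lambda>x. 1 + p x * p x + q x * q x)"

lemma W_smooth [simp]: "Cinf_on W V"
  using V by (simp add: W_def)

lemma Gc_W: "x \<in> V \<Longrightarrow> Gc W g x = 2 * D x * (p x * pd 1 g x + q x * pd 2 g x)"
  using V by (simp add: W_def ops Gc_pq algebra_simps)

lemma Gc_v: "x \<in> V \<Longrightarrow> Gc v g x = - D x * (\<alpha> * pd 1 g x + \<beta> * pd 2 g x)"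
  using V by (simp add: v_eq ops Gc_pq algebra_simps)

lemma Lc_v: "x \<in> V \<Longrightarrow> Lc v x = - \<alpha> * pd 1 D x - \<beta> * pd 2 D x"
  using V by (simp add: v_eq ops Lc_pq)

lemma Lc_W: "x \<in> V \<Longrightarrow> Lc W x = 2 * p x * pd 1 D x + 2 * q x * pd 2 D x + 2 * (r x + t x) * D x"
  using V by (simp add: W_def ops Lc_pq Gc_pq pd_u algebra_simps)

lemma pde': "x \<in> V \<Longrightarrow> A x * r x + 2 * (B x * s x) + C x * t x = W x * v x * F (z x)"
  using pde[of x] by (simp add: A_def B_def C_def W_def algebra_simps)

text \<open>Fourth derivatives are symmetric in all indices, so contracting one pair with the metric
  coefficients and the other with the cofactors of the Hessian can be done in either order. This
  exchanges \<open>La\<close> acting on \<open>D\<close> for \<open>Lc\<close> acting on the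
  Hessian, to which the equation applies.\<close>

lemma La_D: "x \<in> V \<Longrightarrow> La D x = A x * Lc r x + 2 * (B x * Lc s x) + C x * Lc t x
    + 2 * (Ga r t x - Ga s s x)"
proof -
  assume x: "x \<in> V"
  have "La D x = r x * La t x + t x * La r x - 2 * s x * La s x + 2 * (Ga r t x - Ga s s x)"
    using V x by (simp add: D_eq ops)
  moreover have "r x * La t x + t x * La r x - 2 * s x * La s x
      = A x * Lc r x + 2 * (B x * Lc s x) + C x * Lc t x"
    using x by (simp add: Lop_def pd4 algebra_simps)
  ultimately show ?thesis by simp
qed

text \<open>The coefficients are read off by collecting terms in \<open>La_D_eq\<close>. The term
  \<open>- 4 * D\<close> stems from \<open>r Lc A + 2 s Lc B + t Lc C\<close>, whose part without
  derivatives of \<open>D\<close> is \<open>4 * D\<^sup>2\<close>.\<close>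

definition "k0 = (\<lambda>x. - 4 * D x + F (z x) * (2 * v x * (r x + t x) + 4 * (p x * pd 1 v x + q x * pd 2 v x))
  + 2 * \<gamma> * W x * v x * F1 (z x)
  + 2 * F1 (z x) * (2 * v x * (p x * pd 1 z x + q x * pd 2 z x) - W x * (\<alpha> * pd 1 z x + \<beta> * pd 2 z x)))"
definition "k1 = (\<lambda>x. 2 * s x * q x - 2 * p x * t x + F (z x) * (2 * p x * v x - \<alpha> * W x))"
definition "k2 = (\<lambda>x. 2 * s x * p x - 2 * q x * r x + F (z x) * (2 * q x * v x - \<beta> * W x))"

lemma La_D_eq:
  assumes x: "x \<in> V"
  shows "La D x = k0 x * D x + k1 x * pd 1 D x + k2 x * pd 2 D x
    + W x * v x * F2 (z x) * Gc z z x + 2 * (Ga r t x - Ga s s x)"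
proof -
  note comp = Lop_comp[OF V smooth(7) zT F F1] Gam_comp[OF V smooth(7) zT F F1]
  have "Lc (\<lambda>x. A x * r x + 2 * (B x * s x) + C x * t x) x = Lc (\<lambda>x. W x * v x * F (z x)) x"
    by (rule Lop_cong[OF V x pde']) (use V in auto)
  also have "\<dots> = W x * v x * (F2 (z x) * Gc z z x + F1 (z x) * (2 * \<gamma> * D x))
     + F (z x) * (W x * Lc v x + v x * Lc W x + 2 * Gc W v x)
     + 2 * (F1 (z x) * (W x * Gc v z x + v x * Gc W z x))"
    using V x by (simp add: ops comp Lc_z Gam_commute[of _ _ _ _ "\<lambda>x. F (z x)"])
      (simp add: Gam_commute[of _ _ _ z] ops)
  finally have 1: "Lc (\<lambda>x. A x * r x + 2 * (B x * s x) + C x * t x) x = \<dots>" .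
  have 2: "Lc (\<lambda>x. A x * r x + 2 * (B x * s x) + C x * t x) x
    = A x * Lc r x + 2 * (B x * Lc s x) + C x * Lc t x
      + r x * Lc A x + 2 * (s x * Lc B x) + t x * Lc C x
      + 2 * Gc A r x + 4 * Gc B s x + 2 * Gc C t x"
    using V x by (simp add: ops)
  \<comment> \<open>The terms \<open>2 * Gc A r + 4 * Gc B s + 2 * Gc C t\<close> cancel completely
    once the third derivatives are put into the normal form \<open>pd3\<close>.\<close>
  show ?thesis
    unfolding La_D[OF x] using 1[unfolded 2] x
    by (simp add: Lc_A Lc_B Lc_C Gc_ABC Lc_v Lc_W Gc_W Gc_v k0_def k1_def k2_def pd3)
      (simp add: algebra_simps D_at)
qed

lemma quad_nonneg: "0 \<le> A x * a * a + B x * (a * b + b * a) + C x * b * b"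
proof -
  have "A x * a * a + B x * (a * b + b * a) + C x * b * b = a\<^sup>2 + b\<^sup>2 + (q x * a - p x * b)\<^sup>2"
    by (simp add: A_def B_def C_def algebra_simps power2_eq_square)
  then show ?thesis by simp
qed

lemma det_pos: "A x * C x - (B x)\<^sup>2 > 0"
proof -
  have "A x * C x - (B x)\<^sup>2 = 1 + (p x)\<^sup>2 + (q x)\<^sup>2"
    by (simp add: A_def B_def C_def algebra_simps power2_eq_square)
  then show ?thesis by (simp add: add_pos_nonneg)
qed

lemma A_pos: "A x > 0" and W_pos: "W x > 0"
  by (simp_all add: A_def W_def add_pos_nonneg)

lemma rt_nonneg: "x \<in> V \<Longrightarrow> 0 \<le> r x" "x \<in> V \<Longrightarrow> 0 \<le> t x"
  using psd[of x 1 0] psd[of x 0 1] by auto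

text \<open>The mean curvature equation equates \<open>W * v * F\<close> with the trace of a
  positive definite times a positive semi-definite matrix; \<open>W\<close> and \<open>F\<close> are
  positive.\<close>

lemma v_nonneg: "x \<in> V \<Longrightarrow> 0 \<le> v x"
proof -
  assume x: "x \<in> V"
  have "0 \<le> A x * r x + 2 * B x * s x + C x * t x"
    by (rule trace_product_nonneg[OF A_pos det_pos])
      (use psd[OF x] in \<open>simp add: power2_eq_square algebra_simps\<close>)
  then have "0 \<le> W x * (v x * F (z x))" using pde'[OF x] by (simp add: algebra_simps)
  then have "0 \<le> v x * F (z x)" using W_pos[of x] by (simp add: zero_le_mult_iff)
  then show ?thesis using F_pos[OF zT[OF x]] by (simp add: zero_le_mult_iff)
qed

text \<open>The cofactor form at a gradient is the Hessian form at the gradient rotated by a right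
  angle.\<close>

lemma Gc_nonneg: "x \<in> V \<Longrightarrow> 0 \<le> Gc f f x"
  using psd[of x "pd 2 f x" "- pd 1 f x"] by (simp add: Gam_def algebra_simps power2_eq_square)

lemma D_nonneg: "x \<in> V \<Longrightarrow> 0 \<le> D x"
proof -
  assume x: "x \<in> V"
  show ?thesis
  proof (cases "t x = 0")
    case True
    have "s x = 0"
    proof (rule ccontr)
      assume "s x \<noteq> 0"
      \<comment> \<open>For \<open>t = 0\<close> the form at \<open>(1, b)\<close> is
        \<open>r + 2 * s * b\<close>; the chosen \<open>b\<close> makes it equal to -1.\<close>
      then show False
        using psd[OF x, of 1 "- (r x + 1) / (2 * s x)"] True by (simp add: field_simps)
    qed
    then show ?thesis using True by (simp add: D_at)
  next
    case False
    then have t: "t x > 0" using rt_nonneg[OF x] by simp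
    have "0 \<le> t x * D x"
      using psd[OF x, of "t x" "- s x"] by (simp add: D_at algebra_simps power2_eq_square)
    then show ?thesis using t by (simp add: zero_le_mult_iff)
  qed
qed

text \<open>Eliminating the derivatives of \<open>r\<close> by those of \<open>D = r t - s\<^sup>2\<close> turns \<open>t\<^sup>2\<close> times the left-hand side
  into \<open>t Ga D t\<close> minus nonnegative terms.\<close>

lemma third_order_bound:
  assumes x: "x \<in> V"
  shows "t x > 0 \<Longrightarrow> Ga r t x - Ga s s x \<le> Ga D t x / t x"
    and "r x > 0 \<Longrightarrow> Ga r t x - Ga s s x \<le> Ga D r x / r x"
proof -
  have form: "0 \<le> D x * Ga g g x + (A x * h1 * h1 + B x * (h1 * h2 + h2 * h1) + C x * h2 * h2)" for g h1 h2
    using D_nonneg[OF x] quad_nonneg by (simp add: Gam_def)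
  {
    assume t: "t x > 0"
    \<comment> \<open>After replacing \<open>r * t\<close> by \<open>D + s\<^sup>2\<close>, the
      discarded terms are \<open>D * Ga t t\<close> and the form with coefficients \<open>A\<close>,
      \<open>B\<close>, \<open>C\<close> at \<open>s\<close> times the gradient of \<open>t\<close>
      minus \<open>t\<close> times the gradient of \<open>s\<close>.\<close>
    have "t x * t x * (Ga r t x - Ga s s x) \<le> t x * Ga D t x"
      using form[of t "s x * pd 1 t x - t x * pd 1 s x" "s x * pd 2 t x - t x * pd 2 s x"] x
      by (simp add: Gam_def pd_D D_at algebra_simps)
    then have "t x * (Ga r t x - Ga s s x) \<le> Ga D t x" using t by simp
    then show "Ga r t x - Ga s s x \<le> Ga D t x / t x" using t by (simp add: field_simps)
  }
  {
    assume r: "r x > 0"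
    have "r x * r x * (Ga r t x - Ga s s x) \<le> r x * Ga D r x"
      using form[of r "s x * pd 1 r x - r x * pd 1 s x" "s x * pd 2 r x - r x * pd 2 s x"] x
      by (simp add: Gam_def pd_D D_at algebra_simps)
    then have "r x * (Ga r t x - Ga s s x) \<le> Ga D r x" using r by simp
    then show "Ga r t x - Ga s s x \<le> Ga D r x / r x" using r by (simp add: field_simps)
  }
qed

lemma cont: "Cinf_on f V \<Longrightarrow> S \<subseteq> V \<Longrightarrow> continuous_on S f"
  using Cinf_on_continuous continuous_on_subset by blast

lemma k_smooth: "Cinf_on k0 V" "Cinf_on k1 V" "Cinf_on k2 V"
  using V by (simp_all add: k0_def k1_def k2_def)

text \<open>Here \<open>h\<close> stands for \<open>r\<close> or \<open>t\<close>, whichever is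
  positive at \<open>x0\<close>. On the open set where it stays positive, \<open>Ga D h / h\<close>
  is linear in the gradient of \<open>D\<close> with continuous coefficients and is absorbed into
  the first-order terms.\<close>

lemma rank_one:
  assumes x0: "x0 \<in> V" "D x0 = 0" and h: "Cinf_on h V" "h x0 > 0"
    and bound: "\<And>x. x \<in> V \<Longrightarrow> h x > 0 \<Longrightarrow> Ga r t x - Ga s s x \<le> Ga D h x / h x"
  shows "\<exists>e>0. ball x0 e \<subseteq> V \<and> (\<forall>x\<in>ball x0 e. D x = 0)"
proof -
  define V' where "V' = V \<inter> h -` {0<..}"
  have V': "open V'" "x0 \<in> V'" "V' \<subseteq> V" "\<And>x. x \<in> V' \<Longrightarrow> h x > 0"
    using continuous_open_preimage[OF cont[OF h(1)] V, of "{0<..}"] x0 h by (auto simp: V'_def)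
  have sm: "Cinf_on f V'" if "Cinf_on f V" for f :: "real^2 \<Rightarrow> real"
    by (rule Cinf_on_subset[OF that V'(3)])
  have "\<exists>e>0. ball x0 e \<subseteq> V' \<and> (\<forall>x\<in>ball x0 e. D x = 0)"
  proof (rule strong_maximum_principle[where A=A and B=B and C=C and ?c0.0=k0 and
        ?c1.0="\<lambda>x. k1 x + 2 * (A x * pd 1 h x + B x * pd 2 h x) / h x" and
        ?c2.0="\<lambda>x. k2 x + 2 * (B x * pd 1 h x + C x * pd 2 h x) / h x"])
    show "continuous_on V' (\<lambda>x. k1 x + 2 * (A x * pd 1 h x + B x * pd 2 h x) / h x)"
      "continuous_on V' (\<lambda>x. k2 x + 2 * (B x * pd 1 h x + C x * pd 2 h x) / h x)"
      using V'(1) V'(4)[THEN less_imp_neq]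
      by (simp_all add: Cinf_on_continuous sm[OF k_smooth(2)] sm[OF k_smooth(3)] sm[OF h(1)]
          sm[OF ABC_smooth(1)] sm[OF ABC_smooth(2)] sm[OF ABC_smooth(3)] less_imp_neq[symmetric])
    show "A x * pd 1 (pd 1 D) x + 2 * B x * pd 2 (pd 1 D) x + C x * pd 2 (pd 2 D) x
      \<le> k0 x * D x + (k1 x + 2 * (A x * pd 1 h x + B x * pd 2 h x) / h x) * pd 1 D x
        + (k2 x + 2 * (B x * pd 1 h x + C x * pd 2 h x) / h x) * pd 2 D x" if "x \<in> V'" for x
    proof -
      have x: "x \<in> V" "h x > 0" using that V' by auto
      \<comment> \<open>This factor multiplies \<open>F2\<close>, so the sign of the third
        derivative of \<open>\<phi>\<close> allows the term to be dropped.\<close>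
      have "0 \<le> (W x * v x) * Gc z z x"
        using W_pos v_nonneg x Gc_nonneg by (simp add: less_imp_le)
      then have "(W x * v x) * Gc z z x * F2 (z x) \<le> 0"
        by (rule mult_nonneg_nonpos) (rule F2_le[OF zT[OF x(1)]])
      then have "La D x \<le> k0 x * D x + k1 x * pd 1 D x + k2 x * pd 2 D x + 2 * (Ga D h x / h x)"
        using La_D_eq[OF x(1)] bound[OF x] by (simp add: algebra_simps)
      also have "\<dots> = k0 x * D x + (k1 x + 2 * (A x * pd 1 h x + B x * pd 2 h x) / h x) * pd 1 D x
        + (k2 x + 2 * (B x * pd 1 h x + C x * pd 2 h x) / h x) * pd 2 D x"
        using x(2) by (simp add: Gam_def field_simps)
      finally show ?thesis by (simp add: Lop_def)
    qed
  qed (use V' x0 D_nonneg A_pos det_pos Cinf_on_subset[of D V V'] in \<open>auto intro!: cont k_smooth ABC_smooth\<close>)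
  then show ?thesis using V' by blast
qed

section \<open>The vertical component of the normal and flat points\<close>

definition "l0 = (\<lambda>x. - (\<alpha> * (pd 1 W x * F (z x) + W x * F1 (z x) * pd 1 z x)
  + \<beta> * (pd 2 W x * F (z x) + W x * F1 (z x) * pd 2 z x)))"
definition "l1 = (\<lambda>x. 2 * s x * q x - 2 * p x * t x - \<alpha> * W x * F (z x))"
definition "l2 = (\<lambda>x. 2 * s x * p x - 2 * q x * r x - \<beta> * W x * F (z x))"

lemma pd_ABC: "x \<in> V \<Longrightarrow> pd i A x = 2 * q x * pd i q x"
  "x \<in> V \<Longrightarrow> pd i B x = - (p x * pd i q x + pd i p x * q x)"
  "x \<in> V \<Longrightarrow> pd i C x = 2 * p x * pd i p x"
  unfolding A_def B_def C_def using V
  by (simp_all add: pd_add[where S=V] pd_mult[where S=V] pd_minus[where S=V])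

text \<open>As \<open>v\<close> is affine in \<open>p\<close> and \<open>q\<close>, the equation
  differentiated once suffices. The derivatives of \<open>A\<close>, \<open>B\<close>,
  \<open>C\<close> leave \<open>2 * (\<alpha> * p + \<beta> * q) * D\<close>; this is linear in the
  gradient of \<open>v\<close>, because that gradient is minus the Hessian applied to
  \<open>(\<alpha>, \<beta>)\<close>, and cofactors times Hessian is \<open>D\<close> times the
  identity.\<close>

lemma La_v:
  assumes x: "x \<in> V"
  shows "La v x = l0 x * v x + l1 x * pd 1 v x + l2 x * pd 2 v x"
proof -
  have La_pq: "La p x = A x * pd 1 r x + 2 * B x * pd 1 s x + C x * pd 1 t x"
    "La q x = A x * pd 2 r x + 2 * B x * pd 2 s x + C x * pd 2 t x"
    using x by (simp_all add: Lop_def pd_pd pd3)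
  have "pd i (\<lambda>x. A x * r x + 2 * (B x * s x) + C x * t x) x = pd i (\<lambda>x. W x * v x * F (z x)) x" for i
    by (rule pd_cong[OF V x pde']) (use V in auto)
  moreover have "pd i (\<lambda>x. A x * r x + 2 * (B x * s x) + C x * t x) x
    = A x * pd i r x + 2 * B x * pd i s x + C x * pd i t x
      + 2 * q x * pd i q x * r x - 2 * (p x * pd i q x + q x * pd i p x) * s x + 2 * p x * pd i p x * t x" for i
    using V x by (simp add: pd_add[where S=V] pd_mult[where S=V] pd_ABC algebra_simps)
  moreover have "pd i (\<lambda>x. W x * v x * F (z x)) x
    = pd i W x * v x * F (z x) + W x * pd i v x * F (z x) + W x * v x * (F1 (z x) * pd i z x)" for i
    using V x by (simp add: pd_mult[where S=V] pd_comp_real[OF smooth(7) x F(1)[OF zT[OF x]]] algebra_simps)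
  ultimately have key: "A x * pd i r x + 2 * B x * pd i s x + C x * pd i t x
    = pd i W x * v x * F (z x) + W x * pd i v x * F (z x) + W x * v x * (F1 (z x) * pd i z x)
      - 2 * q x * pd i q x * r x + 2 * (p x * pd i q x + q x * pd i p x) * s x - 2 * p x * pd i p x * t x" for i
    by (simp add: algebra_simps)
  have "La v x = - \<alpha> * La p x - \<beta> * La q x"
    using V x by (simp add: v_eq ops)
  then show ?thesis
    unfolding La_pq key l0_def l1_def l2_def using x by (simp add: pd_v pd_u algebra_simps)
qed

lemma rank_zero:
  assumes x0: "x0 \<in> V" "v x0 = 0"
  shows "\<exists>e>0. ball x0 e \<subseteq> V \<and> (\<forall>x\<in>ball x0 e. D x = 0)"
proof -
  have l: "Cinf_on l0 V" "Cinf_on l1 V" "Cinf_on l2 V"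
    using V by (simp_all add: l0_def l1_def l2_def)
  have "\<exists>e>0. ball x0 e \<subseteq> V \<and> (\<forall>x\<in>ball x0 e. v x = 0)"
    by (rule strong_maximum_principle[where A=A and B=B and C=C and ?c0.0=l0 and ?c1.0=l1 and ?c2.0=l2])
      (use V x0 v_nonneg A_pos det_pos La_v in \<open>auto intro!: cont l ABC_smooth simp: Lop_def\<close>)
  moreover have "D x = 0" if x: "x \<in> V" "v x = 0" for x
  proof -
    have "A x * r x + 2 * (B x * s x) + C x * t x = 0" using pde'[OF x(1)] x(2) by simp
    \<comment> \<open>The trace splits into \<open>r + t\<close> and the Hessian form at
      \<open>(q, - p)\<close>; all summands are nonnegative, so each vanishes.\<close>
    then have "r x + t x + (r x * (q x)\<^sup>2 + 2 * s x * (q x * - p x) + t x * (- p x)\<^sup>2) = 0"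
      by (simp add: A_def B_def C_def algebra_simps power2_eq_square)
    then have "r x = 0" using psd[OF x(1), of "q x" "- p x"] rt_nonneg[OF x(1)] by linarith
    then have "D x \<le> 0" by (simp add: D_at)
    then show ?thesis using D_nonneg[OF x(1)] by simp
  qed
  ultimately show ?thesis by blast
qed

text \<open>If both \<open>r\<close> and \<open>t\<close> vanish at the point, so does
  \<open>s\<close>, and since \<open>F\<close> and \<open>W\<close> are positive the equation forces
  \<open>v\<close> to vanish as well. Otherwise one of the two divisions is available.\<close>

theorem constant_rank:
  assumes x0: "x0 \<in> V" "D x0 = 0"
  shows "\<exists>e>0. ball x0 e \<subseteq> V \<and> (\<forall>x\<in>ball x0 e. D x = 0)"
proof -
  consider "r x0 > 0" | "t x0 > 0" | "r x0 = 0" "t x0 = 0"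
    using rt_nonneg[OF x0(1)] by linarith
  then show ?thesis
  proof cases
    case 1 then show ?thesis using rank_one[of x0 r] x0 third_order_bound(2) by simp
  next
    case 2 then show ?thesis using rank_one[of x0 t] x0 third_order_bound(1) by simp
  next
    case 3
    then have "s x0 = 0" using x0 by (simp add: D_at)
    then have "W x0 * v x0 * F (z x0) = 0" using pde'[OF x0(1)] 3 by simp
    then have "v x0 = 0" using W_pos[of x0] F_pos[OF zT[OF x0(1)]] by auto
    then show ?thesis using rank_zero x0 by blast
  qed
qed

end

section \<open>Parametrised surfaces\<close>

text \<open>A rotation taking the third axis to \<open>n\<close> carries the standard basis along.
  Only Parseval's identity is recorded, as vectors are later compared by their components.\<close>

lemma orthonormal_frame:
  fixes n :: "real^3"
  assumes "norm n = 1"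
  obtains b1 b2 :: "real^3" where
    "\<And>x y :: real^3. x \<bullet> y = (x \<bullet> b1) * (y \<bullet> b1) + (x \<bullet> b2) * (y \<bullet> b2) + (x \<bullet> n) * (y \<bullet> n)"
proof -
  obtain f where f: "orthogonal_transformation f" "f (axis 3 1 :: real^3) = n"
    using orthogonal_transformation_exists[of "axis 3 1" n] assms by (auto simp: norm_axis_1)
  have "x \<bullet> y = (x \<bullet> f (axis 1 1)) * (y \<bullet> f (axis 1 1)) + (x \<bullet> f (axis 2 1)) * (y \<bullet> f (axis 2 1))
     + (x \<bullet> n) * (y \<bullet> n)" for x y :: "real^3"
  proof -
    obtain x' y' where xy: "x = f x'" "y = f y'"
      using orthogonal_transformation_surj[OF f(1)] by (metis surjD)
    have iso: "f a \<bullet> f b = a \<bullet> b" for a b using f(1) by (simp add: orthogonal_transformation_def)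
    show ?thesis
      unfolding xy f(2)[symmetric] iso
      by (simp add: inner_axis) (simp add: inner_vec_def sum_3)
  qed
  then show ?thesis by (rule that)
qed

lemma has_derivative_pd:
  fixes f :: "real^2 \<Rightarrow> real"
  assumes "Cinf_on f S" "x \<in> S"
  shows "(f has_derivative (\<lambda>v. v$1 * pd 1 f x + v$2 * pd 2 f x)) (at x)"
  by (rule has_derivative_eq_rhs[OF Cinf_on_has_derivative[OF assms]])
    (simp add: fun_eq_iff frechet_eq_pd[OF Cinf_on_differentiable[OF assms]])

text \<open>The derivative of a pulled-back function is a combination of the pullbacks of
  \<open>P f\<close> and \<open>Q f\<close>, which are again smooth. A formula for the first
  derivative thus bootstraps to all orders, with no separate smoothness proof for
  \<open>G\<close>.\<close>

lemma Ck_on_pullback: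
  fixes f :: "real^2 \<Rightarrow> real" and G :: "real^2 \<Rightarrow> real^2" and P Q :: "(real^2 \<Rightarrow> real) \<Rightarrow> real^2 \<Rightarrow> real"
  assumes V: "open V"
    and PQ: "\<And>f. Cinf_on f U \<Longrightarrow> Cinf_on (P f) U" "\<And>f. Cinf_on f U \<Longrightarrow> Cinf_on (Q f) U"
    and der: "\<And>f y. Cinf_on f U \<Longrightarrow> y \<in> V \<Longrightarrow>
      ((\<lambda>y. f (G y)) has_derivative (\<lambda>v. v$1 * P f (G y) + v$2 * Q f (G y))) (at y)"
  shows "Cinf_on f U \<Longrightarrow> Ck_on k (\<lambda>y. f (G y)) V"
proof (induction k arbitrary: f)
  case 0
  have "isCont (\<lambda>y. f (G y)) y" if "y \<in> V" for y
    using der[OF 0 that] has_derivative_continuous by blast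
  then show ?case by (simp add: continuous_at_imp_continuous_on)
next
  case (Suc k)
  have "Ck_on k (\<lambda>y. v$1 * P f (G y) + v$2 * Q f (G y)) V" for v :: "real^2"
    by (intro Ck_on_add[OF V] Ck_on_bilinear[OF V bounded_bilinear_mult] Ck_on_const[OF V] Suc.IH PQ Suc.prems)
  then show ?case
    by (intro Ck_on_SucI[OF der[OF Suc.prems] V])
qed

definition jac :: "(real^2 \<Rightarrow> real) \<Rightarrow> (real^2 \<Rightarrow> real) \<Rightarrow> real^2 \<Rightarrow> real" where
  "jac f g x = pd 1 f x * pd 2 g x - pd 2 f x * pd 1 g x"

lemma Cinf_on_jac [simp]: "open U \<Longrightarrow> Cinf_on f U \<Longrightarrow> Cinf_on g U \<Longrightarrow> Cinf_on (jac f g) U"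
  unfolding jac_def[abs_def] by simp

text \<open>The inverse function theorem supplies \<open>G\<close>; Cramer's rule writes the
  derivatives in the new coordinates as quotients of Jacobians in the old ones, which is the form
  that \<open>Ck_on_pullback\<close> requires.\<close>

lemma local_coordinates:
  fixes f1 f2 :: "real^2 \<Rightarrow> real"
  assumes U: "open U" "x0 \<in> U" and f: "Cinf_on f1 U" "Cinf_on f2 U"
    and J: "\<And>x. x \<in> U \<Longrightarrow> jac f1 f2 x \<noteq> 0"
  obtains U' V G where "open U'" "U' \<subseteq> U" "x0 \<in> U'" "open V"
    "homeomorphism U' V (\<lambda>x. vector [f1 x, f2 x]) G"
    "\<And>h :: real^2 \<Rightarrow> real. Cinf_on h U \<Longrightarrow> Cinf_on (\<lambda>y. h (G y)) V"
    "\<And>h y. Cinf_on h U \<Longrightarrow> y \<in> V \<Longrightarrow> pd 1 (\<lambda>y. h (G y)) y = jac h f2 (G y) / jac f1 f2 (G y)"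
    "\<And>h y. Cinf_on h U \<Longrightarrow> y \<in> V \<Longrightarrow> pd 2 (\<lambda>y. h (G y)) y = jac f1 h (G y) / jac f1 f2 (G y)"
proof -
  define f where "f x = f1 x *\<^sub>R axis 1 1 + f2 x *\<^sub>R (axis 2 1 :: real^2)" for x :: "real^2"
  have f_vec: "f = (\<lambda>x. vector [f1 x, f2 x] :: real^2)"
    by (simp add: f_def fun_eq_iff vec_eq_iff forall_2 axis_def)
  define L where "L x v = (v$1 * pd 1 f1 x + v$2 * pd 2 f1 x) *\<^sub>R axis 1 1
    + (v$1 * pd 1 f2 x + v$2 * pd 2 f2 x) *\<^sub>R (axis 2 1 :: real^2)" for x v :: "real^2"
  \<comment> \<open>The adjugate of \<open>L x\<close> divided by its determinant, that is, the
    inverse linear map.\<close>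
  define K where "K x v = ((v$1 * pd 2 f2 x - v$2 * pd 2 f1 x) / jac f1 f2 x) *\<^sub>R axis 1 1
    + ((v$2 * pd 1 f1 x - v$1 * pd 1 f2 x) / jac f1 f2 x) *\<^sub>R (axis 2 1 :: real^2)" for x v :: "real^2"
  have bl: "bounded_linear (L x)" "bounded_linear (K x)" for x
    unfolding L_def[abs_def] K_def[abs_def]
    by (intro bounded_linear_intros bounded_linear_vec_nth bounded_linear_divide bounded_linear_compose[OF bounded_linear_divide])+
  have LK: "L x (K x v) = v" "K x (L x v) = v" if "x \<in> U" for x v
    using J[OF that] by (simp_all add: L_def K_def vec_eq_iff forall_2 axis_def field_simps)
      (simp_all add: jac_def algebra_simps)
  define f' where "f' x = Blinfun (L x)" for x
  have f': "blinfun_apply (f' x) = L x" for x by (simp add: f'_def bl bounded_linear_Blinfun_apply)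
  have der: "(f has_derivative blinfun_apply (f' x)) (at x)" if "x \<in> U" for x
  proof -
    have d: "(f1 has_derivative (\<lambda>v. v$1 * pd 1 f1 x + v$2 * pd 2 f1 x)) (at x)"
      "(f2 has_derivative (\<lambda>v. v$1 * pd 1 f2 x + v$2 * pd 2 f2 x)) (at x)"
      by (rule has_derivative_pd[OF _ that], fact f)+
    show ?thesis unfolding f' f_def[abs_def] L_def[abs_def]
      by (intro has_derivative_add has_derivative_scaleR_left d)
  qed
  have cont: "continuous_on U f'"
  proof (rule continuous_on_blinfun_componentwise)
    fix i :: "real^2"
    have "continuous_on U (pd j f1)" "continuous_on U (pd j f2)" for j
      using f by (simp_all add: Cinf_on_continuous)
    then show "continuous_on U (\<lambda>x. blinfun_apply (f' x) i)"
      unfolding f' L_def by (intro continuous_intros)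
  qed
  have inv: "Blinfun (K x0) o\<^sub>L f' x0 = id_blinfun"
    by (rule blinfun_eqI) (simp add: f' bounded_linear_Blinfun_apply bl LK U)
  obtain U' V G g' where I: "open U'" "U' \<subseteq> U" "x0 \<in> U'" "open V" "f x0 \<in> V" "homeomorphism U' V f G"
    "\<And>y. y \<in> V \<Longrightarrow> (G has_derivative (g' y)) (at y)"
    "\<And>y. y \<in> V \<Longrightarrow> g' y = inv (blinfun_apply (f' (G y)))"
    using inverse_function_theorem[OF U(1) der cont U(2) inv] by (metis (no_types, lifting))
  have GU: "G y \<in> U" if "y \<in> V" for y
    using I(2,6) that by (auto simp: homeomorphism_def)
  have dG: "(G has_derivative K (G y)) (at y)" if y: "y \<in> V" for y
  proof -
    have "inv (L (G y)) = K (G y)"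
      by (rule inv_unique_comp) (use LK[OF GU[OF y]] in \<open>auto simp: fun_eq_iff\<close>)
    then show ?thesis using I(7,8)[OF y] by (simp add: f')
  qed
  have dh: "((\<lambda>y. h (G y)) has_derivative (\<lambda>v. v$1 * (jac h f2 (G y) / jac f1 f2 (G y))
      + v$2 * (jac f1 h (G y) / jac f1 f2 (G y)))) (at y)" if h: "Cinf_on h U" and y: "y \<in> V" for h y
  proof -
    have "((\<lambda>y. h (G y)) has_derivative (\<lambda>v. frechet_derivative h (at (G y)) (K (G y) v))) (at y)"
      by (rule has_derivative_compose[where f=G and g=h, OF dG[OF y] Cinf_on_has_derivative[OF h GU[OF y]]])
    then show ?thesis
      by (rule has_derivative_eq_rhs)
        (use J[OF GU[OF y]] in \<open>simp add: fun_eq_iff frechet_eq_pd[OF Cinf_on_differentiable[OF h GU[OF y]]]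
            K_def axis_def jac_def field_simps\<close>)
  qed
  have smooth: "Cinf_on (\<lambda>y. h (G y)) V" if h: "Cinf_on h U" for h :: "real^2 \<Rightarrow> real"
    unfolding Cinf_on_def
  proof
    show "Ck_on k (\<lambda>y. h (G y)) V" for k
    proof (rule Ck_on_pullback[where U=U and G=G and P="\<lambda>h x. jac h f2 x / jac f1 f2 x"
          and Q="\<lambda>h x. jac f1 h x / jac f1 f2 x", OF I(4)])
      fix g :: "real^2 \<Rightarrow> real" and y assume "Cinf_on g U" "y \<in> V"
      then show "((\<lambda>y. g (G y)) has_derivative (\<lambda>v. v$1 * (jac g f2 (G y) / jac f1 f2 (G y))
        + v$2 * (jac f1 g (G y) / jac f1 f2 (G y)))) (at y)"
        by (rule dh)
    qed (use U f J h in auto)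
  qed
  show ?thesis
    by (rule that[OF I(1-4) I(6)[unfolded f_vec] smooth])
      (simp_all add: pd_eqI[OF dh] axis_def)
qed

lemma pd_chain:
  fixes w f1 f2 :: "real^2 \<Rightarrow> real"
  assumes w: "Cinf_on w V" and f: "Cinf_on f1 U" "Cinf_on f2 U" and x: "x \<in> U" "vector [f1 x, f2 x] \<in> V"
  shows "pd i (\<lambda>x. w (vector [f1 x, f2 x])) x
    = pd 1 w (vector [f1 x, f2 x]) * pd i f1 x + pd 2 w (vector [f1 x, f2 x]) * pd i f2 x"
proof -
  have eq: "(\<lambda>x. vector [f1 x, f2 x]) = (\<lambda>x. f1 x *\<^sub>R axis 1 1 + f2 x *\<^sub>R (axis 2 1 :: real^2))"
    by (simp add: fun_eq_iff vec_eq_iff forall_2 axis_def)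
  have "((\<lambda>x. vector [f1 x, f2 x] :: real^2) has_derivative
     (\<lambda>v. (v$1 * pd 1 f1 x + v$2 * pd 2 f1 x) *\<^sub>R axis 1 1 + (v$1 * pd 1 f2 x + v$2 * pd 2 f2 x) *\<^sub>R axis 2 1)) (at x)"
    unfolding eq
    by (intro has_derivative_add has_derivative_scaleR_left has_derivative_pd[OF f(1) x(1)] has_derivative_pd[OF f(2) x(1)])
  from pd_eqI[OF has_derivative_compose[OF this has_derivative_pd[OF w x(2)]], of i]
  show ?thesis using exhaust_2[of i] by (auto simp: axis_def)
qed

lemma pd_inner_const:
  fixes X :: "real^2 \<Rightarrow> real^3"
  assumes "Cinf_on X U" "x \<in> U"
  shows "pd i (\<lambda>x. X x \<bullet> b) x = pd i X x \<bullet> b"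
  by (rule pd_eqI[THEN trans, OF has_derivative_inner_left[OF Cinf_on_has_derivative[OF assms]]])
    (simp add: pd_def)

text \<open>Coordinates are chosen so that the surface is a graph over its tangent plane at \<open>x0\<close>, on
  the side opposite to \<open>N\<close>.\<close>

theorem parametric_constant_rank:
  fixes X N :: "real^2 \<Rightarrow> real^3" and F F1 F2 :: "real \<Rightarrow> real" and e :: "real^3"
  defines "g \<equiv> \<lambda>i j x. pd i X x \<bullet> pd j X x"
    and "h \<equiv> \<lambda>i j x. - (pd j (pd i X) x \<bullet> N x)"
  assumes U: "open U" and X: "Cinf_on X U" and N: "Cinf_on N U"
    and imm: "\<And>x. x \<in> U \<Longrightarrow> g 1 1 x * g 2 2 x - g 1 2 x * g 1 2 x > 0"
    and unit: "\<And>x. x \<in> U \<Longrightarrow> norm (N x) = 1"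
    and ortho: "\<And>x i. x \<in> U \<Longrightarrow> N x \<bullet> pd i X x = 0"
    and psd: "\<And>x a b. x \<in> U \<Longrightarrow> 0 \<le> h 1 1 x * a\<^sup>2 + 2 * h 1 2 x * (a * b) + h 2 2 x * b\<^sup>2"
    and mean: "\<And>x. x \<in> U \<Longrightarrow> g 2 2 x * h 1 1 x - 2 * g 1 2 x * h 1 2 x + g 1 1 x * h 2 2 x
      = - ((g 1 1 x * g 2 2 x - g 1 2 x * g 1 2 x) * F (X x \<bullet> e) * (N x \<bullet> e))"
    and F: "\<And>\<tau>. \<tau> \<in> T \<Longrightarrow> (F has_real_derivative F1 \<tau>) (at \<tau>)" "Cinf_on F T"
    and F1: "\<And>\<tau>. \<tau> \<in> T \<Longrightarrow> (F1 has_real_derivative F2 \<tau>) (at \<tau>)" "Cinf_on F1 T"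
    and F_pos: "\<And>\<tau>. \<tau> \<in> T \<Longrightarrow> F \<tau> > 0" and F2_le: "\<And>\<tau>. \<tau> \<in> T \<Longrightarrow> F2 \<tau> \<le> 0"
    and XT: "\<And>x. x \<in> U \<Longrightarrow> X x \<bullet> e \<in> T"
    and x0: "x0 \<in> U" "h 1 1 x0 * h 2 2 x0 - h 1 2 x0 * h 1 2 x0 = 0"
  shows "\<exists>d>0. ball x0 d \<subseteq> U \<and> (\<forall>x\<in>ball x0 d. h 1 1 x * h 2 2 x - h 1 2 x * h 1 2 x = 0)"
proof -
  \<comment> \<open>With this sign \<open>N \<bullet> b3\<close> is negative near \<open>x0\<close>,
    so \<open>h\<close> corresponds to a positive multiple of the Hessian of the graph
    function.\<close>
  define b3 where "b3 = - N x0"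
  obtain b1 b2 where parseval: "\<And>x y :: real^3. x \<bullet> y
      = (x \<bullet> b1) * (y \<bullet> b1) + (x \<bullet> b2) * (y \<bullet> b2) + (x \<bullet> b3) * (y \<bullet> b3)"
    using orthonormal_frame[of b3] unit[OF x0(1)] by (auto simp: b3_def)
  define X1 where "X1 x = X x \<bullet> b1" for x
  define X2 where "X2 x = X x \<bullet> b2" for x
  define X3 where "X3 x = X x \<bullet> b3" for x
  have Xs: "Cinf_on X1 U" "Cinf_on X2 U" "Cinf_on X3 U"
    unfolding X1_def[abs_def] X2_def[abs_def] X3_def[abs_def] using U X by simp_all
  have pdX: "pd i X1 x = pd i X x \<bullet> b1" "pd i X2 x = pd i X x \<bullet> b2" "pd i X3 x = pd i X x \<bullet> b3" if "x \<in> U" for x i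
    unfolding X1_def[abs_def] X2_def[abs_def] X3_def[abs_def] using pd_inner_const[OF X that] by auto
  have pdpdX: "pd j (pd i X1) x = pd j (pd i X) x \<bullet> b1" "pd j (pd i X2) x = pd j (pd i X) x \<bullet> b2"
    "pd j (pd i X3) x = pd j (pd i X) x \<bullet> b3" if "x \<in> U" for x i j
    using pd_cong[OF U that pdX(1) Cinf_on_pd[OF Xs(1)]] pd_cong[OF U that pdX(2) Cinf_on_pd[OF Xs(2)]]
      pd_cong[OF U that pdX(3) Cinf_on_pd[OF Xs(3)]]
      pd_inner_const[OF Cinf_on_pd[OF X] that] by auto
  define J where "J = jac X1 X2"
  define U1 where "U1 = {x \<in> U. N x \<bullet> b3 < 0 \<and> J x \<noteq> 0}"
  have "continuous_on U (\<lambda>x. N x \<bullet> b3)" "continuous_on U J"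
    using U Xs N by (simp_all add: Cinf_on_continuous J_def)
  then have "open (U \<inter> (\<lambda>x. N x \<bullet> b3) -` {..<0})" "open (U \<inter> J -` (- {0}))"
    using U by (auto intro!: continuous_open_preimage)
  moreover have "U1 = (U \<inter> (\<lambda>x. N x \<bullet> b3) -` {..<0}) \<inter> (U \<inter> J -` (- {0}))"
    by (auto simp: U1_def)
  ultimately have U1: "open U1" "U1 \<subseteq> U" by auto
  have "N x0 \<bullet> N x0 = 1" using unit[OF x0(1)] by (simp add: norm_eq_sqrt_inner)
  moreover have "J x0 \<noteq> 0"
  proof
    assume J0: "J x0 = 0"
    \<comment> \<open>At \<open>x0\<close> tangent vectors have no component along
      \<open>b3\<close>, so the Gram determinant equals the square of the Jacobian.\<close>
    have g0: "g i j x0 = pd i X1 x0 * pd j X1 x0 + pd i X2 x0 * pd j X2 x0" for i j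
      using ortho[OF x0(1)] parseval[of "pd i X x0" "pd j X x0"] pdX[OF x0(1)]
      by (simp add: g_def b3_def inner_commute)
    have "g 1 1 x0 * g 2 2 x0 - g 1 2 x0 * g 1 2 x0 = (J x0)\<^sup>2"
      by (simp add: g0 J_def jac_def algebra_simps power2_eq_square)
    then show False using imm[OF x0(1)] J0 by simp
  qed
  ultimately have x0U1: "x0 \<in> U1" using x0 by (simp add: U1_def b3_def)
  note Xs1 = Xs[THEN Cinf_on_subset, OF U1(2)]
  obtain U' V G where I: "open U'" "U' \<subseteq> U1" "x0 \<in> U'" "open V"
    "homeomorphism U' V (\<lambda>x. vector [X1 x, X2 x]) G"
    "\<And>h :: real^2 \<Rightarrow> real. Cinf_on h U1 \<Longrightarrow> Cinf_on (\<lambda>y. h (G y)) V"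
    "\<And>h y. Cinf_on h U1 \<Longrightarrow> y \<in> V \<Longrightarrow> pd 1 (\<lambda>y. h (G y)) y = jac h X2 (G y) / jac X1 X2 (G y)"
    "\<And>h y. Cinf_on h U1 \<Longrightarrow> y \<in> V \<Longrightarrow> pd 2 (\<lambda>y. h (G y)) y = jac X1 h (G y) / jac X1 X2 (G y)"
    by (rule local_coordinates[OF U1(1) x0U1 Xs1(1,2)]) (auto simp: U1_def J_def)
  define f where "f x = (vector [X1 x, X2 x] :: real^2)" for x
  have G: "G y \<in> U'" "f (G y) = y" if "y \<in> V" for y
    using I(5) that by (auto simp: homeomorphism_def f_def)
  have f: "f x \<in> V" "G (f x) = x" if "x \<in> U'" for x
    using I(5) that by (auto simp: homeomorphism_def f_def)
  have U'U: "x \<in> U1" "x \<in> U" if "x \<in> U'" for x using that I(2) U1(2) by auto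
  define u where "u y = X3 (G y)" for y
  have u: "Cinf_on u V" unfolding u_def[abs_def] by (rule I(6)[OF Xs1(3)])
  define p where "p x = pd 1 u (f x)" for x
  define q where "q x = pd 2 u (f x)" for x
  define r where "r x = pd 1 (pd 1 u) (f x)" for x
  define s where "s x = pd 2 (pd 1 u) (f x)" for x
  define t where "t x = pd 2 (pd 2 u) (f x)" for x
  note XsU' = Xs1[THEN Cinf_on_subset, OF I(2)]
  have pq: "Cinf_on p U'" "Cinf_on q U'"
  proof -
    have "p x = jac X3 X2 x / jac X1 X2 x" "q x = jac X1 X3 x / jac X1 X2 x" if "x \<in> U'" for x
      using I(7,8)[OF Xs1(3) f(1)[OF that]] f(2)[OF that] by (simp_all add: p_def q_def u_def[abs_def])
    moreover have "Cinf_on (\<lambda>x. jac X3 X2 x / jac X1 X2 x) U'" "Cinf_on (\<lambda>x. jac X1 X3 x / jac X1 X2 x) U'"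
      using I(1) XsU' U'U(1) by (auto simp: U1_def J_def)
    ultimately show "Cinf_on p U'" "Cinf_on q U'" by (auto intro: Cinf_on_cong[OF I(1)])
  qed
  have chain: "pd i (\<lambda>x. w (f x)) x = pd 1 w (f x) * pd i X1 x + pd 2 w (f x) * pd i X2 x"
    if "Cinf_on w V" "x \<in> U'" for w i x
    using pd_chain[OF that(1) XsU'(1,2) that(2)] f(1)[OF that(2)] by (simp add: f_def)
  have pdX3: "pd i X3 x = p x * pd i X1 x + q x * pd i X2 x" if x: "x \<in> U'" for i x
  proof -
    have "pd i X3 x = pd i (\<lambda>x. u (f x)) x"
      by (rule pd_cong[OF I(1) x _ XsU'(3)]) (simp add: u_def f)
    then show ?thesis using chain[OF u x] by (simp add: p_def q_def)
  qed
  have pdpq: "pd i p x = r x * pd i X1 x + s x * pd i X2 x" "pd i q x = s x * pd i X1 x + t x * pd i X2 x"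
    if x: "x \<in> U'" for i x
    using chain[OF Cinf_on_pd[OF u, of 1] x] chain[OF Cinf_on_pd[OF u, of 2] x] pd_commute[OF I(4) u f(1)[OF x], of 1 2]
    by (simp_all add: p_def[abs_def] q_def[abs_def] r_def s_def t_def)
  have pdpdX3: "pd j (pd i X3) x = p x * pd j (pd i X1) x + q x * pd j (pd i X2) x
      + (r x * pd j X1 x + s x * pd j X2 x) * pd i X1 x + (s x * pd j X1 x + t x * pd j X2 x) * pd i X2 x"
    if x: "x \<in> U'" for i j x
  proof -
    have "pd j (pd i X3) x = pd j (\<lambda>x. p x * pd i X1 x + q x * pd i X2 x) x"
      by (rule pd_cong[OF I(1) x pdX3 Cinf_on_pd[OF XsU'(3)]])
    also have "\<dots> = pd j (\<lambda>x. p x * pd i X1 x) x + pd j (\<lambda>x. q x * pd i X2 x) x"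
      by (rule pd_add[where S=U']) (use I(1) pq XsU' x in auto)
    also have "\<dots> = (p x * pd j (pd i X1) x + pd j p x * pd i X1 x) + (q x * pd j (pd i X2) x + pd j q x * pd i X2 x)"
      using pd_mult[OF pq(1) Cinf_on_pd[OF XsU'(1)] x] pd_mult[OF pq(2) Cinf_on_pd[OF XsU'(2)] x] by simp
    finally show ?thesis using pdpq[OF x] by simp
  qed
  define n where "n x = N x \<bullet> b3" for x
  define \<alpha> where "\<alpha> = e \<bullet> b1"
  define \<beta> where "\<beta> = e \<bullet> b2"
  define \<gamma> where "\<gamma> = e \<bullet> b3"
  define W where "W x = 1 + p x * p x + q x * q x" for x
  have main: "n x < 0" "J x \<noteq> 0" "N x \<bullet> b1 = - n x * p x" "N x \<bullet> b2 = - n x * q x"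
    if x: "x \<in> U'" for x
  proof -
    show "n x < 0" and J: "J x \<noteq> 0" using U'U[OF x] by (auto simp: U1_def n_def)
    \<comment> \<open>Orthogonality to the two coordinate tangent vectors is a homogeneous linear
      system with determinant \<open>J x\<close>, hence both coefficients vanish.\<close>
    have "(N x \<bullet> b1 + n x * p x) * pd i X1 x + (N x \<bullet> b2 + n x * q x) * pd i X2 x = 0" for i
    proof -
      have "pd i X x \<bullet> b3 = p x * (pd i X x \<bullet> b1) + q x * (pd i X x \<bullet> b2)"
        using pdX[OF U'U(2)[OF x], of i] pdX3[OF x, of i] by simp
      then show ?thesis
        using ortho[OF U'U(2)[OF x], of i] parseval[of "N x" "pd i X x"]
        by (simp add: n_def pdX[OF U'U(2)[OF x]] algebra_simps)
    qed
    from this[of 1] this[of 2]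
    have "(N x \<bullet> b1 + n x * p x) * J x = 0" "(N x \<bullet> b2 + n x * q x) * J x = 0"
      unfolding J_def jac_def by algebra+
    then show "N x \<bullet> b1 = - n x * p x" "N x \<bullet> b2 = - n x * q x" using J by (simp_all add: eq_neg_iff_add_eq_0)
  qed
  have h_eq: "h i j x = - n x * ((r x * pd j X1 x + s x * pd j X2 x) * pd i X1 x
      + (s x * pd j X1 x + t x * pd j X2 x) * pd i X2 x)" if x: "x \<in> U'" for i j x
  proof -
    have "pd j (pd i X) x \<bullet> b3 = p x * (pd j (pd i X) x \<bullet> b1) + q x * (pd j (pd i X) x \<bullet> b2)
      + (r x * pd j X1 x + s x * pd j X2 x) * pd i X1 x + (s x * pd j X1 x + t x * pd j X2 x) * pd i X2 x"
      using pdpdX[OF U'U(2)[OF x], of j i] pdpdX3[OF x, of j i] by simp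
    then show ?thesis
      unfolding h_def parseval[of "pd j (pd i X) x" "N x"] main(3,4)[OF x] n_def[symmetric]
      by (simp add: algebra_simps)
  qed
  have g_eq: "g i j x = pd i X1 x * pd j X1 x + pd i X2 x * pd j X2 x
      + (p x * pd i X1 x + q x * pd i X2 x) * (p x * pd j X1 x + q x * pd j X2 x)" if x: "x \<in> U'" for i j x
    using parseval[of "pd i X x" "pd j X x"] pdX[OF U'U(2)[OF x]] pdX3[OF x] by (simp add: g_def)
  \<comment> \<open>With \<open>P\<close> the Jacobian matrix of \<open>(X1, X2)\<close>,
    \<open>h_eq\<close> and \<open>g_eq\<close> say that \<open>h\<close> is \<open>- n\<close>
    times the Hessian of \<open>u\<close>, and \<open>g\<close> the metric of the graph, both
    transformed by \<open>P\<close>; each determinant picks up a factor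
    \<open>J\<^sup>2\<close>.\<close>
  have det_h: "h 1 1 x * h 2 2 x - h 1 2 x * h 1 2 x = (n x * J x)\<^sup>2 * (r x * t x - s x * s x)" if x: "x \<in> U'" for x
    unfolding h_eq[OF x] J_def jac_def by (simp add: algebra_simps power2_eq_square)
  have det_g: "g 1 1 x * g 2 2 x - g 1 2 x * g 1 2 x = (J x)\<^sup>2 * W x" if x: "x \<in> U'" for x
    unfolding g_eq[OF x] J_def jac_def W_def by (simp add: algebra_simps power2_eq_square)
  have tr: "g 2 2 x * h 1 1 x - 2 * g 1 2 x * h 1 2 x + g 1 1 x * h 2 2 x
    = - n x * (J x)\<^sup>2 * ((1 + q x * q x) * r x - 2 * (p x * q x) * s x + (1 + p x * p x) * t x)" if x: "x \<in> U'" for x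
    unfolding g_eq[OF x] h_eq[OF x] J_def jac_def by (simp add: algebra_simps power2_eq_square)
  have height: "X x \<bullet> e = \<alpha> * f x $ 1 + \<beta> * f x $ 2 + \<gamma> * u (f x) + 0" if x: "x \<in> U'" for x
    using parseval[of "X x" e] f[OF x] by (simp add: \<alpha>_def \<beta>_def \<gamma>_def f_def X1_def X2_def u_def X3_def)
  interpret G: convex_graph V u F F1 F2 T \<alpha> \<beta> \<gamma> 0 "pd 1 u" "pd 2 u" "pd 1 (pd 1 u)" "pd 2 (pd 1 u)" "pd 2 (pd 2 u)"
    "\<lambda>x. \<alpha> * x$1 + \<beta> * x$2 + \<gamma> * u x + 0" "\<lambda>x. \<gamma> - \<alpha> * pd 1 u x - \<beta> * pd 2 u x"
    "\<lambda>x. pd 1 (pd 1 u) x * pd 2 (pd 2 u) x - pd 2 (pd 1 u) x * pd 2 (pd 1 u) x"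
  proof (unfold_locales, goal_cases)
    \<comment> \<open>Cases 9, 10 and 11 are the locale assumptions \<open>zT\<close>,
      \<open>psd\<close> and \<open>pde\<close>.\<close>
    case (9 y)
    then show ?case using XT[OF U'U(2)[OF G(1)[OF 9]]] height[OF G(1)[OF 9]] by (simp add: G)
  next
    case (10 y a b)
    let ?x = "G y"
    have x: "?x \<in> U'" using G 10 by blast
    \<comment> \<open>The vector inserted into \<open>psd\<close> is the adjugate of the Jacobian
      matrix applied to \<open>(a, b)\<close>; the Jacobian matrix maps it to \<open>J\<close> times
      \<open>(a, b)\<close>.\<close>
    have "0 \<le> (- n ?x * (J ?x)\<^sup>2) * (r ?x * a\<^sup>2 + 2 * s ?x * (a * b) + t ?x * b\<^sup>2)"
      using psd[OF U'U(2)[OF x], of "a * pd 2 X2 ?x - b * pd 2 X1 ?x" "b * pd 1 X1 ?x - a * pd 1 X2 ?x"]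
      unfolding h_eq[OF x] J_def jac_def by (simp add: algebra_simps power2_eq_square)
    moreover have "- n ?x * (J ?x)\<^sup>2 > 0" using main(1,2)[OF x] by (simp add: mult_neg_pos)
    ultimately have "0 \<le> r ?x * a\<^sup>2 + 2 * s ?x * (a * b) + t ?x * b\<^sup>2"
      by (meson linorder_not_le mult_pos_neg)
    then show ?case using G(2)[OF 10] by (simp add: r_def s_def t_def)
  next
    case (11 y)
    let ?x = "G y"
    have x: "?x \<in> U'" using G 11 by blast
    have Ne: "N ?x \<bullet> e = n ?x * (\<gamma> - \<alpha> * p ?x - \<beta> * q ?x)"
      using parseval[of "N ?x" e] main(3,4)[OF x] by (simp add: \<alpha>_def \<beta>_def \<gamma>_def n_def algebra_simps)
    have "n ?x * (J ?x)\<^sup>2 * ((1 + q ?x * q ?x) * r ?x - 2 * (p ?x * q ?x) * s ?x + (1 + p ?x * p ?x) * t ?x)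
      = n ?x * (J ?x)\<^sup>2 * (W ?x * (\<gamma> - \<alpha> * p ?x - \<beta> * q ?x) * F (X ?x \<bullet> e))"
      using mean[OF U'U(2)[OF x]] unfolding tr[OF x] det_g[OF x] Ne by (simp add: algebra_simps)
    then have "(1 + q ?x * q ?x) * r ?x - 2 * (p ?x * q ?x) * s ?x + (1 + p ?x * p ?x) * t ?x
      = W ?x * (\<gamma> - \<alpha> * p ?x - \<beta> * q ?x) * F (X ?x \<bullet> e)"
      using main(1,2)[OF x] by simp
    then show ?case unfolding height[OF x] W_def p_def q_def r_def s_def t_def G(2)[OF 11] .
  qed (use I(4) u F F1 F_pos F2_le in auto)
  have "r x0 * t x0 - s x0 * s x0 = 0"
    using det_h[OF I(3)] x0(2) main(1,2)[OF I(3)] by simp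
  then obtain d where d: "d > 0" "ball (f x0) d \<subseteq> V"
    "\<And>y. y \<in> ball (f x0) d \<Longrightarrow> pd 1 (pd 1 u) y * pd 2 (pd 2 u) y - pd 2 (pd 1 u) y * pd 2 (pd 1 u) y = 0"
    using G.constant_rank[OF f(1)[OF I(3)]] by (auto simp: r_def s_def t_def)
  have "continuous_on U' f" using I(5) by (simp add: homeomorphism_def f_def[abs_def])
  then have "open (U' \<inter> f -` ball (f x0) d)" using I(1) by (intro continuous_open_preimage) auto
  moreover have "x0 \<in> U' \<inter> f -` ball (f x0) d" using I(3) d(1) by simp
  ultimately obtain \<epsilon> where \<epsilon>: "\<epsilon> > 0" "ball x0 \<epsilon> \<subseteq> U' \<inter> f -` ball (f x0) d"
    using open_contains_ball by blast
  have "h 1 1 x * h 2 2 x - h 1 2 x * h 1 2 x = 0" if "x \<in> ball x0 \<epsilon>" for x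
  proof -
    have x: "x \<in> U'" "f x \<in> ball (f x0) d" using that \<epsilon> by auto
    show ?thesis using det_h[OF x(1)] d(3)[OF x(2)] by (simp add: r_def s_def t_def)
  qed
  moreover have "ball x0 \<epsilon> \<subseteq> U" using \<epsilon>(2) U'U(2) by auto
  ultimately show ?thesis using \<epsilon>(1) by blast
qed

section \<open>The weight function\<close>

lemma Cinf_on_deriv:
  fixes f :: "real \<Rightarrow> real"
  assumes "open T" "Cinf_on f T"
  shows "Cinf_on (deriv f) T" and "t \<in> T \<Longrightarrow> (f has_real_derivative deriv f t) (at t)"
proof -
  have d: "(f has_real_derivative frechet_derivative f (at t) 1) (at t)" if "t \<in> T" for t
  proof -
    have "f differentiable (at t)" using Cinf_on_differentiable[OF assms(2) that] .
    then have lin: "frechet_derivative f (at t) h = frechet_derivative f (at t) 1 * h" for h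
      using linear_scale[OF linear_frechet_derivative, of f "at t" h 1] by simp
    show ?thesis
      unfolding has_field_derivative_def
      by (rule has_derivative_eq_rhs[OF has_frechet_derivative[OF \<open>f differentiable at t\<close>]])
        (rule ext, rule lin)
  qed
  then have e: "deriv f t = frechet_derivative f (at t) 1" if "t \<in> T" for t
    using that by (simp add: DERIV_imp_deriv)
  show "Cinf_on (deriv f) T"
    by (rule Cinf_on_cong[OF assms(1) _ Cinf_on_frechet[OF assms(2), of 1]]) (simp add: e)
  show "t \<in> T \<Longrightarrow> (f has_real_derivative deriv f t) (at t)" using d e by simp
qed

text \<open>Strict monotonicity alone allows \<open>f1\<close> to have zeros; concavity of \<open>f1\<close> excludes them.\<close>

lemma strict_mono_concave_derivative_pos:
  fixes f f1 f2 f3 :: "real \<Rightarrow> real"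
  assumes T: "open T" "\<And>x y z. x \<in> T \<Longrightarrow> y \<in> T \<Longrightarrow> x \<le> z \<Longrightarrow> z \<le> y \<Longrightarrow> z \<in> T"
    and f: "\<And>x. x \<in> T \<Longrightarrow> (f has_real_derivative f1 x) (at x)"
    and f1: "\<And>x. x \<in> T \<Longrightarrow> (f1 has_real_derivative f2 x) (at x)"
    and f2: "\<And>x. x \<in> T \<Longrightarrow> (f2 has_real_derivative f3 x) (at x)"
    and f3: "\<And>x. x \<in> T \<Longrightarrow> f3 x \<le> 0"
    and mono: "strict_mono_on T f" and t: "t \<in> T"
  shows "f1 t > 0"
proof -
  have nonneg: "f1 x \<ge> 0" if x: "x \<in> T" for x
  proof (rule ccontr)
    assume "\<not> f1 x \<ge> 0"
    then obtain d where d: "d > 0" "\<And>h. h > 0 \<Longrightarrow> h < d \<Longrightarrow> f (x + h) < f x"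
      using DERIV_neg_dec_right[OF f[OF x]] by auto
    obtain e where e: "e > 0" "ball x e \<subseteq> T" using T(1) x open_contains_ball by blast
    define h where "h = min d e / 2"
    have "h > 0" "h < d" "x + h \<in> T" using d e by (auto simp: h_def dist_real_def subset_eq)
    then show False using d(2)[of h] strict_mono_onD[OF mono x, of "x + h"] by simp
  qed
  have "f1 t \<noteq> 0"
  proof
    assume z: "f1 t = 0"
    obtain e where e: "e > 0" "ball t e \<subseteq> T" using T(1) t open_contains_ball by blast
    \<comment> \<open>A zero of the nonnegative function \<open>f1\<close> is a minimum.\<close>
    have "f2 t = 0"
      by (rule DERIV_local_min[OF f1[OF t] e(1)]) (use nonneg z e in \<open>auto simp: dist_real_def\<close>)
    define t' where "t' = t + e / 2"
    have t': "t < t'" "t' \<in> T" using e by (auto simp: t'_def dist_real_def subset_eq)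
    have inT: "x \<in> T" if "t \<le> x" "x \<le> t'" for x using T(2)[OF t t'(2) that] .
    \<comment> \<open>Nested mean values descend from \<open>f\<close> to \<open>f3\<close>; the
      sign of \<open>f3\<close> then climbs back up to \<open>f t' \<le> f t\<close>, against strict
      monotonicity.\<close>
    obtain x where x: "t < x" "x < t'" "f t' - f t = (t' - t) * f1 x"
      using MVT2[OF t'(1), of f f1] f inT by auto
    obtain y where y: "t < y" "y < x" "f1 x - f1 t = (x - t) * f2 y"
      using MVT2[OF x(1), of f1 f2] f1 inT x by (meson less_imp_le order_trans)
    obtain w where w: "t < w" "w < y" "f2 y - f2 t = (y - t) * f3 w"
      using MVT2[OF y(1), of f2 f3] f2 inT x y by (meson less_imp_le order_trans)
    have "f2 y \<le> 0" using w f3[OF inT[of w]] x y \<open>f2 t = 0\<close> by (simp add: mult_nonneg_nonpos)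
    then have "f1 x \<le> 0" using y z by (simp add: mult_nonneg_nonpos)
    then have "f t' \<le> f t" using x by (smt (verit) mult_nonneg_nonpos)
    then show False using strict_mono_onD[OF mono t t'(2) t'(1)] by simp
  qed
  then show ?thesis using nonneg[OF t] by simp
qed

section \<open>Linear algebra\<close>

text \<open>In the index type \<open>2\<close> arithmetic is modulo 2, so \<open>3 - i\<close> is
  the other index and the matrix is the adjugate over the determinant.\<close>

lemma matrix_inv_2:
  fixes A :: "real^2^2"
  assumes d: "det A \<noteq> 0"
  shows "matrix_inv A = (\<chi> i j. (if i = j then A $ (3 - i) $ (3 - j) else - A $ i $ j) / det A)"
    and "det (matrix_inv A) \<noteq> 0"
proof -
  define B where "B = (\<chi> i j. (if i = j then A $ (3 - i) $ (3 - j) else - A $ i $ j) / det A)"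
  have B: "A ** B = mat 1" "B ** A = mat 1"
    using d by (simp_all add: B_def vec_eq_iff matrix_matrix_mult_def forall_2 sum_2 mat_def field_simps)
      (simp_all add: det_2 algebra_simps)
  have "A ** matrix_inv A = mat 1 \<and> matrix_inv A ** A = mat 1"
    unfolding matrix_inv_def by (rule someI[of _ B]) (use B in auto)
  then show "matrix_inv A = (\<chi> i j. (if i = j then A $ (3 - i) $ (3 - j) else - A $ i $ j) / det A)"
    using B unfolding B_def[symmetric] by (metis matrix_mul_assoc matrix_mul_lid matrix_mul_rid)
  show "det (matrix_inv A) \<noteq> 0"
    using \<open>A ** matrix_inv A = mat 1 \<and> _\<close> by (metis det_I det_mul mult_zero_right zero_neq_one)
qed

text \<open>Strict Cauchy-Schwarz: by injectivity
  \<open>(b \<bullet> b) *\<^sub>R a - (a \<bullet> b) *\<^sub>R b\<close> is nonzero, and its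
  squared length is \<open>b \<bullet> b\<close> times the Gram determinant.\<close>

lemma gram_det_pos:
  fixes L :: "real^2 \<Rightarrow> real^3"
  assumes L: "linear L" "inj L"
  defines "a \<equiv> L (axis 1 1)" and "b \<equiv> L (axis 2 1)"
  shows "(a \<bullet> a) * (b \<bullet> b) - (a \<bullet> b) * (a \<bullet> b) > 0"
proof -
  have nz: "L v \<noteq> 0" if "v \<noteq> 0" for v using that L by (metis linear_injective_0)
  have "b \<noteq> 0" unfolding b_def by (rule nz) simp
  then have b: "b \<bullet> b > 0" by simp
  have "(b \<bullet> b) *\<^sub>R a - (a \<bullet> b) *\<^sub>R b = L ((b \<bullet> b) *\<^sub>R axis 1 1 - (a \<bullet> b) *\<^sub>R axis 2 1)"
    by (simp add: a_def b_def linear_diff[OF L(1)] linear_scale[OF L(1)])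
  moreover have "(b \<bullet> b) *\<^sub>R axis 1 1 - (a \<bullet> b) *\<^sub>R axis 2 1 \<noteq> (0 :: real^2)"
    using b by (simp add: vec_eq_iff forall_2 axis_def)
  ultimately have "(b \<bullet> b) *\<^sub>R a - (a \<bullet> b) *\<^sub>R b \<noteq> 0" using nz by metis
  then have "0 < ((b \<bullet> b) *\<^sub>R a - (a \<bullet> b) *\<^sub>R b) \<bullet> ((b \<bullet> b) *\<^sub>R a - (a \<bullet> b) *\<^sub>R b)" by simp
  also have "\<dots> = (b \<bullet> b) * ((a \<bullet> a) * (b \<bullet> b) - (a \<bullet> b) * (a \<bullet> b))"
    by (simp add: inner_diff_left inner_diff_right inner_commute algebra_simps)
  finally show ?thesis using b by (simp add: zero_less_mult_iff)
qed

lemma range_eq_normal_complement: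
  fixes L :: "real^2 \<Rightarrow> real^3"
  assumes L: "linear L" "inj L" and n: "norm n = 1" "\<And>v. n \<bullet> L v = 0"
  shows "range L = {y. n \<bullet> y = 0}"
proof (rule subspace_dim_equal)
  show "subspace (range L)" using L by (simp add: linear_subspace_image)
  show "subspace {y. n \<bullet> y = 0}" by (rule subspace_hyperplane)
  show "range L \<subseteq> {y. n \<bullet> y = 0}" using n by auto
  have "dim (range L) = 2" using dim_image_eq[OF L(1), of UNIV] L(2) by simp
  moreover have "dim {y. n \<bullet> y = 0} = 2" using dim_hyperplane[of n] n(1) by (cases "n = 0") auto
  ultimately show "dim {y. n \<bullet> y = 0} \<le> dim (range L)" by simp
qed

section \<open>Derivatives up to the boundary\<close>

definition plane_open :: "(real^2) set \<Rightarrow> bool" where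
  "plane_open S \<longleftrightarrow> openin (top_of_set half_plane) S"

lemma plane_open_ball:
  assumes "plane_open S" "x \<in> S"
  obtains r where "r > 0" "ball x r \<inter> half_plane \<subseteq> S"
  using assms unfolding plane_open_def openin_contains_ball by blast

lemma plane_open_subset: "plane_open S \<Longrightarrow> S \<subseteq> half_plane"
  unfolding plane_open_def using openin_subset by fastforce

text \<open>Even at a boundary point the half-plane contains short segments in both positive
  coordinate directions, and these determine the derivative.\<close>

lemma has_derivative_unique_plane_open:
  fixes f :: "real^2 \<Rightarrow> 'b::real_normed_vector"
  assumes S: "plane_open S" "x \<in> S"
    and f: "(f has_derivative f') (at x within S)" "(f has_derivative f'') (at x within S)"
  shows "f' = f''"
proof (rule frechet_derivative_unique_within[OF f])
  fix i :: "real^2" and e :: real assume i: "i \<in> Basis" and e: "e > 0"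
  obtain r where r: "r > 0" "ball x r \<inter> half_plane \<subseteq> S" using plane_open_ball[OF S] .
  have x: "0 \<le> x $ 2" using S plane_open_subset by (auto simp: half_plane_def)
  define d where "d = min e r / 2"
  have d: "d > 0" "d < e" "d < r" using e r by (auto simp: d_def)
  obtain j where j: "i = axis j 1" using i by (auto simp: Basis_vec_def)
  have "x + d *\<^sub>R i \<in> ball x r" using d i by (simp add: dist_norm)
  moreover have "x + d *\<^sub>R i \<in> half_plane" using x d j by (simp add: half_plane_def axis_def)
  ultimately show "\<exists>d. 0 < \<bar>d\<bar> \<and> \<bar>d\<bar> < e \<and> x + d *\<^sub>R i \<in> S"
    using r d by (intro exI[of _ d]) auto
qed

text \<open>The derivative that still makes sense at boundary points; with a chart image for
  \<open>S\<close> it is \<open>differential\<close> in coordinates.\<close>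

definition Dw :: "(real^2) set \<Rightarrow> (real^2 \<Rightarrow> 'b::real_normed_vector) \<Rightarrow> real^2 \<Rightarrow> real^2 \<Rightarrow> 'b" where
  "Dw S f x = frechet_derivative f (at x within S)"

lemma Dw_eqI:
  assumes "plane_open S" "x \<in> S" "(f has_derivative f') (at x within S)"
  shows "Dw S f x = f'"
proof -
  have "f differentiable (at x within S)" using assms(3) by (auto simp: differentiable_def)
  then have "(f has_derivative Dw S f x) (at x within S)" by (simp add: Dw_def frechet_derivative_works)
  then show ?thesis using has_derivative_unique_plane_open[OF assms(1,2)] assms(3) by blast
qed

lemma Dw_cong:
  assumes "x \<in> S" "\<And>y. y \<in> S \<Longrightarrow> f y = g y"
  shows "Dw S f x = Dw S g x"
proof -
  have "(f has_derivative f') (at x within S) \<longleftrightarrow> (g has_derivative f') (at x within S)" for f'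
    using has_derivative_transform[of x S g f f'] has_derivative_transform[of x S f g f'] assms by auto
  then show ?thesis by (simp add: Dw_def frechet_derivative_def)
qed

text \<open>Uniqueness of the derivative within \<open>S\<close> makes the derivative of every local
  extension agree with that of \<open>f\<close> along \<open>S\<close>. Calculus up to the boundary
  is thereby reduced to open sets.\<close>

lemma smooth_on_extension:
  assumes S: "plane_open S" and f: "smooth_on S f" and x: "x \<in> S"
  obtains V g where "open V" "x \<in> V" "Cinf_on g V" "\<And>y. y \<in> S \<inter> V \<Longrightarrow> g y = f y"
    "\<And>y. y \<in> S \<inter> V \<Longrightarrow> (f has_derivative frechet_derivative g (at y)) (at y within S)"
    "\<And>y. y \<in> S \<inter> V \<Longrightarrow> Dw S f y = frechet_derivative g (at y)"
proof -
  obtain V g where V: "open V" "x \<in> V" "Cinf_on g V" "\<And>y. y \<in> S \<inter> V \<Longrightarrow> g y = f y"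
    using f x unfolding smooth_on_def Cinf_on_def by meson
  have d: "(f has_derivative frechet_derivative g (at y)) (at y within S)" if y: "y \<in> S \<inter> V" for y
  proof -
    have gd: "(g has_derivative frechet_derivative g (at y)) (at y within S)"
      using Cinf_on_has_derivative[OF V(3)] y by (auto intro: has_derivative_at_withinI)
    obtain e where e: "e > 0" "ball y e \<subseteq> V" using V(1) y open_contains_ball by blast
    show ?thesis
      by (rule has_derivative_transform_within[OF gd e(1)]) (use V(4) y e in \<open>auto simp: dist_commute subset_eq\<close>)
  qed
  show ?thesis by (rule that[OF V d]) (use d Dw_eqI[OF S] in auto)
qed

lemma smooth_on_has_derivative:
  assumes "plane_open S" "smooth_on S f" "x \<in> S"
  shows "(f has_derivative Dw S f x) (at x within S)"
  by (rule smooth_on_extension[OF assms]) (use assms(3) in fastforce)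

lemma smooth_on_Dw:
  assumes S: "plane_open S" and f: "smooth_on S f"
  shows "smooth_on S (\<lambda>x. Dw S f x w)"
  unfolding smooth_on_def
proof
  fix x assume "x \<in> S"
  from smooth_on_extension[OF S f this] obtain V g where "open V" "x \<in> V" "Cinf_on g V"
    "\<And>y. y \<in> S \<inter> V \<Longrightarrow> Dw S f y = frechet_derivative g (at y)" by metis
  then show "\<exists>V g. open V \<and> x \<in> V \<and> (\<forall>k. Ck_on k g V) \<and> (\<forall>y\<in>S \<inter> V. g y = Dw S f y w)"
    using Cinf_on_frechet[of g V w] unfolding Cinf_on_def
    by (intro exI[of _ V] exI[of _ "\<lambda>x. frechet_derivative g (at x) w"]) auto
qed

lemma smooth_on_continuous:
  assumes "plane_open S" "smooth_on S f" shows "continuous_on S f"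
  using smooth_on_has_derivative[OF assms] has_derivative_continuous
  unfolding continuous_on_eq_continuous_within by blast

lemma smooth_on_subset:
  assumes "smooth_on S f" "T \<subseteq> S" shows "smooth_on T f"
  unfolding smooth_on_def
proof
  fix x assume "x \<in> T"
  then have "x \<in> S" using assms(2) by blast
  from bspec[OF assms(1)[unfolded smooth_on_def] this]
  obtain V g where V: "open V" "x \<in> V" "\<forall>k. Ck_on k g V" "\<forall>y\<in>S \<inter> V. g y = f y"
    by (elim exE conjE)
  have "\<forall>y\<in>T \<inter> V. g y = f y" using V(4) assms(2) by auto
  then show "\<exists>V g. open V \<and> x \<in> V \<and> (\<forall>k. Ck_on k g V) \<and> (\<forall>y\<in>T \<inter> V. g y = f y)"
    using V(1-3) by (intro exI[of _ V] exI[of _ g] conjI)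
qed

text \<open>The part of a chart image off the boundary line. It is open in the plane, and the
  maximum principle is applied only there.\<close>

definition upper :: "(real^2) set \<Rightarrow> (real^2) set" where
  "upper S = S \<inter> {x. 0 < x $ 2}"

lemma open_upper:
  assumes "plane_open S" shows "open (upper S)"
proof -
  obtain O' where O': "open O'" "S = half_plane \<inter> O'"
    using assms unfolding plane_open_def openin_open by auto
  have "upper S = O' \<inter> {x. 0 < x $ 2}" using O'(2) by (auto simp: upper_def half_plane_def)
  moreover have "open {x :: real^2. 0 < x $ 2}" by (intro open_Collect_less continuous_intros)
  ultimately show ?thesis using O'(1) by auto
qed

lemma Dw_upper: "plane_open S \<Longrightarrow> x \<in> upper S \<Longrightarrow> Dw S f x = frechet_derivative f (at x)"
  using open_upper[of S] at_within_open_subset[of x "upper S" S] by (simp add: Dw_def upper_def)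

lemma Cinf_on_upper: "plane_open S \<Longrightarrow> smooth_on S f \<Longrightarrow> Cinf_on f (upper S)"
  by (rule smooth_on_open_imp_Cinf_on[OF open_upper smooth_on_subset]) (auto simp: upper_def)

section \<open>Charts and curvature\<close>

lemma in_chart_at:
  assumes "surface_chart M \<kappa>" "p \<in> fst \<kappa>"
  shows "in_chart \<kappa> f (snd \<kappa> p) = f p"
proof -
  have "topspace (subtopology M (fst \<kappa>)) = fst \<kappa>"
    using assms(1) openin_subset by (fastforce simp: surface_chart_def)
  then have "inj_on (snd \<kappa>) (fst \<kappa>)"
    using assms(1) homeomorphic_imp_injective_map by (fastforce simp: surface_chart_def)
  then show ?thesis using assms(2) by (simp add: in_chart_def)
qed

lemma surface_chart_plane_open: "surface_chart M \<kappa> \<Longrightarrow> plane_open (chart_image \<kappa>)"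
  by (simp add: surface_chart_def plane_open_def)

lemma surface_chart_open_image:
  assumes \<kappa>: "surface_chart M \<kappa>" and W: "openin M W" "W \<subseteq> fst \<kappa>"
  shows "plane_open (snd \<kappa> ` W)"
proof -
  have "openin (subtopology M (fst \<kappa>)) W"
    using W by (auto simp: openin_subtopology)
  then have "openin (top_of_set (chart_image \<kappa>)) (snd \<kappa> ` W)"
    using \<kappa> homeomorphic_imp_open_map[unfolded open_map_def] by (auto simp: surface_chart_def)
  then show ?thesis
    using surface_chart_plane_open[OF \<kappa>] openin_trans unfolding plane_open_def by blast
qed

lemma surface_chart_open_preimage:
  assumes \<kappa>: "surface_chart M \<kappa>" and O': "open O'"
  shows "openin M {p \<in> fst \<kappa>. snd \<kappa> p \<in> O'}"
proof -
  have top: "topspace (subtopology M (fst \<kappa>)) = fst \<kappa>"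
    using \<kappa> openin_subset by (fastforce simp: surface_chart_def)
  have "continuous_map (subtopology M (fst \<kappa>)) (top_of_set (chart_image \<kappa>)) (snd \<kappa>)"
    using \<kappa> homeomorphic_imp_continuous_map by (auto simp: surface_chart_def)
  then have "continuous_map (subtopology M (fst \<kappa>)) euclidean (snd \<kappa>)"
    using continuous_map_into_fulltopology by blast
  from openin_continuous_map_preimage[OF this, of O'] O'
  have "openin (subtopology M (fst \<kappa>)) {p \<in> fst \<kappa>. snd \<kappa> p \<in> O'}" by (simp only: top open_openin)
  then show ?thesis using \<kappa> openin_trans_full by (auto simp: surface_chart_def)
qed

locale convex_surface =
  fixes M :: "'a topology" and \<A> :: "'a chart set" and \<psi> N :: "'a \<Rightarrow> real^3"
  assumes surf: "smooth_surface M \<A>" and imm: "immersion \<A> \<psi>" and gauss: "gauss_map \<A> \<psi> N"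
    and convex: "\<And>\<kappa> p v. \<kappa> \<in> \<A> \<Longrightarrow> p \<in> fst \<kappa> \<Longrightarrow> 0 \<le> scalar_second_ff \<kappa> \<psi> (N p) p v v"
begin

abbreviation "X \<kappa> \<equiv> in_chart \<kappa> \<psi>"
abbreviation "Nc \<kappa> \<equiv> in_chart \<kappa> N"
abbreviation "DX \<kappa> \<equiv> Dw (chart_image \<kappa>) (X \<kappa>)"
abbreviation "DN \<kappa> \<equiv> Dw (chart_image \<kappa>) (Nc \<kappa>)"

text \<open>The second fundamental form by Weingarten's formula, in the sign convention that makes
  it nonnegative. It needs neither projections nor second derivatives, so a change of charts is a
  plain chain rule.\<close>

definition h :: "'a chart \<Rightarrow> real^2 \<Rightarrow> real^2 \<Rightarrow> real^2 \<Rightarrow> real" where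
  "h \<kappa> x v w = DN \<kappa> x v \<bullet> DX \<kappa> x w"

text \<open>Has the same zeros as the Gauss curvature. Both off-diagonal entries appear because
  symmetry of \<open>h\<close> is derived only off the boundary.\<close>

definition \<Delta> :: "'a chart \<Rightarrow> real^2 \<Rightarrow> real" where
  "\<Delta> \<kappa> x = h \<kappa> x (axis 1 1) (axis 1 1) * h \<kappa> x (axis 2 1) (axis 2 1)
     - h \<kappa> x (axis 1 1) (axis 2 1) * h \<kappa> x (axis 2 1) (axis 1 1)"

context
  fixes \<kappa>
  assumes \<kappa>: "\<kappa> \<in> \<A>"
begin

lemma chart: "surface_chart M \<kappa>"
  using surf \<kappa> by (simp add: smooth_surface_def)

lemma po: "plane_open (chart_image \<kappa>)"
  by (rule surface_chart_plane_open[OF chart])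

lemma X_smooth: "smooth_on (chart_image \<kappa>) (X \<kappa>)" and N_smooth: "smooth_on (chart_image \<kappa>) (Nc \<kappa>)"
  using imm gauss \<kappa> by (simp_all add: immersion_def gauss_map_def smooth_map_def)

lemma differential_eq: "differential \<kappa> f p = Dw (chart_image \<kappa>) (in_chart \<kappa> f) (snd \<kappa> p)"
  by (rule ext) (simp add: differential_def Dw_def)

lemma at_chart: "p \<in> fst \<kappa> \<Longrightarrow> in_chart \<kappa> f (snd \<kappa> p) = f p"
  by (rule in_chart_at[OF chart])

lemma in_image: "p \<in> fst \<kappa> \<Longrightarrow> snd \<kappa> p \<in> chart_image \<kappa>"
  by (simp add: chart_image_def)

lemma in_imageE: "x \<in> chart_image \<kappa> \<Longrightarrow> (\<And>p. p \<in> fst \<kappa> \<Longrightarrow> x = snd \<kappa> p \<Longrightarrow> P) \<Longrightarrow> P"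
  by (auto simp: chart_image_def)

lemma DX_linear: "x \<in> chart_image \<kappa> \<Longrightarrow> linear (DX \<kappa> x)"
  using smooth_on_has_derivative[OF po X_smooth] has_derivative_linear by blast

lemma DN_linear: "x \<in> chart_image \<kappa> \<Longrightarrow> linear (DN \<kappa> x)"
  using smooth_on_has_derivative[OF po N_smooth] has_derivative_linear by blast

lemma DX_inj: "x \<in> chart_image \<kappa> \<Longrightarrow> inj (DX \<kappa> x)"
  using imm \<kappa> by (auto simp: immersion_def differential_eq elim!: in_imageE)

lemma Nc_unit: "x \<in> chart_image \<kappa> \<Longrightarrow> norm (Nc \<kappa> x) = 1"
  using gauss \<kappa> by (auto simp: gauss_map_def at_chart elim!: in_imageE)

lemma Nc_ortho: "x \<in> chart_image \<kappa> \<Longrightarrow> Nc \<kappa> x \<bullet> DX \<kappa> x v = 0"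
proof (elim in_imageE)
  fix p assume p: "p \<in> fst \<kappa>" "x = snd \<kappa> p"
  then have "N p \<in> orthogonal_comp (tangent_plane \<kappa> \<psi> p)" using gauss \<kappa> by (auto simp: gauss_map_def)
  then show ?thesis using p
    by (auto simp: orthogonal_comp_def orthogonal_def tangent_plane_def differential_eq at_chart inner_commute)
qed

lemma tangent_plane_eq:
  assumes p: "p \<in> fst \<kappa>" shows "tangent_plane \<kappa> \<psi> p = {y. N p \<bullet> y = 0}"
  unfolding tangent_plane_def differential_eq
  by (rule range_eq_normal_complement[OF DX_linear DX_inj])
    (use Nc_unit[OF in_image[OF p]] Nc_ortho[OF in_image[OF p]] in \<open>simp_all add: in_image p at_chart\<close>)

lemma N_inner: assumes "p \<in> fst \<kappa>" shows "N p \<bullet> N p = 1"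
  using Nc_unit[OF in_image[OF assms]] by (simp add: at_chart assms norm_eq_sqrt_inner)

lemma normal_line:
  assumes p: "p \<in> fst \<kappa>" and n: "n \<in> orthogonal_comp {y. N p \<bullet> y = 0}"
  shows "n = (n \<bullet> N p) *\<^sub>R N p"
proof -
  let ?d = "n - (n \<bullet> N p) *\<^sub>R N p"
  have t: "N p \<bullet> ?d = 0" by (simp add: inner_diff_right N_inner[OF p] inner_commute)
  then have "?d \<bullet> n = 0" using n by (auto simp: orthogonal_comp_def orthogonal_def)
  then have "?d \<bullet> ?d = 0" using t by (simp add: inner_diff_right inner_commute)
  then show ?thesis by simp
qed

lemma normal_part_eq:
  assumes p: "p \<in> fst \<kappa>" shows "normal_part \<kappa> \<psi> p Y = (Y \<bullet> N p) *\<^sub>R N p"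
  unfolding normal_part_def tangent_plane_eq[OF p]
proof (rule the_equality)
  show "(Y \<bullet> N p) *\<^sub>R N p \<in> orthogonal_comp {y. N p \<bullet> y = 0} \<and> Y - (Y \<bullet> N p) *\<^sub>R N p \<in> {y. N p \<bullet> y = 0}"
    by (auto simp: orthogonal_comp_def orthogonal_def inner_diff_right N_inner[OF p] inner_commute)
  fix n assume n: "n \<in> orthogonal_comp {y. N p \<bullet> y = 0} \<and> Y - n \<in> {y. N p \<bullet> y = 0}"
  then have "N p \<bullet> n = N p \<bullet> Y" by (simp add: inner_diff_right)
  then show "n = (Y \<bullet> N p) *\<^sub>R N p" using normal_line[OF p, of n] n by (metis inner_commute)
qed

text \<open>Differentiate the identity \<open>Nc \<kappa> y \<bullet> DX \<kappa> y w = 0\<close>;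
  uniqueness of the derivative makes this valid at boundary points too.\<close>

lemma second_derivative_normal:
  assumes x: "x \<in> chart_image \<kappa>"
  shows "Dw (chart_image \<kappa>) (\<lambda>y. DX \<kappa> y w) x v \<bullet> Nc \<kappa> x = - h \<kappa> x v w"
proof -
  let ?S = "chart_image \<kappa>"
  have "((\<lambda>y. Nc \<kappa> y \<bullet> DX \<kappa> y w) has_derivative
      (\<lambda>v. Nc \<kappa> x \<bullet> Dw ?S (\<lambda>y. DX \<kappa> y w) x v + DN \<kappa> x v \<bullet> DX \<kappa> x w)) (at x within ?S)"
    by (intro has_derivative_inner smooth_on_has_derivative[OF po] N_smooth smooth_on_Dw[OF po] X_smooth x)
  moreover have "((\<lambda>y. Nc \<kappa> y \<bullet> DX \<kappa> y w) has_derivative (\<lambda>v. 0)) (at x within ?S)"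
    by (rule has_derivative_transform[OF x _ has_derivative_const[of 0]]) (simp add: Nc_ortho)
  ultimately have "(\<lambda>v. Nc \<kappa> x \<bullet> Dw ?S (\<lambda>y. DX \<kappa> y w) x v + DN \<kappa> x v \<bullet> DX \<kappa> x w) = (\<lambda>v. 0)"
    by (rule has_derivative_unique_plane_open[OF po x])
  from fun_cong[OF this, of v] show ?thesis by (simp add: h_def inner_commute)
qed

lemma second_ff_eq:
  assumes p: "p \<in> fst \<kappa>" shows "second_ff \<kappa> \<psi> p v w = - h \<kappa> (snd \<kappa> p) v w *\<^sub>R N p"
proof -
  have "differential \<kappa> (\<lambda>q. differential \<kappa> \<psi> q w) p v
      = Dw (chart_image \<kappa>) (\<lambda>y. DX \<kappa> y w) (snd \<kappa> p) v"
    unfolding differential_eq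
    by (rule fun_cong[OF Dw_cong]) (auto simp: in_image p at_chart elim!: in_imageE)
  then show ?thesis
    using second_derivative_normal[OF in_image[OF p], of w v]
    by (simp add: second_ff_def normal_part_eq[OF p] at_chart p)
qed

lemma scalar_second_ff_eq:
  "p \<in> fst \<kappa> \<Longrightarrow> scalar_second_ff \<kappa> \<psi> n p v w = h \<kappa> (snd \<kappa> p) v w * (N p \<bullet> n)"
  by (simp add: scalar_second_ff_def second_ff_eq)

lemma h_nonneg: "x \<in> chart_image \<kappa> \<Longrightarrow> 0 \<le> h \<kappa> x v v"
  using convex[OF \<kappa>] scalar_second_ff_eq N_inner by (force elim!: in_imageE)

lemma first_ff_eq: "first_ff \<kappa> \<psi> p v w = DX \<kappa> (snd \<kappa> p) v \<bullet> DX \<kappa> (snd \<kappa> p) w"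
  by (simp add: first_ff_def differential_eq)

lemma first_ff_det_pos:
  assumes "x \<in> chart_image \<kappa>"
  shows "(DX \<kappa> x (axis 1 1) \<bullet> DX \<kappa> x (axis 1 1)) * (DX \<kappa> x (axis 2 1) \<bullet> DX \<kappa> x (axis 2 1))
    - (DX \<kappa> x (axis 1 1) \<bullet> DX \<kappa> x (axis 2 1)) * (DX \<kappa> x (axis 1 1) \<bullet> DX \<kappa> x (axis 2 1)) > 0"
  by (rule gram_det_pos[OF DX_linear DX_inj]) (fact assms)+

lemma first_ff_matrix_det:
  assumes p: "p \<in> fst \<kappa>" shows "det (first_ff_matrix \<kappa> \<psi> p) > 0"
  using first_ff_det_pos[OF in_image[OF p]]
  by (simp add: det_2 first_ff_matrix_def first_ff_eq inner_commute)

text \<open>The normal space is a line, so the chart normal is \<open>N p\<close> up to sign. The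
  square is recorded since a determinant of order two scales by it.\<close>

lemma chart_normal_eq:
  assumes p: "p \<in> fst \<kappa>" shows "(N p \<bullet> chart_normal \<kappa> \<psi> p)\<^sup>2 = 1"
proof -
  let ?u = "DX \<kappa> (snd \<kappa> p) (axis 1 1)" and ?v = "DX \<kappa> (snd \<kappa> p) (axis 2 1)"
  let ?c = "cross3 ?u ?v"
  have "(norm ?c)\<^sup>2 > 0"
    using first_ff_det_pos[OF in_image[OF p]] unfolding norm_cross
    unfolding power2_norm_eq_inner
    by (simp add: power2_eq_square)
  then have c: "norm ?c \<noteq> 0" by force
  have "?c \<in> orthogonal_comp {y. N p \<bullet> y = 0}"
  proof -
    have "?c \<bullet> y = 0" if "N p \<bullet> y = 0" for y
    proof -
      have "y \<in> range (DX \<kappa> (snd \<kappa> p))"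
        using that tangent_plane_eq[OF p] by (simp add: tangent_plane_def differential_eq)
      then obtain a where "y = DX \<kappa> (snd \<kappa> p) a" by blast
      also have "\<dots> = a$1 *\<^sub>R ?u + a$2 *\<^sub>R ?v"
        using DX_linear[OF in_image[OF p]] by (subst vec2_eq_axis[of a]) (simp add: linear_add linear_scale)
      finally show ?thesis by (simp add: inner_add_right dot_cross_self)
    qed
    then show ?thesis by (auto simp: orthogonal_comp_def orthogonal_def inner_commute)
  qed
  from normal_line[OF p this] have "norm ?c = \<bar>?c \<bullet> N p\<bar> * norm (N p)" by (metis norm_scaleR)
  then have "\<bar>?c \<bullet> N p\<bar> = norm ?c" using N_inner[OF p] by (simp add: norm_eq_sqrt_inner)
  then have "\<bar>N p \<bullet> chart_normal \<kappa> \<psi> p\<bar> = 1"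
    using c by (simp add: chart_normal_def differential_eq sgn_div_norm abs_mult inner_commute)
  then show ?thesis by (metis one_power2 power2_abs)
qed

lemma chart_gauss_curvature_eq_0_iff:
  assumes p: "p \<in> fst \<kappa>" shows "chart_gauss_curvature \<kappa> \<psi> p = 0 \<longleftrightarrow> \<Delta> \<kappa> (snd \<kappa> p) = 0"
proof -
  let ?c = "N p \<bullet> chart_normal \<kappa> \<psi> p"
  have "det (\<chi> i j. scalar_second_ff \<kappa> \<psi> (chart_normal \<kappa> \<psi> p) p (axis i 1) (axis j 1))
    = ?c\<^sup>2 * \<Delta> \<kappa> (snd \<kappa> p)"
    by (simp add: det_2 scalar_second_ff_eq[OF p] \<Delta>_def algebra_simps power2_eq_square)
  then have "chart_gauss_curvature \<kappa> \<psi> p = det (matrix_inv (first_ff_matrix \<kappa> \<psi> p)) * \<Delta> \<kappa> (snd \<kappa> p)"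
    by (simp add: chart_gauss_curvature_def det_mul chart_normal_eq[OF p])
  then show ?thesis using matrix_inv_2(2)[of "first_ff_matrix \<kappa> \<psi> p"] first_ff_matrix_det[OF p] by simp
qed

lemma h_linear: "x \<in> chart_image \<kappa> \<Longrightarrow> linear (\<lambda>v. h \<kappa> x v w)" "x \<in> chart_image \<kappa> \<Longrightarrow> linear (h \<kappa> x v)"
  using DN_linear[of x] DX_linear[of x]
  by (auto intro!: linearI simp: h_def[abs_def] linear_add linear_scale inner_add_left inner_add_right)

lemma h_expand:
  assumes x: "x \<in> chart_image \<kappa>"
  shows "h \<kappa> x v w = v$1 * (w$1 * h \<kappa> x (axis 1 1) (axis 1 1) + w$2 * h \<kappa> x (axis 1 1) (axis 2 1))
    + v$2 * (w$1 * h \<kappa> x (axis 2 1) (axis 1 1) + w$2 * h \<kappa> x (axis 2 1) (axis 2 1))"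
proof -
  have 1: "h \<kappa> x v w = v$1 * h \<kappa> x (axis 1 1) w + v$2 * h \<kappa> x (axis 2 1) w"
    by (subst vec2_eq_axis[of v]) (simp only: linear_add[OF h_linear(1)[OF x]] linear_scale[OF h_linear(1)[OF x]] real_scaleR_def)
  have 2: "h \<kappa> x u w = w$1 * h \<kappa> x u (axis 1 1) + w$2 * h \<kappa> x u (axis 2 1)" for u
    by (subst vec2_eq_axis[of w]) (simp only: linear_add[OF h_linear(2)[OF x]] linear_scale[OF h_linear(2)[OF x]] real_scaleR_def)
  show ?thesis by (simp only: 1 2[of "axis 1 1"] 2[of "axis 2 1"])
qed

text \<open>A nontrivial kernel is a condition free of coordinates and hence transfers between
  charts. Kernel vectors are read off from a nonzero column; if there is none, the form is
  zero.\<close>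

lemma \<Delta>_eq_0_iff:
  assumes x: "x \<in> chart_image \<kappa>"
  shows "\<Delta> \<kappa> x = 0 \<longleftrightarrow> (\<exists>v. v \<noteq> 0 \<and> (\<forall>w. h \<kappa> x v w = 0))"
proof
  let ?a = "h \<kappa> x (axis 1 1) (axis 1 1)" and ?b = "h \<kappa> x (axis 1 1) (axis 2 1)"
    and ?c = "h \<kappa> x (axis 2 1) (axis 1 1)" and ?d = "h \<kappa> x (axis 2 1) (axis 2 1)"
  {
    assume z: "\<Delta> \<kappa> x = 0"
    then have z: "?a * ?d = ?b * ?c" by (simp add: \<Delta>_def)
    consider "?c \<noteq> 0 \<or> ?a \<noteq> 0" | "?d \<noteq> 0 \<or> ?b \<noteq> 0" | "?a = 0" "?b = 0" "?c = 0" "?d = 0" by blast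
    then show "\<exists>v. v \<noteq> 0 \<and> (\<forall>w. h \<kappa> x v w = 0)"
    proof cases
      case 1
      show ?thesis
        by (rule exI[of _ "vector [?c, - ?a]"])
          (use 1 z in \<open>auto simp: vec_eq_iff forall_2 h_expand[OF x, of "vector [?c, - ?a]"] algebra_simps\<close>)
    next
      case 2
      show ?thesis
        by (rule exI[of _ "vector [?d, - ?b]"])
          (use 2 z in \<open>auto simp: vec_eq_iff forall_2 h_expand[OF x, of "vector [?d, - ?b]"] algebra_simps\<close>)
    next
      case 3
      then have "h \<kappa> x (axis 1 1) w = 0" for w using h_expand[OF x, of "axis 1 1" w] by simp
      then show ?thesis by (intro exI[of _ "axis 1 1"]) simp
    qed
  }
  {
    assume "\<exists>v. v \<noteq> 0 \<and> (\<forall>w. h \<kappa> x v w = 0)"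
    then obtain v where v: "v \<noteq> 0" "\<And>w. h \<kappa> x v w = 0" by blast
    have ax: "axis 1 (1::real) $ (2::2) = 0" "axis 2 (1::real) $ (1::2) = 0" by (simp_all add: axis_def)
    have "v$1 * ?a + v$2 * ?c = 0" "v$1 * ?b + v$2 * ?d = 0"
      using h_expand[OF x, of v "axis 1 1"] h_expand[OF x, of v "axis 2 1"] v(2)
      by (simp_all add: ax)
    then have "v$1 * \<Delta> \<kappa> x = 0" "v$2 * \<Delta> \<kappa> x = 0" unfolding \<Delta>_def by algebra+
    then show "\<Delta> \<kappa> x = 0" using v(1) by (auto simp: vec_eq_iff forall_2)
  }
qed

lemma \<Delta>_continuous: "continuous_on (chart_image \<kappa>) (\<Delta> \<kappa>)"
  unfolding \<Delta>_def h_def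
  by (intro continuous_intros smooth_on_continuous[OF po] smooth_on_Dw[OF po] X_smooth N_smooth)

end

end

section \<open>Independence of the chart and second derivatives off the boundary\<close>

context convex_surface
begin

lemma \<Delta>_chart_change:
  assumes \<kappa>: "\<kappa> \<in> \<A>" and \<mu>: "\<mu> \<in> \<A>" and p: "p \<in> fst \<kappa>" "p \<in> fst \<mu>" and z: "\<Delta> \<kappa> (snd \<kappa> p) = 0"
  shows "\<Delta> \<mu> (snd \<mu> p) = 0"
proof -
  let ?S = "snd \<kappa> ` (fst \<kappa> \<inter> fst \<mu>)" and ?x = "snd \<kappa> p"
  define \<tau> where "\<tau> = in_chart \<kappa> (snd \<mu>)"
  have open_int: "openin M (fst \<kappa> \<inter> fst \<mu>)"
    using chart[OF \<kappa>] chart[OF \<mu>] by (auto simp: surface_chart_def)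
  have S: "plane_open ?S" by (rule surface_chart_open_image[OF chart[OF \<kappa>] open_int]) simp
  have xS: "?x \<in> ?S" and sub: "?S \<subseteq> chart_image \<kappa>" using p by (auto simp: chart_image_def)
  have "smooth_on ?S \<tau>" using surf \<kappa> \<mu> by (simp add: smooth_surface_def \<tau>_def)
  from smooth_on_has_derivative[OF S this xS] obtain J where J: "(\<tau> has_derivative J) (at ?x within ?S)" by blast
  have \<tau>: "\<tau> (snd \<kappa> q) = snd \<mu> q" if "q \<in> fst \<kappa>" for q by (simp add: \<tau>_def at_chart \<kappa> that)
  have tsub: "\<tau> ` ?S \<subseteq> chart_image \<mu>" by (auto simp: \<tau> chart_image_def)
  have tx: "\<tau> ?x = snd \<mu> p" by (rule \<tau>[OF p(1)])
  have change: "Dw (chart_image \<kappa>) (in_chart \<kappa> f) ?x v = Dw (chart_image \<mu>) (in_chart \<mu> f) (snd \<mu> p) (J v)"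
    if f: "smooth_on (chart_image \<kappa>) (in_chart \<kappa> f)" "smooth_on (chart_image \<mu>) (in_chart \<mu> f)"
    for f :: "'a \<Rightarrow> real^3" and v
  proof -
    have 1: "(in_chart \<kappa> f has_derivative Dw (chart_image \<kappa>) (in_chart \<kappa> f) ?x) (at ?x within ?S)"
      by (rule has_derivative_subset[OF smooth_on_has_derivative[OF po[OF \<kappa>] f(1)] sub]) (use xS sub in blast)
    have "(in_chart \<mu> f has_derivative Dw (chart_image \<mu>) (in_chart \<mu> f) (\<tau> ?x)) (at (\<tau> ?x) within \<tau> ` ?S)"
      by (rule has_derivative_subset[OF smooth_on_has_derivative[OF po[OF \<mu>] f(2)] tsub]) (use xS tsub in blast)
    from diff_chain_within[OF J this]
    have "(in_chart \<kappa> f has_derivative Dw (chart_image \<mu>) (in_chart \<mu> f) (\<tau> ?x) \<circ> J) (at ?x within ?S)"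
      by (rule has_derivative_transform[OF xS, rotated]) (auto simp: \<tau> at_chart \<kappa> \<mu>)
    from has_derivative_unique_plane_open[OF S xS 1 this] show ?thesis by (simp add: tx)
  qed
  note DX_change = change[OF X_smooth[OF \<kappa>] X_smooth[OF \<mu>]]
    and DN_change = change[OF N_smooth[OF \<kappa>] N_smooth[OF \<mu>]]
  have linJ: "linear J" using J has_derivative_linear by blast
  \<comment> \<open>Injectivity of the transition derivative is inherited from the immersion,
    because \<open>DX\<close> in one chart is \<open>DX\<close> in the other after \<open>J\<close>;
    equal dimensions then give surjectivity.\<close>
  have "inj J"
    using DX_inj[OF \<kappa> in_image[OF \<kappa> p(1)]] by (auto simp: inj_def DX_change)
  then have "surj J" using linJ linear_injective_imp_surjective by blast
  obtain v where v: "v \<noteq> 0" "\<And>w. h \<kappa> ?x v w = 0"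
    using \<Delta>_eq_0_iff[OF \<kappa> in_image[OF \<kappa> p(1)]] z by blast
  have "h \<mu> (snd \<mu> p) (J v) w = 0" for w
  proof -
    obtain w' where "w = J w'" using \<open>surj J\<close> by (metis surjD)
    then show ?thesis using v(2)[of w'] by (simp add: h_def DX_change DN_change)
  qed
  moreover have "J v \<noteq> 0" using \<open>inj J\<close> linJ v(1) by (metis linear_injective_0)
  ultimately show ?thesis using \<Delta>_eq_0_iff[OF \<mu> in_image[OF \<mu> p(2)]] by blast
qed

text \<open>The chart picked by \<open>SOME\<close> in the definition is unknown; comparing it with
  \<open>\<kappa>\<close> in both directions removes the choice.\<close>

lemma gauss_curvature_eq_0_iff:
  assumes \<kappa>: "\<kappa> \<in> \<A>" and p: "p \<in> fst \<kappa>"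
  shows "gauss_curvature \<A> \<psi> p = 0 \<longleftrightarrow> \<Delta> \<kappa> (snd \<kappa> p) = 0"
proof -
  define \<mu> where "\<mu> = (SOME \<kappa>. \<kappa> \<in> \<A> \<and> p \<in> fst \<kappa>)"
  have \<mu>: "\<mu> \<in> \<A>" "p \<in> fst \<mu>"
    using someI[of "\<lambda>\<kappa>. \<kappa> \<in> \<A> \<and> p \<in> fst \<kappa>" \<kappa>] \<kappa> p by (auto simp: \<mu>_def)
  show ?thesis
    using \<Delta>_chart_change[OF \<kappa> \<mu>(1) p \<mu>(2)] \<Delta>_chart_change[OF \<mu>(1) \<kappa> \<mu>(2) p]
    by (auto simp: gauss_curvature_def \<mu>_def[symmetric] chart_gauss_curvature_eq_0_iff[OF \<mu>])
qed

lemma pd_X: "\<kappa> \<in> \<A> \<Longrightarrow> x \<in> upper (chart_image \<kappa>) \<Longrightarrow> pd i (X \<kappa>) x = DX \<kappa> x (axis i 1)"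
  by (simp add: pd_def Dw_upper[OF po])

lemma h_eq_pd:
  assumes \<kappa>: "\<kappa> \<in> \<A>" and x: "x \<in> upper (chart_image \<kappa>)"
  shows "- (pd j (pd i (X \<kappa>)) x \<bullet> Nc \<kappa> x) = h \<kappa> x (axis j 1) (axis i 1)"
proof -
  note U = open_upper[OF po[OF \<kappa>]] and XU = Cinf_on_upper[OF po[OF \<kappa>] X_smooth[OF \<kappa>]]
  have "pd j (pd i (X \<kappa>)) x = pd j (\<lambda>y. DX \<kappa> y (axis i 1)) x"
    by (rule pd_cong[OF U x pd_X[OF \<kappa>] Cinf_on_pd[OF XU]])
  also have "\<dots> = Dw (chart_image \<kappa>) (\<lambda>y. DX \<kappa> y (axis i 1)) x (axis j 1)"
    by (simp add: pd_def Dw_upper[OF po[OF \<kappa>] x])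
  finally show ?thesis
    using second_derivative_normal[OF \<kappa>, of x "axis i 1" "axis j 1"] x by (simp add: upper_def)
qed

lemma h_symmetric:
  assumes \<kappa>: "\<kappa> \<in> \<A>" and x: "x \<in> upper (chart_image \<kappa>)"
  shows "h \<kappa> x (axis i 1) (axis j 1) = h \<kappa> x (axis j 1) (axis i 1)"
proof -
  note U = open_upper[OF po[OF \<kappa>]] and XU = Cinf_on_upper[OF po[OF \<kappa>] X_smooth[OF \<kappa>]]
  \<comment> \<open>\<open>pd_commute\<close> concerns real functions, so the vector identity is
    tested against the fixed vector \<open>Nc \<kappa> x\<close>.\<close>
  define b where "b = Nc \<kappa> x"
  have Xb: "Cinf_on (\<lambda>y. X \<kappa> y \<bullet> b) (upper (chart_image \<kappa>))" using U XU by simp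
  have "pd j (pd i (\<lambda>y. X \<kappa> y \<bullet> b)) x = pd j (pd i (X \<kappa>)) x \<bullet> b" for i j
  proof -
    have "pd j (pd i (\<lambda>y. X \<kappa> y \<bullet> b)) x = pd j (\<lambda>y. pd i (X \<kappa>) y \<bullet> b) x"
      by (rule pd_cong[OF U x pd_inner_const[OF XU] Cinf_on_pd[OF Xb]])
    then show ?thesis by (simp add: pd_inner_const[OF Cinf_on_pd[OF XU] x])
  qed
  then have "pd j (pd i (X \<kappa>)) x \<bullet> b = pd i (pd j (X \<kappa>)) x \<bullet> b"
    using pd_commute[OF U Xb x, of i j] by metis
  then show ?thesis using h_eq_pd[OF \<kappa> x, of i j] h_eq_pd[OF \<kappa> x, of j i] by (simp add: b_def)
qed

end

section \<open>Propagation of the zero set\<close>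

locale phi_surface = convex_surface M \<A> \<psi> N
  for M :: "'a topology" and \<A> :: "'a chart set" and \<psi> N :: "'a \<Rightarrow> real^3" +
  fixes F F1 F2 :: "real \<Rightarrow> real" and T :: "real set"
  assumes mean: "\<And>\<kappa> p. \<kappa> \<in> \<A> \<Longrightarrow> p \<in> fst \<kappa> \<Longrightarrow>
      mean_curvature_vector \<kappa> \<psi> p = F (\<psi> p $ 3) *\<^sub>R normal_part \<kappa> \<psi> p (axis 3 1)"
    and height: "\<And>p. p \<in> topspace M \<Longrightarrow> \<psi> p $ 3 \<in> T"
    and F: "\<And>\<tau>. \<tau> \<in> T \<Longrightarrow> (F has_real_derivative F1 \<tau>) (at \<tau>)" "Cinf_on F T"
    and F1: "\<And>\<tau>. \<tau> \<in> T \<Longrightarrow> (F1 has_real_derivative F2 \<tau>) (at \<tau>)" "Cinf_on F1 T"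
    and F_pos: "\<And>\<tau>. \<tau> \<in> T \<Longrightarrow> F \<tau> > 0" and F2_le: "\<And>\<tau>. \<tau> \<in> T \<Longrightarrow> F2 \<tau> \<le> 0"
begin

text \<open>Pair the vector equation with \<open>N\<close> and multiply by the determinant of the
  metric. The minus sign comes from \<open>second_ff_eq\<close>; the two mixed terms stay apart
  because boundary points are included.\<close>

lemma mean_curvature_equation:
  assumes \<kappa>: "\<kappa> \<in> \<A>" and x: "x \<in> chart_image \<kappa>"
  defines "g \<equiv> \<lambda>i j. DX \<kappa> x (axis i 1) \<bullet> DX \<kappa> x (axis j 1)"
    and "k \<equiv> \<lambda>i j. h \<kappa> x (axis i 1) (axis j 1)"
  shows "g 2 2 * k 1 1 - g 1 2 * k 1 2 - g 1 2 * k 2 1 + g 1 1 * k 2 2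
    = - ((g 1 1 * g 2 2 - g 1 2 * g 1 2) * F (X \<kappa> x \<bullet> axis 3 1) * (Nc \<kappa> x \<bullet> axis 3 1))"
proof -
  obtain p where p: "p \<in> fst \<kappa>" "x = snd \<kappa> p" using in_imageE[OF \<kappa> x] .
  let ?G = "first_ff_matrix \<kappa> \<psi> p"
  have G: "?G $ i $ j = g i j" for i j by (simp add: first_ff_matrix_def first_ff_eq[OF \<kappa>] g_def p)
  have det: "det ?G = g 1 1 * g 2 2 - g 1 2 * g 1 2" by (simp add: det_2 G) (simp add: g_def inner_commute)
  have d: "det ?G > 0" by (rule first_ff_matrix_det[OF \<kappa> p(1)])
  have "mean_curvature_vector \<kappa> \<psi> p \<bullet> N p
      = - (\<Sum>i\<in>UNIV. \<Sum>j\<in>UNIV. matrix_inv ?G $ i $ j * k i j)"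
    by (simp add: mean_curvature_vector_def inner_sum_left second_ff_eq[OF \<kappa> p(1)] N_inner[OF \<kappa> p(1)]
        k_def p(2) sum_negf)
  also have "\<dots> = - ((g 2 2 * k 1 1 - g 1 2 * k 1 2 - g 2 1 * k 2 1 + g 1 1 * k 2 2) / det ?G)"
    using d by (simp add: matrix_inv_2 sum_2 G field_simps)
  also have "g 2 1 = g 1 2" by (simp add: g_def inner_commute)
  finally have "- ((g 2 2 * k 1 1 - g 1 2 * k 1 2 - g 1 2 * k 2 1 + g 1 1 * k 2 2) / det ?G)
      = F (\<psi> p $ 3) * (N p \<bullet> axis 3 1)"
    using mean[OF \<kappa> p(1)] by (simp add: normal_part_eq[OF \<kappa> p(1)] N_inner[OF \<kappa> p(1)] inner_commute)
  then have "g 2 2 * k 1 1 - g 1 2 * k 1 2 - g 1 2 * k 2 1 + g 1 1 * k 2 2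
      = - (det ?G * (F (\<psi> p $ 3) * (N p \<bullet> axis 3 1)))"
    using d by (simp add: field_simps)
  then show ?thesis unfolding det p(2) by (simp add: at_chart[OF \<kappa> p(1)] inner_axis mult.assoc)
qed

lemma \<Delta>_zero_open:
  assumes \<kappa>: "\<kappa> \<in> \<A>" and x0: "x0 \<in> upper (chart_image \<kappa>)" "\<Delta> \<kappa> x0 = 0"
  shows "\<exists>d>0. ball x0 d \<subseteq> upper (chart_image \<kappa>) \<and> (\<forall>x\<in>ball x0 d. \<Delta> \<kappa> x = 0)"
proof -
  let ?U = "upper (chart_image \<kappa>)"
  have US: "x \<in> chart_image \<kappa>" if "x \<in> ?U" for x using that by (simp add: upper_def)
  note hp = h_eq_pd[OF \<kappa>] and pX = pd_X[OF \<kappa>]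
  have \<Delta>: "- (pd 1 (pd 1 (X \<kappa>)) x \<bullet> Nc \<kappa> x) * - (pd 2 (pd 2 (X \<kappa>)) x \<bullet> Nc \<kappa> x)
      - - (pd 2 (pd 1 (X \<kappa>)) x \<bullet> Nc \<kappa> x) * - (pd 2 (pd 1 (X \<kappa>)) x \<bullet> Nc \<kappa> x) = \<Delta> \<kappa> x" if "x \<in> ?U" for x
    unfolding hp[OF that] \<Delta>_def using h_symmetric[OF \<kappa> that, of 1 2] by simp
  have "\<exists>d>0. ball x0 d \<subseteq> ?U \<and> (\<forall>x\<in>ball x0 d.
      - (pd 1 (pd 1 (X \<kappa>)) x \<bullet> Nc \<kappa> x) * - (pd 2 (pd 2 (X \<kappa>)) x \<bullet> Nc \<kappa> x)
      - - (pd 2 (pd 1 (X \<kappa>)) x \<bullet> Nc \<kappa> x) * - (pd 2 (pd 1 (X \<kappa>)) x \<bullet> Nc \<kappa> x) = 0)"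
  proof (rule parametric_constant_rank[OF open_upper[OF po[OF \<kappa>]] Cinf_on_upper[OF po[OF \<kappa>] X_smooth[OF \<kappa>]]
        Cinf_on_upper[OF po[OF \<kappa>] N_smooth[OF \<kappa>]] _ _ _ _ _ F F1 F_pos F2_le _ x0(1), where e="axis 3 1"])
    fix x assume x: "x \<in> ?U"
    show "pd 1 (X \<kappa>) x \<bullet> pd 1 (X \<kappa>) x * (pd 2 (X \<kappa>) x \<bullet> pd 2 (X \<kappa>) x)
        - pd 1 (X \<kappa>) x \<bullet> pd 2 (X \<kappa>) x * (pd 1 (X \<kappa>) x \<bullet> pd 2 (X \<kappa>) x) > 0"
      unfolding pX[OF x] by (rule first_ff_det_pos[OF \<kappa> US[OF x]])
    show "norm (Nc \<kappa> x) = 1" by (rule Nc_unit[OF \<kappa> US[OF x]])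
    show "Nc \<kappa> x \<bullet> pd i (X \<kappa>) x = 0" for i unfolding pX[OF x] by (rule Nc_ortho[OF \<kappa> US[OF x]])
    show "0 \<le> - (pd 1 (pd 1 (X \<kappa>)) x \<bullet> Nc \<kappa> x) * a\<^sup>2 + 2 * - (pd 2 (pd 1 (X \<kappa>)) x \<bullet> Nc \<kappa> x) * (a * b)
        + - (pd 2 (pd 2 (X \<kappa>)) x \<bullet> Nc \<kappa> x) * b\<^sup>2" for a b
      unfolding hp[OF x]
      using h_nonneg[OF \<kappa> US[OF x], of "vector [a, b]"] h_symmetric[OF \<kappa> x, of 1 2]
      by (simp add: h_expand[OF \<kappa> US[OF x], of "vector [a, b]"] algebra_simps power2_eq_square)
    show "pd 2 (X \<kappa>) x \<bullet> pd 2 (X \<kappa>) x * - (pd 1 (pd 1 (X \<kappa>)) x \<bullet> Nc \<kappa> x)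
        - 2 * (pd 1 (X \<kappa>) x \<bullet> pd 2 (X \<kappa>) x) * - (pd 2 (pd 1 (X \<kappa>)) x \<bullet> Nc \<kappa> x)
        + pd 1 (X \<kappa>) x \<bullet> pd 1 (X \<kappa>) x * - (pd 2 (pd 2 (X \<kappa>)) x \<bullet> Nc \<kappa> x)
      = - ((pd 1 (X \<kappa>) x \<bullet> pd 1 (X \<kappa>) x * (pd 2 (X \<kappa>) x \<bullet> pd 2 (X \<kappa>) x)
        - pd 1 (X \<kappa>) x \<bullet> pd 2 (X \<kappa>) x * (pd 1 (X \<kappa>) x \<bullet> pd 2 (X \<kappa>) x))
          * F (X \<kappa> x \<bullet> axis 3 1) * (Nc \<kappa> x \<bullet> axis 3 1))"
      unfolding hp[OF x] pX[OF x]
      using mean_curvature_equation[OF \<kappa> US[OF x], unfolded h_symmetric[OF \<kappa> x, of 1 2]]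
      by (simp only: mult.assoc mult_2 distrib_right)
    show "X \<kappa> x \<bullet> axis 3 1 \<in> T"
    proof -
      obtain p where p: "p \<in> fst \<kappa>" "x = snd \<kappa> p" using in_imageE[OF \<kappa> US[OF x]] .
      have "p \<in> topspace M" using chart[OF \<kappa>] p openin_subset by (auto simp: surface_chart_def)
      then show ?thesis using height p by (simp add: at_chart[OF \<kappa>] inner_axis)
    qed
  qed (use \<Delta>[OF x0(1)] x0(2) in auto)
  then obtain d where d: "d > 0" "ball x0 d \<subseteq> ?U" "\<And>x. x \<in> ball x0 d \<Longrightarrow>
      - (pd 1 (pd 1 (X \<kappa>)) x \<bullet> Nc \<kappa> x) * - (pd 2 (pd 2 (X \<kappa>)) x \<bullet> Nc \<kappa> x)
      - - (pd 2 (pd 1 (X \<kappa>)) x \<bullet> Nc \<kappa> x) * - (pd 2 (pd 1 (X \<kappa>)) x \<bullet> Nc \<kappa> x) = 0" by blast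
  have "\<Delta> \<kappa> x = 0" if x: "x \<in> ball x0 d" for x
    using \<Delta>[of x] d(2) d(3)[OF x] x by (metis subsetD)
  then show ?thesis using d by blast
qed

text \<open>The interior of the half ball is connected, and the boundary part follows by continuity.\<close>

lemma \<Delta>_zero_half_ball:
  assumes \<kappa>: "\<kappa> \<in> \<A>" and r: "ball x r \<inter> half_plane \<subseteq> chart_image \<kappa>"
    and y: "y \<in> ball x r \<inter> half_plane" "d > 0" "\<And>z. z \<in> ball y d \<inter> half_plane \<Longrightarrow> \<Delta> \<kappa> z = 0"
    and z: "z \<in> ball x r \<inter> half_plane"
  shows "\<Delta> \<kappa> z = 0"
proof -
  let ?e = "axis 2 1 :: real^2"
  define B where "B = ball x r \<inter> {x :: real^2. 0 < x $ 2}"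
  \<comment> \<open>Moving slightly upwards from any point of the half ball leads into the open set
    \<open>B\<close>. This serves to enter \<open>B\<close> near \<open>y\<close> and, at the end,
    to reach \<open>z\<close> as a limit.\<close>
  have up: "\<exists>\<delta>>0. \<forall>t. 0 < t \<and> t < \<delta> \<longrightarrow> w + t *\<^sub>R ?e \<in> B \<inter> ball w s"
    if w: "w \<in> ball x r \<inter> half_plane" and s: "s > 0" for w s
  proof -
    obtain \<delta> where \<delta>: "\<delta> > 0" "ball w \<delta> \<subseteq> ball x r" using w open_ball open_contains_ball by blast
    have "w + t *\<^sub>R ?e \<in> B \<inter> ball w s" if "0 < t" "t < min \<delta> s" for t
    proof -
      have "w + t *\<^sub>R ?e \<in> ball w \<delta> \<inter> ball w s" using that by (simp add: dist_norm norm_axis_1)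
      moreover have "0 < (w + t *\<^sub>R ?e) $ 2" using w that by (simp add: half_plane_def axis_def)
      ultimately show ?thesis using \<delta> by (auto simp: B_def)
    qed
    then show ?thesis using \<delta> s by (intro exI[of _ "min \<delta> s"]) auto
  qed
  have Bsub: "B \<subseteq> upper (chart_image \<kappa>)" using r by (auto simp: B_def upper_def half_plane_def)
  define Z where "Z = {w \<in> B. \<Delta> \<kappa> w = 0}"
  have "open B" unfolding B_def by (intro open_Int open_ball open_Collect_less continuous_intros)
  have "convex {x :: real^2. 0 < x $ 2}" using convex_halfspace_gt[of 0 ?e] by (simp add: inner_axis inner_commute)
  then have "connected B" unfolding B_def by (intro convex_connected convex_Int convex_ball)
  have contB: "continuous_on B (\<Delta> \<kappa>)"
    by (rule continuous_on_subset[OF \<Delta>_continuous[OF \<kappa>]]) (use Bsub in \<open>auto simp: upper_def\<close>)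
  have "closedin (top_of_set B) Z"
    unfolding Z_def by (rule continuous_closedin_preimage_constant[OF contB])
  moreover have "open Z"
    unfolding open_contains_ball
  proof
    fix w assume w: "w \<in> Z"
    then obtain d1 where d1: "d1 > 0" "\<forall>v\<in>ball w d1. \<Delta> \<kappa> v = 0"
      using \<Delta>_zero_open[OF \<kappa>, of w] Bsub by (auto simp: Z_def)
    obtain d2 where d2: "d2 > 0" "ball w d2 \<subseteq> B"
      using w \<open>open B\<close> open_contains_ball[of B] by (auto simp: Z_def)
    show "\<exists>e>0. ball w e \<subseteq> Z"
      by (rule exI[of _ "min d1 d2"]) (use d1 d2 in \<open>auto simp: Z_def subset_eq\<close>)
  qed
  then have "openin (top_of_set B) Z" using \<open>open B\<close> by (auto simp: openin_open_eq Z_def)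
  ultimately have "Z = {} \<or> Z = B" using \<open>connected B\<close> by (auto simp: connected_clopen)
  moreover have "Z \<noteq> {}"
  proof -
    obtain \<delta> where "\<delta> > 0" "\<forall>t. 0 < t \<and> t < \<delta> \<longrightarrow> y + t *\<^sub>R ?e \<in> B \<inter> ball y d" using up[OF y(1,2)] by blast
    then have "y + (\<delta> / 2) *\<^sub>R ?e \<in> B \<inter> ball y d" by simp
    then have "y + (\<delta> / 2) *\<^sub>R ?e \<in> Z" using y(3) by (auto simp: Z_def B_def half_plane_def)
    then show ?thesis by blast
  qed
  ultimately have ZB: "Z = B" by blast
  obtain \<delta> where \<delta>: "\<delta> > 0" "\<forall>t. 0 < t \<and> t < \<delta> \<longrightarrow> z + t *\<^sub>R ?e \<in> B \<inter> ball z 1" using up[OF z, of 1] by auto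
  define a where "a n = z + (\<delta> / 2 * inverse (real (Suc n))) *\<^sub>R ?e" for n
  have aB: "a n \<in> B" for n
  proof -
    have "\<delta> / 2 * inverse (real (Suc n)) \<le> \<delta> / 2 * 1"
      using \<delta> by (intro mult_left_mono) (auto simp: field_simps)
    then show ?thesis using \<delta> by (simp add: a_def)
  qed
  have "(\<lambda>n. z + (\<delta> / 2 * inverse (real (Suc n))) *\<^sub>R ?e) \<longlonglongrightarrow> z + (\<delta> / 2 * 0) *\<^sub>R ?e"
    by (intro tendsto_intros LIMSEQ_inverse_real_of_nat)
  then have a: "a \<longlonglongrightarrow> z" by (simp add: a_def[abs_def])
  have "(\<lambda>n. \<Delta> \<kappa> (a n)) \<longlonglongrightarrow> \<Delta> \<kappa> z"
    by (rule continuous_on_tendsto_compose[OF \<Delta>_continuous[OF \<kappa>] a])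
      (use z r aB Bsub in \<open>auto simp: upper_def intro!: always_eventually\<close>)
  moreover have "(\<lambda>n. \<Delta> \<kappa> (a n)) = (\<lambda>n. 0)" using aB ZB by (auto simp: Z_def)
  ultimately show ?thesis using LIMSEQ_unique[OF _ tendsto_const] by metis
qed

text \<open>\<open>W\<close> is the interior of the zero set: open by construction, closed by the
  half-ball lemma, and nonempty because the constant rank theorem applies at an interior
  zero.\<close>

theorem gauss_curvature_zero_everywhere:
  assumes conn: "connected_space M" and ex: "\<exists>p\<in>surface_interior \<A>. gauss_curvature \<A> \<psi> p = 0"
    and p: "p \<in> topspace M"
  shows "gauss_curvature \<A> \<psi> p = 0"
proof -
  define W where "W = \<Union>{O'. openin M O' \<and> (\<forall>q\<in>O'. gauss_curvature \<A> \<psi> q = 0)}"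
  have W0: "gauss_curvature \<A> \<psi> q = 0" if "q \<in> W" for q using that by (auto simp: W_def)
  have WI: "q \<in> W" if "openin M O'" "\<And>q. q \<in> O' \<Longrightarrow> gauss_curvature \<A> \<psi> q = 0" "q \<in> O'" for q O'
    using that by (auto simp: W_def)
  have openW: "openin M W" unfolding W_def by (rule openin_Union) auto
  have covered: "\<exists>\<kappa>\<in>\<A>. q \<in> fst \<kappa>" if "q \<in> topspace M" for q
    using surf that by (auto simp: smooth_surface_def)
  have "q \<in> W" if q: "q \<in> M closure_of W" for q
  proof -
    obtain \<kappa> where \<kappa>: "\<kappa> \<in> \<A>" "q \<in> fst \<kappa>" using covered q in_closure_of by metis
    obtain r where r: "r > 0" "ball (snd \<kappa> q) r \<inter> half_plane \<subseteq> chart_image \<kappa>"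
      using plane_open_ball[OF po[OF \<kappa>(1)] in_image[OF \<kappa>]] .
    define O' where "O' = {s \<in> fst \<kappa>. snd \<kappa> s \<in> ball (snd \<kappa> q) r}"
    have O': "openin M O'" unfolding O'_def by (rule surface_chart_open_preimage[OF chart[OF \<kappa>(1)] open_ball])
    have qO: "q \<in> O'" using \<kappa> r by (simp add: O'_def)
    then obtain s where s: "s \<in> W" "s \<in> O'" using q O' by (auto simp: in_closure_of)
    have sub: "snd \<kappa> u \<in> half_plane" if "u \<in> fst \<kappa>" for u
      using in_image[OF \<kappa>(1) that] plane_open_subset[OF po[OF \<kappa>(1)]] by blast
    \<comment> \<open>Near \<open>s\<close> the curvature vanishes on a whole relative half ball,
      which is the starting region for spreading zeros over the half ball about
      \<open>q\<close>.\<close>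
    have "plane_open (snd \<kappa> ` (W \<inter> O'))"
      by (rule surface_chart_open_image[OF chart[OF \<kappa>(1)]]) (use openW O' in \<open>auto simp: O'_def\<close>)
    then obtain d where d: "d > 0" "ball (snd \<kappa> s) d \<inter> half_plane \<subseteq> snd \<kappa> ` (W \<inter> O')"
      by (rule plane_open_ball) (use s in auto)
    have zero: "\<Delta> \<kappa> z = 0" if z: "z \<in> ball (snd \<kappa> s) d \<inter> half_plane" for z
    proof -
      obtain u where "u \<in> W" "u \<in> fst \<kappa>" "z = snd \<kappa> u" using z d(2) by (auto simp: O'_def)
      then show ?thesis using W0 gauss_curvature_eq_0_iff[OF \<kappa>(1)] by blast
    qed
    have "gauss_curvature \<A> \<psi> u = 0" if u: "u \<in> O'" for u
    proof -
      have "\<Delta> \<kappa> (snd \<kappa> u) = 0"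
        by (rule \<Delta>_zero_half_ball[OF \<kappa>(1) r(2) _ d(1) zero]) (use u s sub in \<open>auto simp: O'_def\<close>)
      then show ?thesis using gauss_curvature_eq_0_iff[OF \<kappa>(1)] u by (simp add: O'_def)
    qed
    then show ?thesis using WI[OF O' _ qO] by blast
  qed
  then have "closedin M W"
    using closure_of_subset[OF openin_subset[OF openW]] by (auto simp: closure_of_eq[symmetric])
  then have "W = {} \<or> W = topspace M" using conn openW by (auto simp: connected_space_clopen_in)
  moreover have "W \<noteq> {}"
  proof -
    obtain p0 \<kappa> where \<kappa>: "\<kappa> \<in> \<A>" "p0 \<in> fst \<kappa>" "0 < snd \<kappa> p0 $ 2" "gauss_curvature \<A> \<psi> p0 = 0"
      using ex by (auto simp: surface_interior_def)
    have "\<Delta> \<kappa> (snd \<kappa> p0) = 0" using gauss_curvature_eq_0_iff[OF \<kappa>(1,2)] \<kappa>(4) by simp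
    then obtain d where d: "d > 0" "\<forall>x\<in>ball (snd \<kappa> p0) d. \<Delta> \<kappa> x = 0"
      using \<Delta>_zero_open[OF \<kappa>(1), of "snd \<kappa> p0"] \<kappa>(3) in_image[OF \<kappa>(1,2)] by (auto simp: upper_def)
    have "p0 \<in> W"
    proof (rule WI[OF surface_chart_open_preimage[OF chart[OF \<kappa>(1)] open_ball]])
      show "p0 \<in> {s \<in> fst \<kappa>. snd \<kappa> s \<in> ball (snd \<kappa> p0) d}" using \<kappa> d by simp
    qed (use d gauss_curvature_eq_0_iff[OF \<kappa>(1)] in auto)
    then show ?thesis by blast
  qed
  ultimately show ?thesis using W0 p by blast
qed

end

theorem theorem2p5:
  fixes M :: "'a topology" and \<A> :: "'a chart set"
    and a b :: ereal and \<phi> :: "real \<Rightarrow> real" and \<psi> :: "'a \<Rightarrow> real^3"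
  assumes "smooth_surface M \<A>" and "connected_space M"
    and "smooth_on (einterval a b) \<phi>"
    and "strict_mono_on (einterval a b) \<phi>"
    and "\<And>t. t \<in> einterval a b \<Longrightarrow> (deriv ^^ 3) \<phi> t \<le> 0"
    and "immersion \<A> \<psi>"
    and "\<And>p. p \<in> topspace M \<Longrightarrow> \<psi> p $ 3 \<in> einterval a b"
    and "locally_convex \<A> \<psi>"
    and "phi_minimal \<A> \<phi> \<psi>"
    and "\<exists>p\<in>surface_interior \<A>. gauss_curvature \<A> \<psi> p = 0"
  shows "\<forall>p\<in>topspace M. gauss_curvature \<A> \<psi> p = 0"
proof -
  let ?T = "einterval a b"
  have T: "open ?T" by simp
  have \<phi>0: "Cinf_on \<phi> ?T" by (rule smooth_on_open_imp_Cinf_on[OF T assms(3)])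
  note \<phi>1 = Cinf_on_deriv[OF T \<phi>0]
  note \<phi>2 = Cinf_on_deriv[OF T \<phi>1(1)]
  note \<phi>3 = Cinf_on_deriv[OF T \<phi>2(1)]
  have le: "deriv (deriv (deriv \<phi>)) t \<le> 0" if "t \<in> ?T" for t
    using assms(5)[OF that] by (simp add: numeral_3_eq_3)
  \<comment> \<open>The derivative of \<open>\<phi>\<close> takes the role of \<open>F\<close>,
    whose positivity yields \<open>v \<ge> 0\<close> and forces \<open>v = 0\<close> at flat
    points.\<close>
  have pos: "deriv \<phi> t > 0" if "t \<in> ?T" for t
  proof (rule strict_mono_concave_derivative_pos[OF T _ \<phi>1(2) \<phi>2(2) \<phi>3(2) le assms(4) that])
    show "z \<in> ?T" if "x \<in> ?T" "y \<in> ?T" "x \<le> z" "z \<le> y" for x y z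
      using that unfolding einterval_iff by (meson ereal_less_eq(3) le_less_trans less_le_trans)
  qed
  obtain N where "gauss_map \<A> \<psi> N"
    "\<And>\<kappa> p v. \<kappa> \<in> \<A> \<Longrightarrow> p \<in> fst \<kappa> \<Longrightarrow> 0 \<le> scalar_second_ff \<kappa> \<psi> (N p) p v v"
    using assms(8) by (auto simp: locally_convex_def)
  then interpret phi_surface M \<A> \<psi> N "deriv \<phi>" "deriv (deriv \<phi>)" "deriv (deriv (deriv \<phi>))" ?T
    using assms(1,6,7,9) \<phi>1 \<phi>2 \<phi>3 pos le by unfold_locales (auto simp: phi_minimal_def)
  show ?thesis using gauss_curvature_zero_everywhere[OF assms(2,10)] by blast
qed

end
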